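(* Let $M$ be a three-dimensional compact connected manifold without boundary. The round category of $M$ (1) equals two if $M$ is homeomorphic to one of the following: (a) the sphere $S^3$; (b) $S^1\times S^2$; (c) the projective space $\mathbb{R}P^3$; (d) a lens space obtainable as a quotient of $S^3$ by a differentiable action of the group $\mathbb{Z}_p$; (2) equals three if $M$ is the torus $T^3$; (3) does not exceed four for all remaining $M$.
   Context: **$P$-category.** Let $X$ be a Hausdorff space and $P\subset X$ a closed subset. $P\text{-}\mathrm{cat}\,X$ is the minimal number $k$ of closed subsets $A_1,\dots,A_k$ of $X$ such that $X=\bigcup_{i=1}^k A_i$ and each $A_i$ is contractible within $X$ to $P$, i.e. for each $i$ there is a homotopy $F_i\colon A_i\times[0,1]\to X$ with $F_i(x,0)=x$ for $x\in A_i$, and $F_i(A_i\times\{1\})=P_i\subset X$ where $P_i$ is homeomorphic to $P$. If no such $k$ exists, $P\text{-}\mathrm{cat}\,X=\infty$. The **round category** of $X$ is the $P$-category of $X$ for $P$ the circle $S^1$. *)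

theory Defs
  imports "HOL-Analysis.Analysis" "HOL-Algebra.Group_Action" "HOL-Algebra.Elementary_Groups"
begin

section \<open>The $P$-category of a space\<close>

text \<open>
  \<open>P\<close> enters the definition only through its homeomorphism type, so it is an abstract topology
  rather than a distinguished closed subset of \<open>X\<close>.
\<close>

definition contractible_within_to :: "'a topology \<Rightarrow> 'a set \<Rightarrow> 'p topology \<Rightarrow> bool" where
  "contractible_within_to X A P \<longleftrightarrow>
     (\<exists>F. continuous_map (prod_topology (subtopology X A) (top_of_set {0..1::real})) X F \<and>
          (\<forall>x\<in>A. F (x, 0) = x) \<and>
          subtopology X (F ` (A \<times> {1})) homeomorphic_space P)"

text \<open>The infimum of the empty subset of \<^typ>\<open>enat\<close> is \<open>\<infinity>\<close>.\<close>

definition P_category :: "'p topology \<Rightarrow> 'a topology \<Rightarrow> enat" where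
  "P_category P X =
     Inf {enat k | k. \<exists>A :: nat \<Rightarrow> 'a set.
            (\<forall>i<k. closedin X (A i) \<and> contractible_within_to X (A i) P) \<and>
            topspace X = (\<Union>i<k. A i)}"

abbreviation circle :: "complex topology" where
  "circle \<equiv> top_of_set (sphere 0 1)"

definition round_category :: "'a topology \<Rightarrow> enat" where
  "round_category X = P_category circle X"


section \<open>Closed 3-manifolds\<close>

definition closed_connected_3_manifold :: "'a topology \<Rightarrow> bool" where
  "closed_connected_3_manifold M \<longleftrightarrow>
     Hausdorff_space M \<and> second_countable M \<and> compact_space M \<and> connected_space M \<and>
     topspace M \<noteq> {} \<and>
     (\<forall>x\<in>topspace M. \<exists>U V. openin M U \<and> x \<in> U \<and> open (V :: (real^3) set) \<and>
        subtopology M U homeomorphic_space top_of_set V)"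


section \<open>Model spaces\<close>

text \<open>The final topology on the image of \<open>f\<close>: the one making \<open>f\<close> a quotient map.\<close>

definition quotient_topology :: "'a topology \<Rightarrow> ('a \<Rightarrow> 'b) \<Rightarrow> 'b topology" where
  "quotient_topology X f =
     topology (\<lambda>U. U \<subseteq> f ` topspace X \<and> openin X {x \<in> topspace X. f x \<in> U})"

lemma openin_quotient_topology:
  "openin (quotient_topology X f) U \<longleftrightarrow>
     U \<subseteq> f ` topspace X \<and> openin X {x \<in> topspace X. f x \<in> U}"
proof -
  have "istopology (\<lambda>U. U \<subseteq> f ` topspace X \<and> openin X {x \<in> topspace X. f x \<in> U})"
    unfolding istopology_def
  proof (intro conjI allI impI)
    fix S T assume a: "S \<subseteq> f ` topspace X \<and> openin X {x \<in> topspace X. f x \<in> S}"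
      "T \<subseteq> f ` topspace X \<and> openin X {x \<in> topspace X. f x \<in> T}"
    show "S \<inter> T \<subseteq> f ` topspace X" using a by blast
    have "openin X ({x \<in> topspace X. f x \<in> S} \<inter> {x \<in> topspace X. f x \<in> T})"
      by (rule openin_Int) (use a in blast)+
    moreover have "{x \<in> topspace X. f x \<in> S \<inter> T} =
        {x \<in> topspace X. f x \<in> S} \<inter> {x \<in> topspace X. f x \<in> T}" by blast
    ultimately show "openin X {x \<in> topspace X. f x \<in> S \<inter> T}" by (simp only:)
  next
    fix K assume a: "\<forall>S\<in>K. S \<subseteq> f ` topspace X \<and> openin X {x \<in> topspace X. f x \<in> S}"
    show "\<Union>K \<subseteq> f ` topspace X" using a by blast
    have "{x \<in> topspace X. f x \<in> \<Union>K} = (\<Union>S\<in>K. {x \<in> topspace X. f x \<in> S})" by blast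
    then show "openin X {x \<in> topspace X. f x \<in> \<Union>K}" using a by auto
  qed
  then show ?thesis by (simp add: quotient_topology_def topology_inverse')
qed

lemma topspace_quotient_topology: "topspace (quotient_topology X f) = f ` topspace X"
proof (rule subset_antisym)
  show "topspace (quotient_topology X f) \<subseteq> f ` topspace X"
    by (metis openin_quotient_topology openin_topspace)
  have "{x \<in> topspace X. f x \<in> f ` topspace X} = topspace X" by blast
  then show "f ` topspace X \<subseteq> topspace (quotient_topology X f)"
    by (intro openin_subset) (simp add: openin_quotient_topology)
qed

lemma quotient_map_quotient_topology: "quotient_map X (quotient_topology X f) f"
  by (auto simp: quotient_map_def topspace_quotient_topology openin_quotient_topology)

definition orbit_space :: "('g, 'm) monoid_scheme \<Rightarrow> 'a topology \<Rightarrow> ('g \<Rightarrow> 'a \<Rightarrow> 'a) \<Rightarrow> 'a set topology"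
  where "orbit_space G X \<phi> = quotient_topology X (orbit G \<phi>)"

abbreviation S3 :: "(complex \<times> complex) set" where
  "S3 \<equiv> sphere 0 1"

definition real_projective_3_space :: "(complex \<times> complex) set topology" where
  "real_projective_3_space = quotient_topology (top_of_set S3) (\<lambda>x. {x, - x})"

text \<open>
  Differentiability relative to the subset \<open>S3\<close> of the ambient space (existence of a derivative
  within \<open>S3\<close>) is differentiability on the submanifold \<open>S3\<close>.
\<close>

definition differentiable_action_on_S3 ::
  "('g, 'm) monoid_scheme \<Rightarrow> ('g \<Rightarrow> complex \<times> complex \<Rightarrow> complex \<times> complex) \<Rightarrow> bool" where
  "differentiable_action_on_S3 G \<phi> \<longleftrightarrow>
     group_action G S3 \<phi> \<and> (\<forall>g\<in>carrier G. \<phi> g differentiable_on S3)"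

text \<open>
  The residue class of \<open>k\<close> acts by \<open>(z, w) \<mapsto> (\<zeta>^k z, \<zeta>^(q k) w)\<close> where \<open>\<zeta> = exp (2 \<pi> i / p)\<close>.
  Maps in \<^const>\<open>BijGroup\<close> are extensional, hence the restriction to \<open>S3\<close>.
\<close>

definition lens_action :: "nat \<Rightarrow> int \<Rightarrow> int \<Rightarrow> complex \<times> complex \<Rightarrow> complex \<times> complex" where
  "lens_action p q k =
     (\<lambda>(z, w) \<in> S3. (cis (2 * pi * of_int k / of_nat p) * z,
                      cis (2 * pi * of_int (q * k) / of_nat p) * w))"

definition lens_space :: "nat \<Rightarrow> int \<Rightarrow> (complex \<times> complex) set topology" where
  "lens_space p q = orbit_space (integer_mod_group p) (top_of_set S3) (lens_action p q)"

definition lens_space_as_quotient :: "'a topology \<Rightarrow> bool" where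
  "lens_space_as_quotient M \<longleftrightarrow>
     (\<exists>p q \<phi>. p > 0 \<and> coprime (int p) q \<and> M homeomorphic_space lens_space p q \<and>
        differentiable_action_on_S3 (integer_mod_group p) \<phi> \<and>
        M homeomorphic_space orbit_space (integer_mod_group p) (top_of_set S3) \<phi>)"

lemma cis_mod_eq:
  assumes "p > 0"
  shows "cis (2 * pi * of_int (q * (m mod int p)) / of_nat p) = cis (2 * pi * of_int (q * m) / of_nat p)"
proof -
  have "m mod int p = m - int p * (m div int p)"
    by (simp add: minus_mult_div_eq_mod)
  then have r: "real_of_int (m mod int p) = of_int m - of_nat p * of_int (m div int p)"
    by (simp only: of_int_diff of_int_mult of_int_of_nat_eq)
  have "2 * pi * of_int (q * (m mod int p)) / of_nat p =
      2 * pi * of_int (q * m) / of_nat p - 2 * pi * of_int (q * (m div int p))"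
    using assms unfolding of_int_mult r by (simp add: field_simps)
  moreover have "cis (2 * pi * of_int (q * (m div int p))) = 1"
    by (rule cis_multiple_2pi) simp
  ultimately show ?thesis
    by (simp add: cis_divide [symmetric])
qed

lemma lens_action_in_S3:
  assumes "x \<in> S3"
  shows "lens_action p q k x \<in> S3"
  using assms by (cases x) (simp add: lens_action_def norm_Pair norm_mult)

lemma lens_action_add:
  assumes "p > 0" "x \<in> S3"
  shows "lens_action p q ((k + l) mod int p) x = lens_action p q k (lens_action p q l x)"
proof -
  obtain z w where x: "x = (z, w)" by fastforce
  define a where "a = (\<lambda>k. cis (2 * pi * of_int k / of_nat p))"
  have add: "a (k + l) = a k * a l" for k l
    by (simp add: a_def cis_mult add_divide_distrib distrib_left)
  have m1: "a (m mod int p) = a m" and m2: "a (q * (m mod int p)) = a (q * m)" for m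
    using cis_mod_eq[OF assms(1), of 1 m] cis_mod_eq[OF assms(1), of q m] by (simp_all add: a_def)
  have eq: "lens_action p q k (z', w') = (a k * z', a (q * k) * w')" if "(z', w') \<in> S3" for k z' w'
    using that by (simp add: lens_action_def a_def)
  have "lens_action p q l x \<in> S3"
    using lens_action_in_S3[OF assms(2)] .
  then have "lens_action p q k (lens_action p q l x) = (a k * (a l * z), a (q * k) * (a (q * l) * w))"
    using assms(2) unfolding x by (simp add: eq)
  moreover have "lens_action p q ((k + l) mod int p) x = (a (k + l) * z, a (q * k + q * l) * w)"
    using assms(2) unfolding x by (simp only: eq m1 m2 distrib_left)
  ultimately show ?thesis
    by (simp add: add mult.assoc)
qed

lemma lens_action_zero: "x \<in> S3 \<Longrightarrow> lens_action p q 0 x = x"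
  by (cases x) (simp add: lens_action_def)

lemma lens_action_Bij:
  assumes "p > 0"
  shows "lens_action p q k \<in> Bij S3"
proof -
  have "bij_betw (lens_action p q k) S3 S3"
  proof (rule bij_betwI[where g = "lens_action p q (- k)"])
    show "lens_action p q (- k) (lens_action p q k x) = x" if "x \<in> S3" for x
      using lens_action_add[OF assms that, of q "- k" k] lens_action_zero[OF that] by simp
    show "lens_action p q k (lens_action p q (- k) x) = x" if "x \<in> S3" for x
      using lens_action_add[OF assms that, of q k "- k"] lens_action_zero[OF that] by simp
  qed (use lens_action_in_S3 in blast)+
  then show ?thesis
    by (simp add: Bij_def) (simp add: lens_action_def)
qed

text \<open>Lens spaces are quotients of the sphere by a differentiable (even free) action.\<close>

lemma differentiable_lens_action:
  assumes "p > 0"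
  shows "differentiable_action_on_S3 (integer_mod_group p) (lens_action p q)"
  unfolding differentiable_action_on_S3_def
proof
  have "lens_action p q \<in> hom (integer_mod_group p) (BijGroup S3)"
  proof (rule homI)
    fix k l
    show "lens_action p q k \<in> carrier (BijGroup S3)"
      by (simp add: BijGroup_def lens_action_Bij assms)
    have "lens_action p q ((k + l) mod int p) = compose S3 (lens_action p q k) (lens_action p q l)"
      by (rule ext) (use lens_action_add[OF assms] in
          \<open>auto simp: compose_def lens_action_def\<close>)
    then show "lens_action p q (k \<otimes>\<^bsub>integer_mod_group p\<^esub> l) =
        lens_action p q k \<otimes>\<^bsub>BijGroup S3\<^esub> lens_action p q l"
      by (simp add: BijGroup_def lens_action_Bij assms)
  qed
  then show "group_action (integer_mod_group p) S3 (lens_action p q)"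
    by (simp add: group_action_def group_hom_def group_hom_axioms_def group_BijGroup)
next
  have "(\<lambda>x. (c * fst x, d * snd x)) differentiable_on S3" for c d :: complex
    by (intro linear_imp_differentiable_on linearI) (auto simp: algebra_simps)
  then have "lens_action p q k differentiable_on S3" for k
    unfolding differentiable_on_def
    by (rule_tac ballI, rule_tac differentiable_transform_within[where d = 1
          and f = "\<lambda>x. (cis (2 * pi * of_int k / of_nat p) * fst x,
                         cis (2 * pi * of_int (q * k) / of_nat p) * snd x)"])
       (auto simp: lens_action_def)
  then show "\<forall>k\<in>carrier (integer_mod_group p). lens_action p q k differentiable_on S3"
    by blast
qed

lemma lens_action_free:
  assumes "p > 0" "coprime (int p) q" "k \<in> carrier (integer_mod_group p)" "x \<in> S3"
    and "lens_action p q k x = x"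
  shows "k = 0"
proof -
  obtain z w where x: "x = (z, w)" by fastforce
  have dvd: "int p dvd n" if c: "cis (2 * pi * of_int n / of_nat p) = 1" for n
  proof -
    have "cos (2 * pi * of_int n / of_nat p) = 1"
      using c by (metis cis.sel(1) one_complex.sel(1))
    then obtain m :: int where "2 * pi * of_int n / of_nat p = of_int m * 2 * pi"
      using cos_one_2pi_int by metis
    then have "real_of_int n = of_int (m * int p)"
      using assms(1) by (simp add: field_simps)
    then show ?thesis by (simp only: of_int_eq_iff) simp
  qed
  have e: "cis (2 * pi * of_int k / of_nat p) * z = z" "cis (2 * pi * of_int (q * k) / of_nat p) * w = w"
    using assms(4,5) by (simp_all add: x lens_action_def)
  have "z \<noteq> 0 \<or> w \<noteq> 0"
    using assms(4) by (auto simp: x)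
  then have "int p dvd k \<or> int p dvd q * k"
    using e dvd by (metis mult_cancel_right1)
  then have "int p dvd k"
    using assms(2) by (auto simp: coprime_dvd_mult_right_iff)
  then show ?thesis
    using assms(1,3) by (auto simp: carrier_integer_mod_group dest: zdvd_imp_le split: if_splits)
qed

lemma lens_space_as_quotient_iff:
  "lens_space_as_quotient M \<longleftrightarrow>
     (\<exists>p q. p > 0 \<and> coprime (int p) q \<and> M homeomorphic_space lens_space p q)"
  using differentiable_lens_action unfolding lens_space_as_quotient_def lens_space_def by blast

end

theory Submission
  imports Defs
begin

text \<open>
  A closed set \<open>A\<close> contracts within \<open>X\<close> to a copy of the circle exactly when the inclusion of \<open>A\<close> is
  homotopic in \<open>X\<close> to a map whose image is a circle (\<open>contractible_within_to_iff_homotopic\<close>).  All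
  bounds below are statements about the homotopy class of such inclusions.

  Four sets always suffice.  A compact 3-manifold is a finite union of small compact blocks in charts.
  Euclidean \<open>n\<close>-space is the union of arbitrarily small cells in \<open>n + 1\<close> colours, cells of one colour
  being disjoint: in colour \<open>c\<close> every coordinate must avoid certain gaps, the gaps of different colours
  are disjoint, and \<open>n\<close> coordinates cannot block \<open>n + 1\<close> colours (\<open>grid_cells_cover\<close>).  With such cells
  the blocks are absorbed one after the other into four closed sets, each of which has an open
  neighbourhood contractible to a fixed point \<open>p\<close> (\<open>absorb_chart_block\<close>): the cells of colour \<open>i\<close> that
  touch the \<open>i\<close>-th set are too small to leave its neighbourhood, and those that do not touch it are
  contracted independently, along with the chart.  Hence the manifold is the union of four closed sets that
  contract to \<open>p\<close>.  Choosing \<open>p\<close> on an embedded circle, and letting all four sets contain a common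
  ball, each contraction can be continued by wrapping the set around that circle
  (\<open>contractible_within_to_circle_if_const\<close>).

  Two sets suffice for lens spaces, which split along \<open>|z| = |w|\<close> into two solid tori, and for
  \<open>S\<^sup>1 \<times> S\<^sup>2\<close>, which splits along the equator of \<open>S\<^sup>2\<close>; \<open>S\<^sup>3\<close> and \<open>\<real>P\<^sup>3\<close> are the lens spaces with
  \<open>p = 1, 2\<close>.  One set never suffices: if the whole space deformed to a circle, then every map from a
  sphere of dimension at least two to it would factor through a circle up to homotopy, hence be
  null-homotopic (\<open>nullhomotopic_into_circle_deformable\<close>).  For the quotient map from \<open>S\<^sup>3\<close> to a lens
  space the null-homotopy would lift to a contraction of \<open>S\<^sup>3\<close>; for the inclusion of \<open>S\<^sup>2\<close> in
  \<open>S\<^sup>1 \<times> S\<^sup>2\<close> the projection would turn it into a contraction of \<open>S\<^sup>2\<close>.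

  For the torus \<open>T\<^sup>3 = S\<^sup>1 \<times> T\<^sup>2\<close> three sets suffice because \<open>T\<^sup>2\<close> is the union of three closed sets
  contractible within it.  That two sets do not suffice is a cup product argument.  If \<open>A\<close> deforms to
  a circle, then the integral classes \<open>a\<close> of degree one on \<open>T\<^sup>3\<close> that vanish on \<open>A\<close> contain a sublattice
  of rank two (\<open>integral_class_vanishing_on_deformable\<close>).  So for two sets \<open>A\<close> and \<open>B\<close> there are
  independent classes \<open>a\<close>, \<open>c\<close> vanishing on \<open>A\<close> and \<open>B\<close>, and their product, which is not zero,
  vanishes on \<open>A \<union> B\<close>.  The contradiction is reached by Brouwer's fixed point theorem in place of
  cohomology (\<open>three_torus_not_union_of_two_deformable\<close>).
\<close>

section \<open>Deformations into a space and covers by deformable sets\<close>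

text \<open>
  In this form restriction, composition and gluing of deformations are instances of the general rules
  for homotopies.
\<close>

lemma contractible_within_to_iff_homotopic:
  assumes "A \<subseteq> topspace X"
  shows "contractible_within_to X A P \<longleftrightarrow>
    (\<exists>f. homotopic_with (\<lambda>_. True) (subtopology X A) X id f \<and>
         subtopology X (f ` A) homeomorphic_space P)" (is "?L \<longleftrightarrow> ?R")
proof
  let ?I = "top_of_set {0..1::real}" and ?A = "subtopology X A"
  have swap: "continuous_map (prod_topology S T) (prod_topology T S) (\<lambda>(x, y). (y, x))"
    for S :: "'x topology" and T :: "'y topology"
    by (simp add: case_prod_unfold continuous_map_paired continuous_map_fst continuous_map_snd)
  {
    assume ?L
    then obtain F where F: "continuous_map (prod_topology ?A ?I) X F"
      and F0: "\<forall>x\<in>A. F (x, 0) = x" and P: "subtopology X (F ` (A \<times> {1})) homeomorphic_space P"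
      unfolding contractible_within_to_def by blast
    have "homotopic_with (\<lambda>_. True) ?A X id (\<lambda>x. F (x, 1))"
    proof (subst homotopic_with, simp, intro exI conjI)
      show "continuous_map (prod_topology ?I ?A) X (F \<circ> (\<lambda>(x, y). (y, x)))"
        by (rule continuous_map_compose[OF swap F])
    qed (use F0 in auto)
    moreover have "(\<lambda>x. F (x, 1)) ` A = F ` (A \<times> {1})"
      by (simp add: image_comp o_def flip: image_Pair_const)
    ultimately show ?R using P by metis
  next
    assume ?R
    then obtain f h where h: "continuous_map (prod_topology ?I ?A) X h"
      and h01: "\<forall>x. h (0, x) = id x" "\<forall>x. h (1, x) = f x"
      and P: "subtopology X (f ` A) homeomorphic_space P"
      unfolding homotopic_with_def by blast
    have "(h \<circ> (\<lambda>(x, y). (y, x))) ` (A \<times> {1}) = f ` A"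
      using h01 by (simp add: image_comp o_def flip: image_Pair_const)
    then show ?L
      unfolding contractible_within_to_def
    proof (intro exI conjI)
      show "continuous_map (prod_topology ?A ?I) X (h \<circ> (\<lambda>(x, y). (y, x)))"
        by (rule continuous_map_compose[OF swap h])
    qed (use h01 P in simp_all)
  }
qed

definition has_P_cover :: "'p topology \<Rightarrow> 'a topology \<Rightarrow> nat \<Rightarrow> bool" where
  "has_P_cover P X k \<longleftrightarrow>
     (\<exists>A :: nat \<Rightarrow> 'a set.
        (\<forall>i<k. closedin X (A i) \<and> contractible_within_to X (A i) P) \<and>
        topspace X = (\<Union>i<k. A i))"

lemma P_category_eq_Inf: "P_category P X = Inf {enat k | k. has_P_cover P X k}"
  by (simp add: P_category_def has_P_cover_def)

lemma P_category_le:
  assumes "has_P_cover P X k"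
  shows "P_category P X \<le> enat k"
  unfolding P_category_eq_Inf by (rule Inf_lower) (use assms in blast)

lemma P_category_eqI:
  assumes "has_P_cover P X k" and "\<And>j. j < k \<Longrightarrow> \<not> has_P_cover P X j"
  shows "P_category P X = enat k"
proof (rule antisym)
  show "P_category P X \<le> enat k" using assms(1) by (rule P_category_le)
  have "k \<le> j" if "has_P_cover P X j" for j
    using assms(2) that by (rule_tac ccontr) simp
  then show "enat k \<le> P_category P X"
    unfolding P_category_eq_Inf by (intro Inf_greatest) auto
qed

lemma contractible_within_to_homeomorphic_image:
  assumes fg: "homeomorphic_maps X Y f g" and A: "A \<subseteq> topspace X"
    and con: "contractible_within_to X A P"
  shows "contractible_within_to Y (f ` A) P"
proof -
  have f: "continuous_map X Y f" and g: "continuous_map Y X g"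
    and gf: "\<And>x. x \<in> topspace X \<Longrightarrow> g (f x) = x" and fg': "\<And>y. y \<in> topspace Y \<Longrightarrow> f (g y) = y"
    using fg by (auto simp: homeomorphic_maps_def)
  have fA: "f ` A \<subseteq> topspace Y"
    using A continuous_map_image_subset_topspace[OF f] by blast
  obtain h where h: "homotopic_with (\<lambda>_. True) (subtopology X A) X id h"
    and P: "subtopology X (h ` A) homeomorphic_space P"
    using con contractible_within_to_iff_homotopic[OF A] by blast
  have hA: "h ` A \<subseteq> topspace X"
    using homotopic_with_imp_continuous_maps[OF h] A continuous_map_image_subset_topspace
    by (metis topspace_subtopology_subset)
  have gA: "continuous_map (subtopology Y (f ` A)) (subtopology X A) g"
    unfolding continuous_map_in_subtopology
  proof
    show "continuous_map (subtopology Y (f ` A)) X g"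
      by (rule continuous_map_from_subtopology[OF g])
    show "g \<in> topspace (subtopology Y (f ` A)) \<rightarrow> A"
      using gf A by auto
  qed
  have "homotopic_with (\<lambda>_. True) (subtopology Y (f ` A)) Y (f \<circ> (id \<circ> g)) (f \<circ> (h \<circ> g))"
    by (rule homotopic_with_compose_continuous_map_left
          [OF homotopic_with_compose_continuous_map_right[OF h gA] f]) auto
  then have "homotopic_with (\<lambda>_. True) (subtopology Y (f ` A)) Y id (f \<circ> (h \<circ> g))"
    by (rule homotopic_with_eq) (use fA fg' in \<open>simp_all add: subset_eq\<close>)
  moreover have "subtopology Y ((f \<circ> (h \<circ> g)) ` f ` A) homeomorphic_space P"
  proof -
    have "(f \<circ> (h \<circ> g)) ` f ` A = f ` h ` A"
      using A gf by (simp add: image_comp subset_eq)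
    moreover have "homeomorphic_maps (subtopology X (h ` A)) (subtopology Y (f ` h ` A)) f g"
    proof (rule homeomorphic_maps_subtopologies[OF fg])
      have "f ` h ` A \<subseteq> topspace Y"
        using hA continuous_map_image_subset_topspace[OF f] by blast
      then show "f ` (topspace X \<inter> h ` A) = topspace Y \<inter> f ` h ` A"
        using hA by (simp only: Int_absorb1)
    qed
    then have "subtopology Y (f ` h ` A) homeomorphic_space subtopology X (h ` A)"
      using homeomorphic_maps_imp_homeomorphic_space homeomorphic_space_sym by blast
    ultimately show ?thesis
      using P homeomorphic_space_trans by metis
  qed
  ultimately show ?thesis
    using contractible_within_to_iff_homotopic[OF fA] by blast
qed

lemma has_P_cover_homeomorphic:
  assumes "X homeomorphic_space Y" and "has_P_cover P X k"
  shows "has_P_cover P Y k"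
proof -
  obtain f g where fg: "homeomorphic_maps X Y f g"
    using assms(1) by (auto simp: homeomorphic_space_def)
  then have hom: "homeomorphic_map X Y f"
    using homeomorphic_map_maps by blast
  obtain A where A: "\<And>i. i < k \<Longrightarrow> closedin X (A i)" "\<And>i. i < k \<Longrightarrow> contractible_within_to X (A i) P"
    and X: "topspace X = (\<Union>i<k. A i)"
    using assms(2) unfolding has_P_cover_def by metis
  have "closedin Y (f ` A i)" if "i < k" for i
    using homeomorphic_map_closedness_eq[OF hom] A(1)[OF that] closedin_subset by blast
  moreover have "contractible_within_to Y (f ` A i) P" if "i < k" for i
    using contractible_within_to_homeomorphic_image[OF fg closedin_subset[OF A(1)[OF that]] A(2)[OF that]] .
  moreover have "topspace Y = (\<Union>i<k. f ` A i)"
    unfolding homeomorphic_imp_surjective_map[OF hom, symmetric] X by (rule image_UN)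
  ultimately show ?thesis
    unfolding has_P_cover_def by (intro exI[of _ "\<lambda>i. f ` A i"]) simp
qed

text \<open>
  Conjugation by a homeomorphism carries deformable sets to deformable sets.
\<close>

lemma P_category_homeomorphic:
  assumes "X homeomorphic_space Y"
  shows "P_category P X = P_category P Y"
proof -
  have "has_P_cover P X k \<longleftrightarrow> has_P_cover P Y k" for k
    using assms has_P_cover_homeomorphic homeomorphic_space_sym by metis
  then show ?thesis
    by (simp add: P_category_eq_Inf)
qed

lemma has_P_cover_1: "has_P_cover P X 1 \<Longrightarrow> contractible_within_to X (topspace X) P"
  by (auto simp: has_P_cover_def lessThan_Suc)

lemma has_P_cover_2I:
  assumes "closedin X A" "closedin X B" "topspace X \<subseteq> A \<union> B"
    "contractible_within_to X A P" "contractible_within_to X B P"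
  shows "has_P_cover P X 2"
proof -
  have "A \<union> B \<subseteq> topspace X" using assms(1,2)[THEN closedin_subset] by simp
  then show ?thesis
    unfolding has_P_cover_def using assms
    by (intro exI[of _ "\<lambda>i. if i = 0 then A else B"]) (auto simp: numeral_2_eq_2 lessThan_Suc)
qed

text \<open>
  With two sets available, only the covers by no set and by the whole space have to be excluded.
\<close>

lemma P_category_eq_2I:
  assumes "has_P_cover P X 2" and "topspace X \<noteq> {}" and "\<not> contractible_within_to X (topspace X) P"
  shows "P_category P X = 2"
proof -
  have "P_category P X = enat 2"
  proof (rule P_category_eqI[OF assms(1)])
    fix j :: nat assume "j < 2"
    then consider "j = 0" | "j = 1" by linarith
    then show "\<not> has_P_cover P X j"
    proof cases
      case 1
      then show ?thesis using assms(2) by (simp add: has_P_cover_def)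
    next
      case 2
      show ?thesis unfolding 2 using assms(3) has_P_cover_1[of P X] by argo
    qed
  qed
  then show ?thesis by (simp add: numeral_eq_enat)
qed

lemma homeomorphic_maps_sets_iff:
  "homeomorphic_maps (top_of_set S) (top_of_set T) f g \<longleftrightarrow> homeomorphism S T f g"
proof
  assume L: "homeomorphic_maps (top_of_set S) (top_of_set T) f g"
  then have "continuous_on S f" "f ` S \<subseteq> T" "continuous_on T g" "g ` T \<subseteq> S"
    "\<forall>x\<in>S. g (f x) = x" "\<forall>y\<in>T. f (g y) = y"
    by (simp_all add: homeomorphic_maps_def image_subset_iff_funcset)
  then show "homeomorphism S T f g"
    by (intro homeomorphismI) (simp_all add: image_subset_iff_funcset)
next
  assume "homeomorphism S T f g"
  then show "homeomorphic_maps (top_of_set S) (top_of_set T) f g"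
    by (simp add: homeomorphic_maps_def homeomorphism_def image_subset_iff_funcset[symmetric])
qed

lemma homeomorphic_space_sets_iff: "top_of_set S homeomorphic_space top_of_set T \<longleftrightarrow> S homeomorphic T"
  by (simp add: homeomorphic_space_def homeomorphic_def homeomorphic_maps_sets_iff)

lemma homotopic_with_canonI:
  assumes "continuous_on ({0..1::real} \<times> A) h" "h ` ({0..1} \<times> A) \<subseteq> S"
    and "\<And>x. x \<in> A \<Longrightarrow> h (0, x) = f x" "\<And>x. x \<in> A \<Longrightarrow> h (1, x) = g x"
  shows "homotopic_with_canon (\<lambda>_. True) A S f g"
proof -
  have "continuous_map (prod_topology (top_of_set {0..1}) (top_of_set A)) (top_of_set S) h"
    using assms(1,2) by (simp add: image_subset_iff_funcset)
  with assms(3,4) show ?thesis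
    by (subst homotopic_with, simp) (intro exI[of _ h] conjI, simp_all)
qed

lemma contractible_within_to_set_iff:
  assumes "A \<subseteq> S"
  shows "contractible_within_to (top_of_set S) A (top_of_set Q) \<longleftrightarrow>
    (\<exists>f. homotopic_with_canon (\<lambda>_. True) A S id f \<and> f ` A homeomorphic Q)"
proof -
  have 1: "subtopology (top_of_set S) A = top_of_set A"
    using assms by (simp add: subtopology_subtopology Int_absorb1)
  have 2: "subtopology (top_of_set S) (f ` A) = top_of_set (f ` A)"
    if "homotopic_with_canon (\<lambda>_. True) A S id f" for f
    using homotopic_with_imp_subset2[OF that] by (simp add: subtopology_subtopology Int_absorb1)
  have "A \<subseteq> topspace (top_of_set S)" using assms by simp
  from contractible_within_to_iff_homotopic[OF this] show ?thesis
    unfolding 1 homeomorphic_space_sets_iff[symmetric] by (metis 2)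
qed

lemma quotient_map_factor:
  assumes f: "quotient_map X Y f" and h: "continuous_map X Z h"
    and eq: "\<forall>x\<in>topspace X. \<forall>y\<in>topspace X. f x = f y \<longrightarrow> h x = h y"
  shows "\<exists>g. continuous_map Y Z g \<and> (\<forall>x\<in>topspace X. g (f x) = h x)"
proof -
  obtain g where "continuous_map Y Z g" "\<And>x. x \<in> topspace X \<Longrightarrow> g (f x) = h x"
    using quotient_map_lift_exists[OF f h] eq by (metis (full_types))
  then show ?thesis by blast
qed

lemma circle_eq_cis_image: "(\<lambda>t. cis (2 * pi * t)) ` {0..1} = sphere 0 1"
proof
  show "sphere 0 1 \<subseteq> (\<lambda>t. cis (2 * pi * t)) ` {0..1}"
  proof
    fix z :: complex assume "z \<in> sphere 0 1"
    then have "z = cis (2 * pi * (Arg2pi z / (2 * pi)))"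
      using Arg2pi_eq[of z] by (simp add: cis_conv_exp)
    moreover have "Arg2pi z / (2 * pi) \<in> {0..1}"
      using Arg2pi_ge_0[of z] Arg2pi_lt_2pi[of z] by (simp add: divide_simps)
    ultimately show "z \<in> (\<lambda>t. cis (2 * pi * t)) ` {0..1}" by (rule image_eqI)
  qed
qed auto

section \<open>Small cells in Euclidean space, coloured by dimension plus one colours\<close>

text \<open>
  In units of the mesh, with \<open>N\<close> colours: in colour \<open>c\<close> the interval around an even integer reaches out
  to \<open>c / N\<close> and the one around an odd integer to \<open>(N - 1 - c) / N\<close>.  What they leave uncovered are the
  points whose distance to the nearest even integer lies strictly between \<open>c / N\<close> and \<open>(c + 1) / N\<close>, so
  the gaps of different colours are disjoint.
\<close>

definition grid_radius :: "nat \<Rightarrow> nat \<Rightarrow> int \<Rightarrow> real" where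
  "grid_radius N c n = (if even n then real c / real N else (real N - 1 - real c) / real N)"

text \<open>
  Centres of the same parity are at least \<open>2\<close> apart and all radii are below \<open>1\<close>; for centres of different
  parity the radii add up to \<open>(N - 1) / N < 1\<close>.
\<close>

lemma grid_interval_unique:
  assumes "c < N" "\<bar>t - of_int n\<bar> \<le> grid_radius N c n" "\<bar>t - of_int m\<bar> \<le> grid_radius N c m"
  shows "n = m"
proof (rule ccontr)
  assume "n \<noteq> m"
  have r1: "grid_radius N c k < 1" for k
    using assms(1) by (auto simp: grid_radius_def divide_simps)
  have "\<bar>real_of_int n - of_int m\<bar> \<le> grid_radius N c n + grid_radius N c m"
    using assms(2,3) by linarith
  moreover have "grid_radius N c n + grid_radius N c m < 1" if "even n \<noteq> even m"
    using assms(1) that by (auto simp: grid_radius_def field_simps)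
  moreover have "\<bar>n - m\<bar> \<ge> 2" if "even n = even m"
  proof -
    have "even (n - m)" using that by simp
    then show ?thesis using \<open>n \<noteq> m\<close> by (elim evenE) (auto simp: abs_mult)
  qed
  moreover have "\<bar>n - m\<bar> \<ge> 1" using \<open>n \<noteq> m\<close> by simp
  ultimately show False
    using r1[of n] r1[of m] by (cases "even n = even m") linarith+
qed

text \<open>
  The colour can be read off from a point in one of its gaps: it is the integer part of \<open>N\<close> times the
  distance \<open>s\<close> to the nearest even integer.
\<close>

lemma grid_gap_unique:
  assumes "c < N" "c' < N"
    and gap: "\<And>n. \<bar>t - of_int n\<bar> > grid_radius N c n" and gap': "\<And>n. \<bar>t - of_int n\<bar> > grid_radius N c' n"
  shows "c = c'"
proof -
  define k s where "k = \<lfloor>t\<rfloor>" and "s = (if even k then t - of_int k else of_int k + 1 - t)"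
  have s: "real d < N * s \<and> N * s < real d + 1" if "d < N" "\<And>n. \<bar>t - of_int n\<bar> > grid_radius N d n" for d
  proof -
    have "0 \<le> t - of_int k" "t - of_int k < 1" unfolding k_def by linarith+
    then have "t - of_int k > grid_radius N d k" "of_int k + 1 - t > grid_radius N d (k + 1)"
      using that(2)[of k] that(2)[of "k + 1"] by simp_all
    then show ?thesis
      using that(1) by (auto simp: s_def grid_radius_def field_simps split: if_splits)
  qed
  show ?thesis
    using s[OF assms(1) gap] s[OF assms(2) gap'] by linarith
qed

definition grid_cell :: "real \<Rightarrow> nat \<Rightarrow> ('a \<Rightarrow> int) \<Rightarrow> 'a::euclidean_space set" where
  "grid_cell d c n =
     {x. \<forall>b\<in>Basis. \<bar>x \<bullet> b / d - of_int (n b)\<bar> \<le> grid_radius (Suc DIM('a)) c (n b)}"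

lemma closed_grid_cell: "closed (grid_cell d c n)"
proof -
  have "grid_cell d c n = (\<Inter>b\<in>Basis. {x. \<bar>x \<bullet> b / d - of_int (n b)\<bar> \<le> grid_radius (Suc DIM('a)) c (n b)})"
    by (auto simp: grid_cell_def)
  moreover have "closed {x. \<bar>x \<bullet> b / d - of_int (n b)\<bar> \<le> grid_radius (Suc DIM('a)) c (n b)}" for b
    unfolding divide_inverse by (intro closed_Collect_le continuous_intros)
  ultimately show ?thesis
    by (simp add: closed_INT)
qed

lemma grid_cell_disjoint:
  assumes "c \<le> DIM('a)" "x \<in> grid_cell d c n" "x \<in> grid_cell d c m" "b \<in> Basis"
  shows "n b = m (b::'a::euclidean_space)"
  using assms grid_interval_unique[of c "Suc DIM('a)" "x \<bullet> b / d" "n b" "m b"]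
  by (auto simp: grid_cell_def)

text \<open>
  By the pigeonhole principle: a coordinate of \<open>x\<close> lies in a gap of at most one colour, so the
  coordinates, \<open>DIM('a)\<close> in number, leave one of the \<open>DIM('a) + 1\<close> colours free of gaps.
\<close>

lemma grid_cells_cover:
  obtains c n where "c \<le> DIM('a)" "n \<in> extensional Basis" "(x::'a::euclidean_space) \<in> grid_cell d c n"
proof -
  let ?N = "Suc DIM('a)"
  let ?gap = "\<lambda>c b. \<forall>n. \<bar>x \<bullet> b / d - of_int n\<bar> > grid_radius ?N c n"
  have "\<exists>c\<le>DIM('a). \<forall>b\<in>Basis. \<not> ?gap c b"
  proof (rule ccontr)
    assume "\<not> ?thesis"
    then obtain b where b: "\<And>c. c \<le> DIM('a) \<Longrightarrow> b c \<in> Basis \<and> ?gap c (b c)"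
      by metis
    have "inj_on b {..DIM('a)}"
    proof (rule inj_onI)
      fix c c' assume "c \<in> {..DIM('a)}" "c' \<in> {..DIM('a)}" and eq: "b c = b c'"
      then have le: "c \<le> DIM('a)" "c' \<le> DIM('a)" by auto
      have "\<And>n. \<bar>x \<bullet> b c / d - of_int n\<bar> > grid_radius ?N c n"
        "\<And>n. \<bar>x \<bullet> b c / d - of_int n\<bar> > grid_radius ?N c' n"
        using b[OF le(1)] b[OF le(2)] eq by simp_all
      then show "c = c'"
        using grid_gap_unique[of c ?N c'] le by (metis le_imp_less_Suc)
    qed
    then have "card {..DIM('a)} \<le> DIM('a)"
      by (rule card_inj_on_le) (use b in auto)
    then show False by simp
  qed
  then obtain c where c: "c \<le> DIM('a)" "\<forall>b\<in>Basis. \<exists>n. \<bar>x \<bullet> b / d - of_int n\<bar> \<le> grid_radius ?N c n"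
    by (auto simp: not_less)
  from c(2) obtain n where "\<forall>b\<in>Basis. \<bar>x \<bullet> b / d - of_int (n b)\<bar> \<le> grid_radius ?N c (n b)"
    by metis
  then have "x \<in> grid_cell d c (restrict n Basis)"
    by (simp add: grid_cell_def)
  then show ?thesis
    using that c(1) by blast
qed

lemma grid_radius_le_1: "c < N \<Longrightarrow> grid_radius N c n \<le> 1"
  by (simp add: grid_radius_def divide_simps)

lemma dist_grid_cell:
  assumes "d > 0" "c \<le> DIM('a)" "x \<in> grid_cell d c n" "y \<in> grid_cell d c n"
  shows "dist x (y::'a::euclidean_space) \<le> 2 * d * DIM('a)"
proof -
  have "\<bar>(x - y) \<bullet> b\<bar> \<le> 2 * d" if b: "b \<in> Basis" for b
  proof -
    have "\<bar>x \<bullet> b / d - of_int (n b)\<bar> \<le> 1" "\<bar>y \<bullet> b / d - of_int (n b)\<bar> \<le> 1"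
      using assms(2-4) b grid_radius_le_1[of c "Suc DIM('a)" "n b"] by (force simp: grid_cell_def)+
    then have "\<bar>x \<bullet> b / d - y \<bullet> b / d\<bar> \<le> 2" by linarith
    then show ?thesis
      using assms(1) by (simp add: inner_diff_left field_simps flip: diff_divide_distrib)
  qed
  then have "(\<Sum>b\<in>Basis. \<bar>(x - y) \<bullet> b\<bar>) \<le> DIM('a) * (2 * d)"
    using sum_bounded_above[of Basis "\<lambda>b. \<bar>(x - y) \<bullet> b\<bar>" "2 * d"] by simp
  then show ?thesis
    using norm_le_l1[of "x - y"] by (simp add: dist_norm mult.commute)
qed

text \<open>
  Cells are taken so small that those meeting \<open>C i\<close> within \<open>K\<close> stay in \<open>V i\<close>.  Then \<open>D i\<close> is the union
  of the cells of colour \<open>i\<close> that meet \<open>C i\<close>, and \<open>B i\<close> that of the other cells of this colour, both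
  taken inside \<open>K\<close>.
\<close>

lemma refine_coloured_cover:
  fixes K :: "'a::euclidean_space set"
  assumes "compact K" and C: "\<And>i. i \<le> DIM('a) \<Longrightarrow> closed (C i)"
    and V: "\<And>i. i \<le> DIM('a) \<Longrightarrow> open (V i)" and CV: "\<And>i. i \<le> DIM('a) \<Longrightarrow> C i \<subseteq> V i"
  shows "\<exists>D B. (\<forall>i\<le>DIM('a). compact (D i) \<and> D i \<subseteq> V i \<and> D i \<subseteq> K) \<and>
    (\<forall>i\<le>DIM('a). compact (B i) \<and> B i \<subseteq> K \<and> B i \<inter> (C i \<union> D i) = {}) \<and>
    K \<subseteq> (\<Union>i\<le>DIM('a). D i \<union> B i)"
proof -
  have "\<exists>e>0. \<forall>x\<in>C i \<inter> K. ball x e \<subseteq> V i" if i: "i \<le> DIM('a)" for i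
    using compact_subset_open_imp_ball_epsilon_subset[of "C i \<inter> K" "V i"] assms(1) C[OF i] V[OF i] CV[OF i]
    by (metis SUP_le_iff closed_Int_compact le_infI1)
  then obtain e where e: "\<And>i. i \<le> DIM('a) \<Longrightarrow> e i > 0"
    "\<And>i x. i \<le> DIM('a) \<Longrightarrow> x \<in> C i \<inter> K \<Longrightarrow> ball x (e i) \<subseteq> V i"
    by metis
  \<comment> \<open>one radius that works for all colours\<close>
  define \<epsilon> where "\<epsilon> = Min (e ` {..DIM('a)})"
  have \<epsilon>: "\<epsilon> > 0" "\<And>i. i \<le> DIM('a) \<Longrightarrow> \<epsilon> \<le> e i"
    using e(1) by (auto simp: \<epsilon>_def)
  \<comment> \<open>the mesh: a cell has diameter at most \<open>2 * d * DIM('a)\<close>, which is less than \<open>\<epsilon>\<close>\<close>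
  define d where "d = \<epsilon> / (2 * (real DIM('a) + 1))"
  have d: "d > 0" "2 * d * DIM('a) < \<epsilon>"
    using \<epsilon>(1) by (auto simp: d_def field_simps)
  obtain R where R: "\<And>x. x \<in> K \<Longrightarrow> norm x \<le> R"
    using assms(1) compact_imp_bounded bounded_iff by metis
  define L where "L = \<lceil>R / d\<rceil> + 1"
  \<comment> \<open>finitely many cells meet \<open>K\<close>, so the unions of cells below are closed\<close>
  define G where "G = (PiE Basis (\<lambda>_. {-L..L}) :: ('a \<Rightarrow> int) set)"
  have "finite G" unfolding G_def by (intro finite_PiE) auto
  have G: "n \<in> G" if "x \<in> K" "c \<le> DIM('a)" "x \<in> grid_cell d c n" "n \<in> extensional Basis" for x c n
  proof -
    have "n b \<in> {-L..L}" if b: "b \<in> Basis" for b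
    proof -
      have "\<bar>x \<bullet> b\<bar> \<le> R" using Basis_le_norm[OF b, of x] R[OF \<open>x \<in> K\<close>] by linarith
      then have "\<bar>x \<bullet> b / d\<bar> \<le> R / d" using d(1) by (simp add: divide_right_mono)
      moreover have "\<bar>x \<bullet> b / d - of_int (n b)\<bar> \<le> 1"
        using \<open>c \<le> DIM('a)\<close> \<open>x \<in> grid_cell d c n\<close> b grid_radius_le_1[of c "Suc DIM('a)" "n b"]
        by (force simp: grid_cell_def)
      ultimately have "\<bar>real_of_int (n b)\<bar> \<le> of_int L"
        unfolding L_def by linarith
      then show ?thesis by auto
    qed
    then show ?thesis using that(4) by (auto simp: G_def PiE_def)
  qed
  define near where "near i = {n \<in> G. grid_cell d i n \<inter> K \<inter> C i \<noteq> {}}" for i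
  define D where "D i = (\<Union>n\<in>near i. grid_cell d i n \<inter> K)" for i
  define B where "B i = (\<Union>n\<in>G - near i. grid_cell d i n \<inter> K)" for i
  have cpt: "compact (grid_cell d i n \<inter> K)" for i n
    using assms(1) closed_grid_cell closed_Int_compact by blast
  have DV: "D i \<subseteq> V i" if i: "i \<le> DIM('a)" for i
  proof
    fix y assume "y \<in> D i"
    then obtain n where n: "y \<in> grid_cell d i n" "n \<in> near i"
      unfolding D_def by blast
    then obtain x where x: "x \<in> grid_cell d i n" "x \<in> C i \<inter> K"
      unfolding near_def by blast
    then have "dist x y < e i"
      using dist_grid_cell[OF d(1) i x(1) n(1)] d(2) \<epsilon>(2)[OF i] by linarith
    then show "y \<in> V i"
      using e(2)[OF i x(2)] by auto
  qed
  have BD: "B i \<inter> D i = {}" if i: "i \<le> DIM('a)" for i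
  proof -
    have False if "x \<in> grid_cell d i n" "x \<in> grid_cell d i m" "n \<in> G - near i" "m \<in> near i" for x n m
    proof -
      have "n b = m b" if "b \<in> Basis" for b
        by (rule grid_cell_disjoint[OF i]) fact+
      then have "n = m"
        using that(3,4) by (intro PiE_ext[of n Basis "\<lambda>_. {-L..L}"]) (auto simp: G_def near_def)
      then show False using that by simp
    qed
    then show ?thesis by (auto simp: B_def D_def)
  qed
  have BC: "B i \<inter> C i = {}" for i
    by (auto simp: B_def near_def)
  have cptD: "compact (D i)" for i
    unfolding D_def by (intro compact_UN cpt) (use \<open>finite G\<close> in \<open>simp add: near_def\<close>)
  have cptB: "compact (B i)" for i
    unfolding B_def by (intro compact_UN cpt) (use \<open>finite G\<close> in simp)
  have DBK: "D i \<subseteq> K" "B i \<subseteq> K" for i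
    by (auto simp: D_def B_def)
  have "K \<subseteq> (\<Union>i\<le>DIM('a). D i \<union> B i)"
  proof
    fix x assume x: "x \<in> K"
    obtain c n where cn: "c \<le> DIM('a)" "n \<in> extensional Basis" "x \<in> grid_cell d c n"
      by (rule grid_cells_cover)
    then have "n \<in> G" using G x by blast
    then have "x \<in> D c \<union> B c"
      using cn x by (auto simp: D_def B_def)
    then show "x \<in> (\<Union>i\<le>DIM('a). D i \<union> B i)"
      using cn(1) by blast
  qed
  then show ?thesis
    using DV BD BC cptD cptB DBK by (intro exI[of _ D] exI[of _ B]) (simp add: Int_Un_distrib)
qed

section \<open>Closed sets contractible to a point in a manifold\<close>

text \<open>
  The open neighbourhood is part of the notion because the sets will be enlarged: whatever is added
  inside the neighbourhood is contracted by the homotopy already at hand.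
\<close>

definition openly_contractible_to :: "'a topology \<Rightarrow> 'a \<Rightarrow> 'a set \<Rightarrow> bool" where
  "openly_contractible_to X p A \<longleftrightarrow>
     (\<exists>U. openin X U \<and> A \<subseteq> U \<and> homotopic_with (\<lambda>_. True) (subtopology X U) X id (\<lambda>_. p))"

lemma homotopic_with_id_subset:
  assumes "homotopic_with (\<lambda>_. True) (subtopology X U) X id f" "A \<subseteq> U"
  shows "homotopic_with (\<lambda>_. True) (subtopology X A) X id f"
  using homotopic_from_subtopology[OF assms(1), of A] assms(2)
  by (simp add: subtopology_subtopology Int_absorb1)

text \<open>
  On disjoint open sets the two homotopies can be followed independently.
\<close>

lemma homotopic_with_id_const_Un:
  assumes op: "openin X U" "openin X W" and disj: "U \<inter> W = {}"
    and U: "homotopic_with (\<lambda>_. True) (subtopology X U) X id (\<lambda>_. p)"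
    and W: "homotopic_with (\<lambda>_. True) (subtopology X W) X id (\<lambda>_. p)"
  shows "homotopic_with (\<lambda>_. True) (subtopology X (U \<union> W)) X id (\<lambda>_. p)"
proof -
  let ?I = "top_of_set {0..1::real}"
  let ?Y = "prod_topology ?I (subtopology X (U \<union> W))"
  obtain h where h: "continuous_map (prod_topology ?I (subtopology X U)) X h"
    "\<And>x. h (0, x) = x" "\<And>x. h (1, x) = p"
    using U unfolding homotopic_with_def by auto
  obtain k where k: "continuous_map (prod_topology ?I (subtopology X W)) X k"
    "\<And>x. k (0, x) = x" "\<And>x. k (1, x) = p"
    using W unfolding homotopic_with_def by auto
  define T where "T = (\<lambda>b. {0..1::real} \<times> (if b then U else W))"
  have sub: "U \<subseteq> topspace X" "W \<subseteq> topspace X" using op openin_subset by blast+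
  have "openin (subtopology X (U \<union> W)) (if b then U else W)" for b
    unfolding openin_subtopology using op by (intro exI[of _ "if b then U else W"]) auto
  then have opT: "openin ?Y (T b)" for b
    by (simp only: T_def openin_prod_Times_iff) (metis openin_topspace topspace_euclidean_subtopology)
  have subT: "subtopology ?Y (T b) = prod_topology ?I (subtopology X (if b then U else W))" for b
  proof -
    have "(U \<union> W) \<inter> (if b then U else W) = (if b then U else W)" by auto
    then show ?thesis
      by (simp only: T_def subtopology_Times subtopology_subtopology Int_absorb)
  qed
  have "continuous_map ?Y X (\<lambda>z. if snd z \<in> U then h z else k z)"
  proof (rule pasting_lemma[where I = UNIV and T = T and f = "\<lambda>b. if b then h else k"])
    show "continuous_map (subtopology ?Y (T b)) X (if b then h else k)" for b
      unfolding subT using h(1) k(1) by (cases b) simp_all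
    show "(if b then h else k) z = (if b' then h else k) z" if "z \<in> topspace ?Y \<inter> T b \<inter> T b'" for b b' z
      using that disj by (cases b; cases b') (auto simp: T_def)
    show "\<exists>b. b \<in> UNIV \<and> z \<in> T b \<and> (if snd z \<in> U then h z else k z) = (if b then h else k) z"
      if "z \<in> topspace ?Y" for z
      using that by (intro exI[of _ "snd z \<in> U"]) (auto simp: T_def)
  qed (rule opT)
  then show ?thesis
    unfolding homotopic_with_def
    by (intro exI[of _ "\<lambda>z. if snd z \<in> U then h z else k z"]) (simp add: h k)
qed

text \<open>
  Normality shrinks the two neighbourhoods to disjoint ones.
\<close>

lemma openly_contractible_to_Un:
  assumes "normal_space X" "closedin X A" "closedin X B" "A \<inter> B = {}"
    and A: "openly_contractible_to X p A" and B: "openly_contractible_to X p B"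
  shows "openly_contractible_to X p (A \<union> B)"
proof -
  obtain U where U: "openin X U" "A \<subseteq> U" "homotopic_with (\<lambda>_. True) (subtopology X U) X id (\<lambda>_. p)"
    using A unfolding openly_contractible_to_def by blast
  obtain W where W: "openin X W" "B \<subseteq> W" "homotopic_with (\<lambda>_. True) (subtopology X W) X id (\<lambda>_. p)"
    using B unfolding openly_contractible_to_def by blast
  obtain U' W' where UW: "openin X U'" "openin X W'" "A \<subseteq> U'" "B \<subseteq> W'" "disjnt U' W'"
    using assms(1-4) unfolding normal_space_def disjnt_def by metis
  have "homotopic_with (\<lambda>_. True) (subtopology X (U \<inter> U' \<union> W \<inter> W')) X id (\<lambda>_. p)"
  proof (rule homotopic_with_id_const_Un)
    show "(U \<inter> U') \<inter> (W \<inter> W') = {}" using UW(5) by (auto simp: disjnt_def)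
    show "homotopic_with (\<lambda>_. True) (subtopology X (U \<inter> U')) X id (\<lambda>_. p)"
      "homotopic_with (\<lambda>_. True) (subtopology X (W \<inter> W')) X id (\<lambda>_. p)"
      by (rule homotopic_with_id_subset[OF U(3)] homotopic_with_id_subset[OF W(3)], blast)+
  qed (use U W UW in auto)
  moreover have "openin X (U \<inter> U' \<union> W \<inter> W')" using U W UW by blast
  moreover have "A \<union> B \<subseteq> U \<inter> U' \<union> W \<inter> W'" using U W UW by blast
  ultimately show ?thesis
    unfolding openly_contractible_to_def by blast
qed

text \<open>
  A compact piece of a chart whose whole domain is contractible to \<open>p\<close> in \<open>X\<close>.  The first argument
  names the Euclidean model of the chart and thereby the number of colours.
\<close>

definition chart_block :: "'e::euclidean_space itself \<Rightarrow> 'a topology \<Rightarrow> 'a \<Rightarrow> 'a set \<Rightarrow> bool" where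
  "chart_block _ X p Q \<longleftrightarrow>
     (\<exists>U V f g K. openin X U \<and> homotopic_with (\<lambda>_. True) (subtopology X U) X id (\<lambda>_. p) \<and>
        open V \<and> homeomorphic_maps (subtopology X U) (top_of_set V) f g \<and>
        compact K \<and> K \<subseteq> (V :: 'e set) \<and> Q = g ` K)"

text \<open>
  In the chart, \<open>refine_coloured_cover\<close> divides the cells of colour \<open>i\<close> into those near \<open>A i\<close>, which stay
  in the neighbourhood that contracts together with \<open>A i\<close>, and those disjoint from \<open>A i\<close> and the former,
  which contract together with the chart.
\<close>

lemma absorb_chart_block:
  assumes X: "compact_space X" "Hausdorff_space X"
    and A: "\<And>i. i \<le> DIM('e) \<Longrightarrow> closedin X (A i) \<and> openly_contractible_to X p (A i)"
    and Q: "chart_block TYPE('e::euclidean_space) X p Q"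
  shows "\<exists>A'. (\<forall>i\<le>DIM('e). closedin X (A' i) \<and> openly_contractible_to X p (A' i) \<and> A i \<subseteq> A' i) \<and>
    Q \<subseteq> (\<Union>i\<le>DIM('e). A' i)"
proof -
  obtain U V f g K where U: "openin X U"
    and pU: "homotopic_with (\<lambda>_. True) (subtopology X U) X id (\<lambda>_. p)"
    and V: "open V" and fg: "homeomorphic_maps (subtopology X U) (top_of_set V) f g"
    and K: "compact K" "K \<subseteq> (V :: 'e set)" "Q = g ` K"
    using Q unfolding chart_block_def by (elim exE conjE) (rule that; assumption)
  have normal: "normal_space X"
    by (rule compact_Hausdorff_or_regular_imp_normal_space) (simp_all add: X)
  have tU: "topspace (subtopology X U) = U"
    by (rule topspace_subtopology_subset[OF openin_subset[OF U]])
  have f: "continuous_map (subtopology X U) (top_of_set V) f"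
    and g: "continuous_map (top_of_set V) (subtopology X U) g"
    and gf: "\<And>x. x \<in> U \<Longrightarrow> g (f x) = x" and fg': "\<And>y. y \<in> V \<Longrightarrow> f (g y) = y"
    using fg unfolding homeomorphic_maps_def tU by simp_all
  have fU: "\<And>x. x \<in> U \<Longrightarrow> f x \<in> V" and gV: "\<And>y. y \<in> V \<Longrightarrow> g y \<in> U"
    using continuous_map_image_subset_topspace[OF f] continuous_map_image_subset_topspace[OF g]
    by (simp_all only: tU topspace_euclidean_subtopology image_subset_iff)
  have gX: "continuous_map (top_of_set V) X g"
    using g by (rule continuous_map_into_fulltopology)
  have cpt: "closedin X (g ` L)" if "compact L" "L \<subseteq> V" for L
  proof -
    have "compactin (top_of_set V) L" using that by (simp add: compactin_subtopology)
    then show ?thesis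
      by (intro compactin_imp_closedin[OF X(2)] image_compactin[OF _ gX])
  qed
  have "\<forall>i. i \<le> DIM('e) \<longrightarrow> (\<exists>W. openin X W \<and> A i \<subseteq> W \<and>
      homotopic_with (\<lambda>_. True) (subtopology X W) X id (\<lambda>_. p))"
    using A by (simp add: openly_contractible_to_def)
  then obtain W where W: "\<And>i. i \<le> DIM('e) \<Longrightarrow> openin X (W i) \<and> A i \<subseteq> W i \<and>
      homotopic_with (\<lambda>_. True) (subtopology X (W i)) X id (\<lambda>_. p)"
    unfolding choice_iff' by blast
  have clo: "closed (f ` (A i \<inter> g ` K))" if i: "i \<le> DIM('e)" for i
  proof -
    have "compactin X (A i \<inter> g ` K)"
      using A[OF i] cpt[OF K(1,2)] by (intro closedin_compact_space[OF X(1)] closedin_Int) simp_all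
    moreover have "A i \<inter> g ` K \<subseteq> U" using gV K(2) by blast
    ultimately have "compactin (subtopology X U) (A i \<inter> g ` K)"
      by (simp only: compactin_subtopology)
    then have "compactin (top_of_set V) (f ` (A i \<inter> g ` K))" by (rule image_compactin[OF _ f])
    then show ?thesis by (simp add: compactin_subtopology compact_imp_closed)
  qed
  have ope: "open (V \<inter> g -` W i)" if i: "i \<le> DIM('e)" for i
  proof -
    have "openin (top_of_set V) {y \<in> topspace (top_of_set V). g y \<in> W i}"
      using W[OF i] by (intro openin_continuous_map_preimage[OF gX]) simp
    moreover have "{y \<in> topspace (top_of_set V). g y \<in> W i} = V \<inter> g -` W i" by auto
    ultimately show ?thesis using V by (metis openin_open_eq)
  qed
  have sub: "f ` (A i \<inter> g ` K) \<subseteq> V \<inter> g -` W i" if "i \<le> DIM('e)" for i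
  proof -
    have "y \<in> V \<and> f (g y) = y" if "y \<in> K" for y
      using K(2) fg' that by blast
    moreover have "A i \<subseteq> W i" using W[OF that] by simp
    ultimately show ?thesis by force
  qed
  obtain D B where D: "\<And>i. i \<le> DIM('e) \<Longrightarrow> compact (D i) \<and> D i \<subseteq> V \<inter> g -` W i \<and> D i \<subseteq> K"
    and B: "\<And>i. i \<le> DIM('e) \<Longrightarrow> compact (B i) \<and> B i \<subseteq> K \<and> B i \<inter> (f ` (A i \<inter> g ` K) \<union> D i) = {}"
    and cov: "K \<subseteq> (\<Union>i\<le>DIM('e). D i \<union> B i)"
    using refine_coloured_cover[OF K(1), of "\<lambda>i. f ` (A i \<inter> g ` K)" "\<lambda>i. V \<inter> g -` W i",
        OF clo ope sub] by blast
  show ?thesis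
  proof (intro exI[of _ "\<lambda>i. (A i \<union> g ` D i) \<union> g ` B i"] conjI allI impI)
    fix i assume i: "i \<le> DIM('e)"
    have Di: "compact (D i)" "D i \<subseteq> V \<inter> g -` W i" and Bi: "compact (B i)" "B i \<subseteq> K"
      "B i \<inter> (f ` (A i \<inter> g ` K) \<union> D i) = {}"
      using D[OF i] B[OF i] by simp_all
    have DV: "D i \<subseteq> V" using Di(2) by blast
    have BV: "B i \<subseteq> V" using Bi(2) K(2) by (rule subset_trans)
    have cl: "closedin X (A i \<union> g ` D i)" "closedin X (g ` B i)"
      using A[OF i] cpt[OF Di(1) DV] cpt[OF Bi(1) BV] by (simp_all add: closedin_Un)
    have Wi: "openin X (W i)" "A i \<subseteq> W i" "homotopic_with (\<lambda>_. True) (subtopology X (W i)) X id (\<lambda>_. p)"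
      using W[OF i] by simp_all
    have "A i \<union> g ` D i \<subseteq> W i" using Wi(2) Di(2) by blast
    then have 1: "openly_contractible_to X p (A i \<union> g ` D i)"
      unfolding openly_contractible_to_def using Wi by blast
    have "g ` B i \<subseteq> U" using gV BV by blast
    then have 2: "openly_contractible_to X p (g ` B i)"
      unfolding openly_contractible_to_def using U pU by blast
    have disj: "(A i \<union> g ` D i) \<inter> g ` B i = {}"
    proof -
      have False if y: "y \<in> B i" and gy: "g y \<in> A i \<or> g y \<in> g ` D i" for y
        using gy
      proof
        assume "g y \<in> A i"
        moreover have "y \<in> K" using y Bi(2) by blast
        ultimately have "f (g y) \<in> f ` (A i \<inter> g ` K)" by blast
        moreover have "f (g y) = y" using fg'[OF subsetD[OF BV y]] .
        ultimately show False using y Bi(3) by auto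
      next
        assume "g y \<in> g ` D i"
        then obtain z where z: "z \<in> D i" "g y = g z" by blast
        have "f (g y) = y" "f (g z) = z"
          by (rule fg'[OF subsetD[OF BV y]], rule fg'[OF subsetD[OF DV z(1)]])
        then have "y = z" using z(2) by metis
        then have "y \<in> D i" using z(1) by (rule ssubst)
        then show False using y Bi(3) by auto
      qed
      then show ?thesis by auto
    qed
    show "closedin X (A i \<union> g ` D i \<union> g ` B i)" by (rule closedin_Un[OF cl])
    show "openly_contractible_to X p (A i \<union> g ` D i \<union> g ` B i)"
      by (rule openly_contractible_to_Un[OF normal cl disj 1 2])
  next
    show "Q \<subseteq> (\<Union>i\<le>DIM('e). A i \<union> g ` D i \<union> g ` B i)"
    proof
      fix x assume "x \<in> Q"
      then obtain y where y: "y \<in> K" "x = g y" using K(3) by blast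
      then obtain i where "i \<le> DIM('e)" "y \<in> D i \<union> B i" using cov by blast
      then show "x \<in> (\<Union>i\<le>DIM('e). A i \<union> g ` D i \<union> g ` B i)" using y(2) by blast
    qed
  qed auto
qed

text \<open>
  All colours start from the same set \<open>A\<close>; that it remains inside each of the final sets guarantees
  later that none of them is too small to be wrapped around a circle.
\<close>

lemma cover_chart_blocks:
  assumes X: "compact_space X" "Hausdorff_space X"
    and A: "closedin X A" "openly_contractible_to X p A"
    and "finite \<Q>" and "\<And>Q. Q \<in> \<Q> \<Longrightarrow> chart_block TYPE('e::euclidean_space) X p Q"
  shows "\<exists>A'. (\<forall>i\<le>DIM('e). closedin X (A' i) \<and> openly_contractible_to X p (A' i) \<and> A \<subseteq> A' i) \<and>
    \<Union>\<Q> \<subseteq> (\<Union>i\<le>DIM('e). A' i)"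
  using assms(5,6)
proof (induction \<Q>)
  case empty
  then show ?case using A by (intro exI[of _ "\<lambda>_. A"]) simp
next
  case (insert Q \<Q>)
  then obtain A1 where A1: "\<forall>i\<le>DIM('e). closedin X (A1 i) \<and> openly_contractible_to X p (A1 i) \<and> A \<subseteq> A1 i"
    and cov1: "\<Union>\<Q> \<subseteq> (\<Union>i\<le>DIM('e). A1 i)"
    by (metis insertCI)
  have "chart_block TYPE('e) X p Q" using insert.prems by simp
  then obtain A2 where A2: "\<forall>i\<le>DIM('e). closedin X (A2 i) \<and> openly_contractible_to X p (A2 i) \<and> A1 i \<subseteq> A2 i"
    and cov2: "Q \<subseteq> (\<Union>i\<le>DIM('e). A2 i)"
    using absorb_chart_block[OF X, of A1 p Q] A1 by metis
  have "(\<Union>i\<le>DIM('e). A1 i) \<subseteq> (\<Union>i\<le>DIM('e). A2 i)"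
    by (rule UN_mono) (use A2 in simp_all)
  then have "\<Union>(insert Q \<Q>) \<subseteq> (\<Union>i\<le>DIM('e). A2 i)"
    using cov1 cov2 by simp
  moreover have "\<forall>i\<le>DIM('e). closedin X (A2 i) \<and> openly_contractible_to X p (A2 i) \<and> A \<subseteq> A2 i"
    using A1 A2 by (meson subset_trans)
  ultimately show ?case by (intro exI[of _ A2] conjI)
qed

text \<open>
  Path components are open under this hypothesis, so a connected space has only one of them.
\<close>

lemma path_connected_space_if_locally:
  assumes "connected_space X"
    and nbhd: "\<And>x. x \<in> topspace X \<Longrightarrow> \<exists>U. openin X U \<and> x \<in> U \<and> path_connectedin X U"
  shows "path_connected_space X"
proof -
  have op: "openin X {y. path_component_of X a y \<and> P}" for a P
  proof (subst openin_subopen, intro ballI)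
    fix y assume "y \<in> {y. path_component_of X a y \<and> P}"
    then have y: "path_component_of X a y" P by simp_all
    then have "y \<in> topspace X" using path_component_in_topspace by metis
    then obtain U where U: "openin X U" "y \<in> U" "path_connectedin X U" using nbhd by metis
    have "path_component_of X a z" if "z \<in> U" for z
      using path_component_of_trans[OF y(1)] U that path_component_of by metis
    then have "U \<subseteq> {y. path_component_of X a y \<and> P}" using y(2) by blast
    then show "\<exists>T. openin X T \<and> y \<in> T \<and> T \<subseteq> {y. path_component_of X a y \<and> P}"
      using U by blast
  qed
  show ?thesis
    unfolding path_connected_space_iff_path_component
  proof (intro ballI)
    fix a b assume a: "a \<in> topspace X" and b: "b \<in> topspace X"
    define S where "S = {y. path_component_of X a y}"
    define T where "T = (\<Union>c\<in>topspace X - S. {y. path_component_of X c y})"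
    have ST: "openin X S" "openin X T"
      using op[where P = True] by (auto simp: S_def T_def)
    have "topspace X \<subseteq> S \<union> T"
      by (auto simp: T_def path_component_of_refl)
    moreover have "S \<inter> T = {}"
      using path_component_of_trans path_component_of_sym by (fastforce simp: S_def T_def)
    moreover have "a \<in> S" using a by (simp add: S_def path_component_of_refl)
    ultimately have "T = {}"
      using assms(1) ST unfolding connected_space_def by (metis empty_iff)
    then have "b \<in> S" using b \<open>topspace X \<subseteq> S \<union> T\<close> by blast
    then show "path_component_of X a b" by (simp add: S_def)
  qed
qed

text \<open>
  A chart can be cut down to the preimage of a ball around the image of the given point.
\<close>

lemma manifold_chart:
  assumes "closed_connected_3_manifold M" "x \<in> topspace M"
  obtains U f g r where "r > 0" "openin M U" "x \<in> U"
    "homeomorphic_maps (subtopology M U) (top_of_set (ball (f x :: real^3) r)) f g"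
proof -
  obtain W V where W: "openin M W" "x \<in> W" "open (V :: (real^3) set)"
    "subtopology M W homeomorphic_space top_of_set V"
    using assms unfolding closed_connected_3_manifold_def by metis
  then obtain f g where fg: "homeomorphic_maps (subtopology M W) (top_of_set V) f g"
    unfolding homeomorphic_space_def by metis
  have tW: "topspace (subtopology M W) = W"
    by (rule topspace_subtopology_subset[OF openin_subset[OF W(1)]])
  have f: "continuous_map (subtopology M W) (top_of_set V) f"
    and g: "continuous_map (top_of_set V) (subtopology M W) g"
    and gf: "\<And>x. x \<in> W \<Longrightarrow> g (f x) = x" and fg': "\<And>y. y \<in> V \<Longrightarrow> f (g y) = y"
    using fg unfolding homeomorphic_maps_def tW by simp_all
  have fW: "f ` W \<subseteq> V" and gV: "g ` V \<subseteq> W"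
    using continuous_map_image_subset_topspace[OF f] continuous_map_image_subset_topspace[OF g]
    unfolding tW by simp_all
  have "f x \<in> V" using fW W(2) by blast
  then obtain r where r: "r > 0" "ball (f x) r \<subseteq> V"
    using W(3) open_contains_ball by metis
  define U where "U = {z \<in> topspace (subtopology M W). f z \<in> ball (f x) r}"
  have UW: "U \<subseteq> W" unfolding U_def tW by auto
  have "openin (top_of_set V) (ball (f x) r)"
    using r(2) by (simp add: openin_open_eq W(3))
  then have "openin (subtopology M W) U"
    unfolding U_def by (rule openin_continuous_map_preimage[OF f])
  then have U: "openin M U" using W(1) openin_open_subtopology by metis
  have xU: "x \<in> U" using W(2) r(1) unfolding U_def tW by simp
  have "f ` (topspace (subtopology M W) \<inter> U) = topspace (top_of_set V) \<inter> ball (f x) r"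
  proof (intro equalityI subsetI)
    fix y assume "y \<in> topspace (top_of_set V) \<inter> ball (f x) r"
    then have y: "y \<in> V" "y \<in> ball (f x) r" by simp_all
    then have "f (g y) = y" "g y \<in> W" using fg' gV by blast+
    then show "y \<in> f ` (topspace (subtopology M W) \<inter> U)"
      using y unfolding U_def tW by (intro image_eqI[of _ _ "g y"]) simp_all
  qed (use fW in \<open>auto simp: U_def\<close>)
  from homeomorphic_maps_subtopologies[OF fg this]
  have "homeomorphic_maps (subtopology M U) (top_of_set (ball (f x) r)) f g"
    using UW r(2) by (simp add: subtopology_subtopology Int_absorb1)
  with r(1) U xU show ?thesis by (rule that)
qed

lemma manifold_chart_contractible:
  assumes "openin M U" "homeomorphic_maps (subtopology M U) (top_of_set (ball (y :: real^3) r)) f g"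
  shows "contractible_space (subtopology M U)" "path_connectedin M U"
proof -
  have h: "subtopology M U homeomorphic_space top_of_set (ball y r)"
    using assms(2) unfolding homeomorphic_space_def by blast
  have "contractible_space (top_of_set (ball y r))"
    by (simp add: convex_imp_contractible)
  then show c: "contractible_space (subtopology M U)"
    using homeomorphic_space_contractibility[OF h] by simp
  show "path_connectedin M U"
    using contractible_imp_path_connected_space[OF c] openin_subset[OF assms(1)]
    by (simp add: path_connectedin_def)
qed

lemma manifold_path_connected:
  assumes "closed_connected_3_manifold M"
  shows "path_connected_space M"
proof (rule path_connected_space_if_locally)
  show "connected_space M"
    using assms by (simp add: closed_connected_3_manifold_def)
  fix x assume "x \<in> topspace M"
  then obtain U f g r where U: "r > 0" "openin M U" "x \<in> U"
    "homeomorphic_maps (subtopology M U) (top_of_set (ball (f x :: real^3) r)) f g"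
    using manifold_chart[OF assms] by metis
  show "\<exists>U. openin M U \<and> x \<in> U \<and> path_connectedin M U"
    using U(2,3) manifold_chart_contractible(2)[OF U(2,4)] by blast
qed

text \<open>
  A ball contracts to some point, which is joined to \<open>p\<close> by a path because the manifold is path connected.
\<close>

lemma manifold_chart_homotopic_const:
  assumes "closed_connected_3_manifold M" "openin M U" "p \<in> topspace M"
    "homeomorphic_maps (subtopology M U) (top_of_set (ball (y :: real^3) r)) f g"
  shows "homotopic_with (\<lambda>_. True) (subtopology M U) M id (\<lambda>_. p)"
proof -
  have id: "continuous_map (subtopology M U) M id"
    by (rule continuous_map_id_subt)
  obtain c where c: "homotopic_with (\<lambda>_. True) (subtopology M U) M id (\<lambda>_. c)"
    by (rule nullhomotopic_from_contractible_space[OF id manifold_chart_contractible(1)[OF assms(2,4)]])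
  have "homotopic_with (\<lambda>_. True) (subtopology M U) M (\<lambda>_. c) (\<lambda>_. p)"
  proof (cases "U = {}")
    case True
    then show ?thesis by (simp add: homotopic_constant_maps)
  next
    case False
    then obtain u where "u \<in> topspace (subtopology M U)"
      using topspace_subtopology_subset[OF openin_subset[OF assms(2)]] by blast
    then have "c \<in> topspace M"
      using homotopic_with_imp_continuous_maps[OF c] continuous_map_image_subset_topspace by blast
    then show ?thesis
      using manifold_path_connected[OF assms(1)] assms(3)
      by (simp add: homotopic_constant_maps path_connected_space_iff_path_component)
  qed
  then show ?thesis using c homotopic_with_trans by metis
qed

text \<open>
  After the contraction to \<open>c 1\<close>, the set is wrapped around the circle by the maps
  \<open>x \<mapsto> c (exp (2 \<pi> i s u(x)))\<close>, \<open>0 \<le> s \<le> 1\<close>, where \<open>u\<close> is a Urysohn function separating two points of \<open>Q\<close>.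
  Connectedness of \<open>Q\<close> makes \<open>u\<close> map onto the unit interval, so that the final image is the whole circle.
\<close>

lemma contractible_within_to_circle_if_const:
  assumes X: "normal_space X" "Hausdorff_space X"
    and A: "closedin X A" "homotopic_with (\<lambda>_. True) (subtopology X A) X id (\<lambda>_. c 1)"
    and Q: "connectedin X Q" "Q \<subseteq> A" "a \<in> Q" "b \<in> Q" "a \<noteq> b"
    and c: "continuous_map circle X c" "inj_on c (sphere 0 1)"
  shows "contractible_within_to X A circle"
proof -
  have AX: "A \<subseteq> topspace X" using A(1) by (rule closedin_subset)
  have "a \<in> topspace X" "b \<in> topspace X"
    by (rule subsetD[OF AX subsetD[OF Q(2)]], rule Q)+
  then have cl: "closedin X {a}" "closedin X {b}"
    by (simp_all add: closedin_Hausdorff_sing_eq[OF X(2)])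
  have "disjnt {a} {b}" using Q(5) by simp
  then obtain u where u: "continuous_map X (top_of_set {0..1::real}) u" and "u ` {a} \<subseteq> {0}" "u ` {b} \<subseteq> {1}"
    by (rule Urysohn_lemma[OF X(1) cl, of 0 1]) simp
  then have uab: "u a = 0" "u b = 1" by simp_all
  have uA: "u ` A = {0..1}"
  proof
    show "u ` A \<subseteq> {0..1}"
      using continuous_map_image_subset_topspace[OF u] AX
      by (simp add: image_subset_iff subset_eq)
    have "continuous_map X euclideanreal u" using u by (rule continuous_map_into_fulltopology)
    from connectedin_continuous_map_image[OF this Q(1)]
    have "connected (u ` Q)" by simp
    then have "{u a..u b} \<subseteq> u ` Q"
      using Q(3,4) connected_contains_Icc by blast
    then show "{0..1} \<subseteq> u ` A" using Q(2) unfolding uab by (metis image_mono subset_trans)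
  qed
  define w where "w t = cis (2 * pi * t)" for t :: real
  then have "w = (\<lambda>t. cis (2 * pi * t))" by (rule ext)
  then have w: "w ` {0..1} = sphere 0 1" by (simp only: circle_eq_cis_image)
  let ?I = "top_of_set {0..1::real}"
  have h: "continuous_map (prod_topology ?I (subtopology X A)) X (\<lambda>z. c (w (fst z * u (snd z))))"
  proof -
    have "continuous_map (prod_topology ?I (subtopology X A)) euclideanreal (\<lambda>z. fst z * u (snd z))"
    proof (intro continuous_map_real_mult)
      show "continuous_map (prod_topology ?I (subtopology X A)) euclideanreal fst"
        using continuous_map_fst continuous_map_into_fulltopology by blast
      have "continuous_map (prod_topology ?I (subtopology X A)) (subtopology X A) snd"
        by (rule continuous_map_snd)
      then have "continuous_map (prod_topology ?I (subtopology X A)) X snd"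
        by (rule continuous_map_into_fulltopology)
      from continuous_map_compose[OF this u]
      show "continuous_map (prod_topology ?I (subtopology X A)) euclideanreal (\<lambda>z. u (snd z))"
        unfolding o_def by (rule continuous_map_into_fulltopology)
    qed
    moreover have "continuous_map euclideanreal circle w"
      by (auto simp: continuous_map_in_subtopology w_def intro!: continuous_intros)
    ultimately have "continuous_map (prod_topology ?I (subtopology X A)) circle (w \<circ> (\<lambda>z. fst z * u (snd z)))"
      by (rule continuous_map_compose)
    from continuous_map_compose[OF this c(1)] show ?thesis by (simp add: o_def)
  qed
  have "homotopic_with (\<lambda>_. True) (subtopology X A) X (\<lambda>_. c 1) (\<lambda>x. c (w (u x)))"
    unfolding homotopic_with_def
    by (intro exI[of _ "\<lambda>z. c (w (fst z * u (snd z)))"] conjI h) (simp_all add: w_def)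
  then have hom: "homotopic_with (\<lambda>_. True) (subtopology X A) X id (\<lambda>x. c (w (u x)))"
    by (rule homotopic_with_trans[OF A(2)])
  have im: "(\<lambda>x. c (w (u x))) ` A = c ` sphere 0 1"
    unfolding w[symmetric] uA[symmetric] image_image ..
  have "homeomorphic_map circle (subtopology X (c ` sphere 0 1)) c"
  proof (rule continuous_imp_homeomorphic_map)
    show "continuous_map circle (subtopology X (c ` sphere 0 1)) c"
      using c(1) by (simp add: continuous_map_in_subtopology)
    show "compact_space circle" by (simp add: compact_space_subtopology)
    show "Hausdorff_space (subtopology X (c ` sphere 0 1))"
      using X(2) by (rule Hausdorff_space_subtopology)
    show "c ` topspace circle = topspace (subtopology X (c ` sphere 0 1))"
      using continuous_map_image_subset_topspace[OF c(1)] by (simp add: topspace_subtopology Int_absorb1)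
    show "inj_on c (topspace circle)" using c(2) by simp
  qed
  then have "subtopology X ((\<lambda>x. c (w (u x))) ` A) homeomorphic_space circle"
    unfolding im by (metis homeomorphic_map_imp_homeomorphic_space homeomorphic_space_sym)
  with hom show ?thesis
    by (subst contractible_within_to_iff_homotopic[OF AX]) (intro exI conjI)
qed

lemma chart_inverse:
  assumes U: "openin M U" and fg: "homeomorphic_maps (subtopology M U) (top_of_set B) f g"
  shows "continuous_map (top_of_set B) M g" "g ` B \<subseteq> U" "inj_on g B"
proof -
  have g: "continuous_map (top_of_set B) (subtopology M U) g" and "\<forall>y\<in>B. f (g y) = y"
    using fg by (simp_all add: homeomorphic_maps_def)
  then show "inj_on g B" by (metis inj_on_inverseI)
  show "continuous_map (top_of_set B) M g" using g by (rule continuous_map_into_fulltopology)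
  show "g ` B \<subseteq> U" using g by (simp add: continuous_map_in_subtopology image_subset_iff_funcset)
qed

lemma manifold_chart_block:
  assumes M: "closed_connected_3_manifold M" and "p \<in> topspace M" "x \<in> topspace M"
  shows "\<exists>W Q. openin M W \<and> x \<in> W \<and> W \<subseteq> Q \<and> chart_block TYPE(real^3) M p Q"
proof -
  obtain U f g r where U: "r > 0" "openin M U" "x \<in> U"
    and fg: "homeomorphic_maps (subtopology M U) (top_of_set (ball (f x :: real^3) r)) f g"
    using manifold_chart[OF M assms(3)] by metis
  have tU: "topspace (subtopology M U) = U"
    by (rule topspace_subtopology_subset[OF openin_subset[OF U(2)]])
  have f: "continuous_map (subtopology M U) (top_of_set (ball (f x) r)) f"
    and gf: "\<And>x. x \<in> U \<Longrightarrow> g (f x) = x"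
    using fg unfolding homeomorphic_maps_def tU by simp_all
  define W where "W = {z \<in> topspace (subtopology M U). f z \<in> ball (f x) (r/2)}"
  have "openin (top_of_set (ball (f x) r)) (ball (f x) (r/2))"
    using U(1) by (simp add: openin_open_eq subset_ball)
  then have "openin (subtopology M U) W"
    unfolding W_def by (rule openin_continuous_map_preimage[OF f])
  then have "openin M W" using U(2) openin_open_subtopology by metis
  moreover have "x \<in> W" using U(1,3) unfolding W_def tU by simp
  moreover have "W \<subseteq> g ` cball (f x) (r/2)"
  proof
    fix z assume "z \<in> W"
    then have "z = g (f z)" "f z \<in> cball (f x) (r/2)" using gf unfolding W_def tU by simp_all
    then show "z \<in> g ` cball (f x) (r/2)" by (rule image_eqI)
  qed
  moreover have "chart_block TYPE(real^3) M p (g ` cball (f x) (r/2))"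
    unfolding chart_block_def
  proof (intro exI conjI)
    show "openin M U" by (rule U(2))
    show "homotopic_with (\<lambda>_. True) (subtopology M U) M id (\<lambda>_. p)"
      by (rule manifold_chart_homotopic_const[OF M U(2) assms(2) fg])
    show "homeomorphic_maps (subtopology M U) (top_of_set (ball (f x) r)) f g" by (rule fg)
    show "cball (f x) (r/2) \<subseteq> ball (f x) r" using U(1) by (simp add: cball_subset_ball_iff)
  qed simp_all
  ultimately show ?thesis by blast
qed

lemma circle_in_chart:
  assumes r: "r > 0" and g: "continuous_map (top_of_set (ball (y :: real^3) r)) M g" "inj_on g (ball y r)"
  obtains c where "continuous_map circle M c" "inj_on c (sphere 0 1)" "c ` sphere 0 1 \<subseteq> g ` cball y (r/2)"
proof -
  define e where "e z = y + (r/2) *\<^sub>R (Re z *\<^sub>R axis 1 1 + Im z *\<^sub>R axis 2 1)" for z :: complex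
  have norm: "norm (Re z *\<^sub>R axis 1 1 + Im z *\<^sub>R axis 2 1 :: real^3) = cmod z" for z
    by (simp add: norm_eq_sqrt_inner inner_axis_axis inner_add_left inner_add_right cmod_def
        power2_eq_square inner_complex_def)
  have dist: "dist y (e z) = r/2" if "z \<in> sphere 0 1" for z
    using norm[of z] that r by (simp add: e_def dist_norm)
  have inj: "inj e"
  proof (rule injI)
    fix z w assume "e z = e w"
    then have "Re z *\<^sub>R axis 1 1 + Im z *\<^sub>R axis 2 1 = (Re w *\<^sub>R axis 1 1 + Im w *\<^sub>R axis 2 1 :: real^3)"
      using r by (simp add: e_def)
    then have "(Re z *\<^sub>R axis 1 1 + Im z *\<^sub>R axis 2 1 :: real^3) $ i = (Re w *\<^sub>R axis 1 1 + Im w *\<^sub>R axis 2 1) $ i" for i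
      by simp
    from this[of 1] this[of 2] show "z = w"
      by (simp add: axis_def complex_eq_iff)
  qed
  have "e z \<in> ball y r" if "z \<in> sphere 0 1" for z
    using r by (simp only: mem_ball dist[OF that])
  then have eb: "e ` sphere 0 1 \<subseteq> ball y r" by (rule image_subsetI)
  have "continuous_on (sphere 0 1) e" unfolding e_def by (intro continuous_intros)
  then have e: "continuous_map circle (top_of_set (ball y r)) e"
    using eb by (simp add: image_subset_iff_funcset)
  show ?thesis
  proof (rule that[of "g \<circ> e"])
    show "continuous_map circle M (g \<circ> e)" by (rule continuous_map_compose[OF e g(1)])
    show "inj_on (g \<circ> e) (sphere 0 1)"
      by (rule comp_inj_on[OF inj_on_subset[OF inj subset_UNIV] inj_on_subset[OF g(2) eb]])
    have "e ` sphere 0 1 \<subseteq> cball y (r/2)" using dist by (simp add: image_subset_iff)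
    then show "(g \<circ> e) ` sphere 0 1 \<subseteq> g ` cball y (r/2)"
      unfolding image_comp[symmetric] by (rule image_mono)
  qed
qed

text \<open>
  The circle and the connected set that makes all pieces large enough are taken inside one ball of a chart.
\<close>

theorem closed_3_manifold_circle_cover:
  assumes M: "closed_connected_3_manifold M"
  shows "has_P_cover circle M 4"
proof -
  have X: "compact_space M" "Hausdorff_space M" "topspace M \<noteq> {}"
    using M by (simp_all add: closed_connected_3_manifold_def)
  have normal: "normal_space M"
    by (rule compact_Hausdorff_or_regular_imp_normal_space) (simp_all add: X)
  obtain x0 where "x0 \<in> topspace M" using X(3) by blast
  then obtain U f g r where U: "r > 0" "openin M U" "x0 \<in> U"
    and fg: "homeomorphic_maps (subtopology M U) (top_of_set (ball (f x0 :: real^3) r)) f g"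
    using manifold_chart[OF M] by metis
  define y where "y = f x0"
  note g = chart_inverse[OF U(2) fg, folded y_def]
  obtain c where c: "continuous_map circle M c" "inj_on c (sphere 0 1)" "c ` sphere 0 1 \<subseteq> g ` cball y (r/2)"
    by (rule circle_in_chart[OF U(1) g(1,3)])
  define A where "A = g ` cball y (r/2)"
  have sub: "cball y (r/2) \<subseteq> ball y r" using U(1) by (simp add: cball_subset_ball_iff)
  have "compactin (top_of_set (ball y r)) (cball y (r/2))"
    using sub by (simp add: compactin_subtopology)
  then have "compactin M A" unfolding A_def by (rule image_compactin[OF _ g(1)])
  then have clA: "closedin M A" by (rule compactin_imp_closedin[OF X(2)])
  have "connectedin (top_of_set (ball y r)) (cball y (r/2))"
    using sub by (simp add: connectedin_subtopology)
  then have conA: "connectedin M A" unfolding A_def by (rule connectedin_continuous_map_image[OF g(1)])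
  have c1: "c 1 \<in> A" "c (-1) \<in> A" using c(3) unfolding A_def by (simp_all add: image_subset_iff)
  have neq: "c 1 \<noteq> c (-1)" using inj_onD[OF c(2), of 1 "-1"] by auto
  have pM: "c 1 \<in> topspace M" using c1(1) closedin_subset[OF clA] by (rule rev_subsetD)
  have "homotopic_with (\<lambda>_. True) (subtopology M U) M id (\<lambda>_. c 1)"
    by (rule manifold_chart_homotopic_const[OF M U(2) pM fg])
  moreover have "A \<subseteq> U" using g(2) sub unfolding A_def by (meson image_mono subset_trans)
  ultimately have oA: "openly_contractible_to M (c 1) A"
    unfolding openly_contractible_to_def using U(2) by (intro exI conjI)
  have "\<forall>x\<in>topspace M. \<exists>WQ. openin M (fst WQ) \<and> x \<in> fst WQ \<and> fst WQ \<subseteq> snd WQ \<and>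
      chart_block TYPE(real^3) M (c 1) (snd WQ)"
    using manifold_chart_block[OF M pM] by simp
  from bchoice[OF this] obtain WQ where WQ: "\<forall>x\<in>topspace M. openin M (fst (WQ x)) \<and> x \<in> fst (WQ x) \<and>
      fst (WQ x) \<subseteq> snd (WQ x) \<and> chart_block TYPE(real^3) M (c 1) (snd (WQ x))"
    by (elim exE)
  have "\<exists>\<F>. finite \<F> \<and> \<F> \<subseteq> (\<lambda>x. fst (WQ x)) ` topspace M \<and> topspace M \<subseteq> \<Union>\<F>"
  proof -
    let ?C = "(\<lambda>x. fst (WQ x)) ` topspace M"
    have "(\<forall>U\<in>?C. openin M U) \<and> topspace M \<subseteq> \<Union>?C" using WQ by auto
    from X(1)[unfolded compact_space_alt, THEN spec, THEN mp, OF this] show ?thesis .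
  qed
  then obtain \<F> where \<F>: "finite \<F>" "\<F> \<subseteq> (\<lambda>x. fst (WQ x)) ` topspace M" "topspace M \<subseteq> \<Union>\<F>"
    by (elim exE conjE)
  obtain T where T: "T \<subseteq> topspace M" "finite T" "\<F> = (\<lambda>x. fst (WQ x)) ` T"
    using finite_subset_image[OF \<F>(1,2)] by (elim exE conjE)
  define \<Q> where "\<Q> = (\<lambda>x. snd (WQ x)) ` T"
  have "finite \<Q>" using T(2) by (simp add: \<Q>_def)
  moreover have "chart_block TYPE(real^3) M (c 1) Q" if "Q \<in> \<Q>" for Q
    using that WQ T(1) unfolding \<Q>_def by auto
  ultimately have "\<exists>A'. (\<forall>i\<le>DIM(real^3). closedin M (A' i) \<and> openly_contractible_to M (c 1) (A' i) \<and> A \<subseteq> A' i) \<and>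
      \<Union>\<Q> \<subseteq> (\<Union>i\<le>DIM(real^3). A' i)"
    by (rule cover_chart_blocks[OF X(1,2) clA oA])
  then
  obtain A' where A': "\<forall>i\<le>DIM(real^3). closedin M (A' i) \<and> openly_contractible_to M (c 1) (A' i) \<and> A \<subseteq> A' i"
    and cov: "\<Union>\<Q> \<subseteq> (\<Union>i\<le>DIM(real^3). A' i)"
    by (elim exE conjE)
  have four: "i \<le> DIM(real^3) \<longleftrightarrow> i < 4" "{..DIM(real^3)} = {..<4}" for i by auto
  note A' = A'[unfolded four, rule_format] and cov = cov[unfolded four \<Q>_def]
  have con: "contractible_within_to M (A' i) circle" if "i < 4" for i
  proof -
    have "homotopic_with (\<lambda>_. True) (subtopology M (A' i)) M id (\<lambda>_. c 1)"
      using A'[OF that] unfolding openly_contractible_to_def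
      by (elim conjE exE) (rule homotopic_with_id_subset)
    then show ?thesis
      using A'[OF that] by (intro contractible_within_to_circle_if_const[OF normal X(2) _ _ conA _ c1 neq c(1,2)]) simp_all
  qed
  have "topspace M = (\<Union>i<4. A' i)"
  proof
    have "(\<Union>x\<in>T. fst (WQ x)) \<subseteq> (\<Union>x\<in>T. snd (WQ x))"
      by (rule UN_mono) (use WQ T(1) in auto)
    then show "topspace M \<subseteq> (\<Union>i<4. A' i)" using \<F>(3) cov unfolding T(3) by (meson subset_trans)
    show "(\<Union>i<4. A' i) \<subseteq> topspace M"
      by (rule UN_least, rule closedin_subset) (use A' in simp)
  qed
  with A' con show ?thesis
    unfolding has_P_cover_def by (intro exI[of _ A']) simp
qed

section \<open>Spheres mapped to spaces that deform to a circle\<close>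

text \<open>
  Up to homotopy \<open>e\<close> factors through a circle, and maps from spheres of dimension at least two to a
  circle are null-homotopic.
\<close>

lemma nullhomotopic_into_circle_deformable:
  fixes S :: "'b::real_normed_vector set" and e :: "'a::euclidean_space \<Rightarrow> 'b"
  assumes "contractible_within_to (top_of_set S) S circle" and dim: "2 < DIM('a)"
    and e: "continuous_on (sphere 0 1) e" "e ` sphere 0 1 \<subseteq> S"
  shows "\<exists>a. homotopic_with_canon (\<lambda>_. True) (sphere 0 1) S e (\<lambda>_. a)"
proof -
  obtain f where f: "homotopic_with_canon (\<lambda>_. True) S S id f" and "f ` S homeomorphic sphere (0::complex) 1"
    using assms(1) contractible_within_to_set_iff[OF subset_refl] by metis
  then obtain h k where hk: "homeomorphism (f ` S) (sphere (0::complex) 1) h k"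
    unfolding homeomorphic_def by metis
  have fS: "f ` S \<subseteq> S" using homotopic_with_imp_subset2[OF f] .
  have contf: "continuous_on S f" using homotopic_with_imp_continuous[OF f] by simp
  have step: "homotopic_with_canon (\<lambda>_. True) (sphere 0 1) S (id \<circ> e) (f \<circ> e)"
    by (rule homotopic_with_compose_continuous_right[OF f]) (use e in auto)
  have "\<exists>c. homotopic_with_canon (\<lambda>_. True) (sphere 0 1) (sphere (0::complex) 1) (h \<circ> (f \<circ> e)) (\<lambda>_. c)"
  proof -
    have fe: "continuous_on (sphere 0 1) (f \<circ> e)"
      by (rule continuous_on_compose[OF e(1) continuous_on_subset[OF contf e(2)]])
    have im: "(f \<circ> e) ` sphere 0 1 \<subseteq> f ` S" using e(2) by auto
    have "continuous_on (sphere 0 1) (h \<circ> (f \<circ> e))"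
      by (rule continuous_on_compose[OF fe continuous_on_subset[OF homeomorphism_cont1[OF hk] im]])
    moreover have "h \<circ> (f \<circ> e) \<in> sphere 0 1 \<rightarrow> sphere 0 1"
      using im homeomorphism_image1[OF hk] by fastforce
    ultimately show ?thesis
      using inessential_spheremap_2[OF dim, where 'b = complex] by (metis DIM_complex)
  qed
  then obtain c where c: "homotopic_with_canon (\<lambda>_. True) (sphere 0 1) (sphere (0::complex) 1) (h \<circ> (f \<circ> e)) (\<lambda>_. c)" ..
  have "homotopic_with_canon (\<lambda>_. True) (sphere 0 1) S (k \<circ> (h \<circ> (f \<circ> e))) (k \<circ> (\<lambda>_. c))"
    by (rule homotopic_with_compose_continuous_left[OF c homeomorphism_cont2[OF hk]])
       (use homeomorphism_image2[OF hk] fS in auto)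
  then have "homotopic_with_canon (\<lambda>_. True) (sphere 0 1) S (f \<circ> e) (\<lambda>_. k c)"
  proof (rule homotopic_with_eq)
    fix x :: 'a assume "x \<in> topspace (top_of_set (sphere 0 1))"
    then have "x \<in> sphere 0 1" by simp
    with e(2) have "e x \<in> S" by blast
    then have "f (e x) \<in> f ` S" by (rule imageI)
    then show "(f \<circ> e) x = (k \<circ> (h \<circ> (f \<circ> e))) x" using homeomorphism_apply1[OF hk] by simp
  qed simp_all
  from homotopic_with_trans[OF step this] show ?thesis by (intro exI[of _ "k c"]) simp
qed

text \<open>
  If different points of the orbit of \<open>x\<close> are at least \<open>d\<close> apart, then the balls of radius
  \<open>d / 2\<close> around the points of the orbit are disjoint, they are permuted by the isometries, and \<open>p\<close> is
  injective on each of them because an isometry in \<open>G\<close> that fixes their centre fixes everything.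
\<close>

lemma covering_space_free_finite_isometries:
  fixes C :: "'a::euclidean_space set" and p :: "'a \<Rightarrow> 'b::euclidean_space"
  assumes C: "compact C" and p: "continuous_on C p" and G: "finite G"
    and GC: "\<And>g x. g \<in> G \<Longrightarrow> x \<in> C \<Longrightarrow> g x \<in> C"
    and iso: "\<And>g x y. g \<in> G \<Longrightarrow> x \<in> C \<Longrightarrow> y \<in> C \<Longrightarrow> dist (g x) (g y) = dist x y"
    and fib: "\<And>x y. x \<in> C \<Longrightarrow> y \<in> C \<Longrightarrow> p x = p y \<longleftrightarrow> (\<exists>g\<in>G. y = g x)"
    and free: "\<And>g x y. g \<in> G \<Longrightarrow> x \<in> C \<Longrightarrow> y \<in> C \<Longrightarrow> g x = x \<Longrightarrow> g y = y"
  shows "covering_space C p (p ` C)"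
proof (rule covering_spaceI[OF p refl])
  have quot: "openin (top_of_set (p ` C)) T" if "T \<subseteq> p ` C" "openin (top_of_set C) (C \<inter> p -` T)" for T
    using Abstract_Topology_2.continuous_imp_quotient_map[OF p refl C that(1)] that(2) by simp
  have opn: "openin (top_of_set (p ` C)) (p ` W)" if W: "openin (top_of_set C) W" for W
  proof (rule quot)
    have WC: "W \<subseteq> C" using openin_imp_subset[OF W] .
    then show "p ` W \<subseteq> p ` C" by blast
    show "openin (top_of_set C) (C \<inter> p -` p ` W)"
      unfolding openin_euclidean_subtopology_iff
    proof (intro conjI ballI)
      fix y assume y: "y \<in> C \<inter> p -` p ` W"
      then obtain w where w: "w \<in> W" "p y = p w" by auto
      then obtain g where g: "g \<in> G" "w = g y" using fib y WC by blast
      obtain \<epsilon> where \<epsilon>: "\<epsilon> > 0" "\<And>z. z \<in> C \<Longrightarrow> dist z w < \<epsilon> \<Longrightarrow> z \<in> W"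
        using W w(1) unfolding openin_euclidean_subtopology_iff by metis
      have "z \<in> C \<inter> p -` p ` W" if z: "z \<in> C" "dist z y < \<epsilon>" for z
      proof -
        have "dist (g z) w < \<epsilon>" using iso[OF g(1) z(1)] y z(2) g(2) by simp
        then have "g z \<in> W" using \<epsilon>(2) GC[OF g(1) z(1)] by blast
        moreover have "p z = p (g z)" using fib[OF z(1) GC[OF g(1) z(1)]] g(1) by blast
        ultimately show ?thesis using z(1) by auto
      qed
      then show "\<exists>e>0. \<forall>x'\<in>C. dist x' y < e \<longrightarrow> x' \<in> C \<inter> p -` p ` W" using \<epsilon>(1) by blast
    qed auto
  qed
  fix b assume "b \<in> p ` C"
  then obtain x where x: "x \<in> C" "b = p x" by blast
  define Orb where "Orb = (\<lambda>g. g x) ` G"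
  have pg: "p (g y) = p y" if "g \<in> G" "y \<in> C" for g y
    using fib[OF that(2) GC[OF that]] that(1) by auto
  have Orb: "a \<in> C" "\<exists>g\<in>G. a = g x" "\<exists>h\<in>G. x = h a" if aO: "a \<in> Orb" for a
  proof -
    obtain g where g: "g \<in> G" "a = g x" using aO unfolding Orb_def by auto
    then show aC: "a \<in> C" and "\<exists>g\<in>G. a = g x" using GC[OF g(1) x(1)] by auto
    have "p a = p x" using pg[OF g(1) x(1)] g(2) by simp
    then show "\<exists>h\<in>G. x = h a" using fib[OF aC x(1)] by simp
  qed
  have finD: "finite ((\<lambda>(a, a'). dist a a') ` {z \<in> Orb \<times> Orb. fst z \<noteq> snd z})" (is "finite ?D")
    using G unfolding Orb_def by simp
  define d where "d = Min (insert 1 ?D)"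
  have d0: "d > 0"
    using finD by (auto simp: d_def)
  have dmin: "d \<le> dist a a'" if "a \<in> Orb" "a' \<in> Orb" "a \<noteq> a'" for a a'
  proof -
    have "dist a a' \<in> ?D" by (rule image_eqI[of _ _ "(a, a')"]) (use that in auto)
    then show ?thesis unfolding d_def using finD by (intro Min_le) auto
  qed
  define V where "V a = C \<inter> ball a (d/2)" for a
  define T where "T = p ` V x"
  have sep: "a = a'" if "a \<in> Orb" "a' \<in> Orb" "y \<in> V a" "y \<in> V a'" for a a' y
  proof (rule ccontr)
    assume "a \<noteq> a'"
    then have "d \<le> dist a a'" using dmin that(1,2) by simp
    also have "\<dots> \<le> dist a y + dist a' y" by (metis dist_commute dist_triangle)
    also have "\<dots> < d" using that(3,4) by (simp add: V_def)
    finally show False by simp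
  qed
  have opV: "openin (top_of_set C) (V a)" for a
    unfolding V_def by (simp add: openin_open_Int)
  have shift: "g y \<in> V (g a)" if "g \<in> G" "a \<in> C" "y \<in> V a" for g a y
    using that iso[OF that(1,2), of y] GC[OF that(1)] by (auto simp: V_def)
  have VC: "V a \<subseteq> C" for a unfolding V_def by simp
  have shift_img: "p ` V a \<subseteq> p ` V (g a)" if g: "g \<in> G" and a: "a \<in> C" for g a
  proof (rule image_subsetI)
    fix y assume y: "y \<in> V a"
    have "p y = p (g y)" using pg[OF g subsetD[OF VC y]] by simp
    then show "p y \<in> p ` V (g a)" using shift[OF g a y] by (rule image_eqI)
  qed
  have pV: "p ` V a = T" if a: "a \<in> Orb" for a
  proof -
    obtain g where g: "g \<in> G" "a = g x" using Orb(2)[OF a] by (elim bexE)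
    obtain h where h: "h \<in> G" "x = h a" using Orb(3)[OF a] by (elim bexE)
    have "p ` V x \<subseteq> p ` V a" using shift_img[OF g(1) x(1)] unfolding g(2)[symmetric] .
    moreover have "p ` V a \<subseteq> p ` V x"
      using shift_img[OF h(1) Orb(1)[OF a]] unfolding h(2)[symmetric] .
    ultimately show ?thesis unfolding T_def by (rule subset_antisym[rotated])
  qed
  have inj: "inj_on p (V a)" if a: "a \<in> Orb" for a
  proof (rule inj_onI)
    fix y z assume y: "y \<in> V a" and z: "z \<in> V a" and eq: "p y = p z"
    have yC: "y \<in> C" "z \<in> C" using y z VC by auto
    then obtain g where g: "g \<in> G" "z = g y" using fib[OF yC] eq by auto
    have aC: "a \<in> C" by (rule Orb(1)[OF a])
    obtain k where k: "k \<in> G" "a = k x" using Orb(2)[OF a] by (elim bexE)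
    have "p x = p (g a)" using pg[OF k(1) x(1)] pg[OF g(1) aC] k(2) by simp
    then have "\<exists>h\<in>G. g a = h x" using fib[OF x(1) GC[OF g(1) aC]] by simp
    then have "g a \<in> Orb" unfolding Orb_def by auto
    moreover have "z \<in> V (g a)" using shift[OF g(1) aC y] g(2) by simp
    ultimately have "g a = a" using sep a z by simp
    then have "g y = y" by (rule free[OF g(1) aC yC(1)])
    then show "y = z" using g(2) by simp
  qed
  have pre: "\<Union>(V ` Orb) = C \<inter> p -` T"
  proof (intro equalityI subsetI)
    fix y assume "y \<in> \<Union>(V ` Orb)"
    then obtain a where a: "a \<in> Orb" "y \<in> V a" by (elim UN_E)
    then have "p y \<in> T" using pV[OF a(1)] by auto
    then show "y \<in> C \<inter> p -` T" using a(2) VC by auto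
  next
    fix y assume "y \<in> C \<inter> p -` T"
    then have y: "y \<in> C" "p y \<in> p ` V x" by (simp_all add: T_def)
    obtain u where u: "p y = p u" "u \<in> V x" using y(2) by (rule imageE)
    obtain g where g: "g \<in> G" "y = g u" using fib[OF subsetD[OF VC u(2)] y(1)] u(1) by auto
    have "y \<in> V (g x)" using shift[OF g(1) x(1) u(2)] g(2) by simp
    then show "y \<in> \<Union>(V ` Orb)" using g(1) unfolding Orb_def by auto
  qed
  show "\<exists>T. b \<in> T \<and> openin (top_of_set (p ` C)) T \<and>
      (\<exists>v. \<Union>v = C \<inter> p -` T \<and> (\<forall>u\<in>v. openin (top_of_set C) u) \<and> pairwise disjnt v \<and>
        (\<forall>u\<in>v. \<exists>q. homeomorphism u T p q))"
  proof (intro exI[of _ T] exI[of _ "V ` Orb"] conjI)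
    show "b \<in> T" unfolding T_def x(2) by (rule imageI) (simp add: V_def x(1) d0)
    show "openin (top_of_set (p ` C)) T" unfolding T_def by (rule opn[OF opV])
    show "pairwise disjnt (V ` Orb)"
    proof (rule pairwiseI)
      fix A B assume "A \<in> V ` Orb" "B \<in> V ` Orb" "A \<noteq> B"
      then show "disjnt A B" using sep unfolding disjnt_def by (elim imageE) auto
    qed
    show "\<forall>u\<in>V ` Orb. \<exists>q. homeomorphism u T p q"
    proof (rule ballI, erule imageE)
      fix U a assume a: "a \<in> Orb" and U: "U = V a"
      obtain q where "homeomorphism (V a) T p q"
      proof (rule homeomorphism_injective_open_map[of "V a" p T])
        show "continuous_on (V a) p" by (rule continuous_on_subset[OF p VC])
        fix W assume W: "openin (top_of_set (V a)) W"
        have WC: "openin (top_of_set C) W" by (rule openin_trans[OF W opV])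
        have "p ` W \<subseteq> T" unfolding pV[OF a, symmetric] by (rule image_mono[OF openin_imp_subset[OF W]])
        moreover have "T \<subseteq> p ` C" unfolding T_def by (rule image_mono[OF VC])
        ultimately show "openin (top_of_set T) (p ` W)"
          using openin_subset_trans[OF opn[OF WC]] by simp
      qed (use pV[OF a] inj[OF a] in simp_all)
      then show "\<exists>q. homeomorphism U T p q" unfolding U by (rule exI[of _ q])
    qed
  qed (use pre opV in simp_all)
qed

text \<open>
  Lift the null-homotopy of \<open>p\<close> starting from the identity.  At the end it arrives in a single finite
  fibre, so by connectedness at a single point.
\<close>

lemma contractible_if_covering_nullhomotopic:
  fixes C :: "'a::euclidean_space set" and p :: "'a \<Rightarrow> 'b::euclidean_space"
  assumes cov: "covering_space C p S" and "connected C"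
    and fin: "\<And>b. finite (C \<inter> p -` {b})"
    and null: "homotopic_with_canon (\<lambda>_. True) C S p (\<lambda>_. a)"
  shows "contractible C"
proof -
  obtain h where h: "continuous_on ({0..1::real} \<times> C) h" "h \<in> {0..1} \<times> C \<rightarrow> S"
    "\<And>x. h (0, x) = p x" "\<And>x. h (1, x) = a"
    using null unfolding homotopic_with_def by (auto simp: image_subset_iff_funcset)
  obtain k where k: "continuous_on ({0..1} \<times> C) k" "k \<in> {0..1} \<times> C \<rightarrow> C"
    "\<And>y. y \<in> C \<Longrightarrow> k (0, y) = y" "\<And>z. z \<in> {0..1} \<times> C \<Longrightarrow> h z = p (k z)"
    by (rule covering_space_lift_homotopy[OF cov h(1,2), of "\<lambda>y. y"]) (use h(3) in auto)
  define g where "g y = k (1, y)" for y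
  have "continuous_on C g"
    unfolding g_def by (intro continuous_on_compose2[OF k(1)] continuous_intros) auto
  then have "connected (g ` C)" by (rule connected_continuous_image[OF _ assms(2)])
  moreover have gC: "g y \<in> C \<inter> p -` {a}" if y: "y \<in> C" for y
  proof -
    have m: "(1::real, y) \<in> {0..1} \<times> C" using y by simp
    have "p (g y) = a" unfolding g_def k(4)[OF m, symmetric] by (rule h(4))
    moreover have "g y \<in> C" unfolding g_def using k(2) m by (rule funcset_mem)
    ultimately show ?thesis by simp
  qed
  then have "finite (g ` C)" by (intro finite_subset[OF _ fin] image_subsetI)
  ultimately have "g ` C = {} \<or> (\<exists>b. g ` C = {b})" by (simp add: connected_finite_iff_sing)
  then obtain b where b: "\<And>y. y \<in> C \<Longrightarrow> g y = b" by auto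
  have "homotopic_with_canon (\<lambda>_. True) C C id (\<lambda>_. b)"
    by (subst homotopic_with)
       (use k b in \<open>auto intro!: exI[of _ k] simp: image_subset_iff_funcset g_def\<close>)
  then show ?thesis
    unfolding contractible_def by (intro exI[of _ b])
qed

section \<open>Lens spaces\<close>

text \<open>
  The two quotient maps factor through each other.
\<close>

lemma homeomorphic_space_if_same_fibres:
  assumes f: "quotient_map X Y f" and g: "quotient_map X Z g"
    and eq: "\<And>x y. x \<in> topspace X \<Longrightarrow> y \<in> topspace X \<Longrightarrow> f x = f y \<longleftrightarrow> g x = g y"
  shows "Y homeomorphic_space Z"
proof -
  obtain h where h: "continuous_map Y Z h" "\<forall>x\<in>topspace X. h (f x) = g x"
    using quotient_map_factor[OF f quotient_imp_continuous_map[OF g]] eq by metis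
  obtain k where k: "continuous_map Z Y k" "\<forall>x\<in>topspace X. k (g x) = f x"
    using quotient_map_factor[OF g quotient_imp_continuous_map[OF f]] eq by metis
  have "homeomorphic_maps Y Z h k"
    unfolding homeomorphic_maps_def quotient_imp_surjective_map[OF f, symmetric]
      quotient_imp_surjective_map[OF g, symmetric]
    using h k by simp
  then show ?thesis by (rule homeomorphic_maps_imp_homeomorphic_space)
qed

lemma lens_action_apply:
  assumes "x \<in> S3"
  shows "lens_action p q k x =
    (cis (2 * pi * of_int k / of_nat p) * fst x, cis (2 * pi * of_int (q * k) / of_nat p) * snd x)"
  using assms by (cases x) (simp add: lens_action_def)

lemma lens_action_cong:
  assumes "p > 0" "q mod int p = q' mod int p"
  shows "lens_action p q = lens_action p q'"
proof -
  have "cis (2 * pi * of_int (q * k) / of_nat p) = cis (2 * pi * of_int (q' * k) / of_nat p)" for k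
    using cis_mod_eq[OF assms(1), of k q] cis_mod_eq[OF assms(1), of k q'] assms(2)
    by (simp add: mult.commute)
  then show ?thesis
    by (simp add: lens_action_def fun_eq_iff)
qed

text \<open>
  For \<open>q\<close> coprime to \<open>p\<close>, these invariants of the action \<open>(z, w) \<mapsto> (\<zeta> z, \<zeta>^q w)\<close> separate its orbits on
  the sphere.  They realise the lens space as a subset of a Euclidean space, where homotopies have explicit
  formulas and the lifting theorems for covering spaces apply.
\<close>

definition lens_embedding :: "nat \<Rightarrow> nat \<Rightarrow> complex \<times> complex \<Rightarrow> complex \<times> complex \<times> complex" where
  "lens_embedding p q x = (fst x ^ p, snd x * cnj (fst x) ^ q, snd x ^ p)"

lemma continuous_on_lens_embedding: "continuous_on S (lens_embedding p q)"
  unfolding lens_embedding_def by (intro continuous_intros)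

lemma cis_root_power:
  assumes "p > 0"
  shows "cis (2 * pi * of_int n / of_nat p) ^ p = 1"
proof -
  have "cis (2 * pi * of_int n / of_nat p) ^ p = cis (2 * pi * of_int n)"
    using assms by (simp add: Complex.DeMoivre)
  then show ?thesis by (simp add: cis_multiple_2pi)
qed

lemma lens_embedding_action:
  assumes "p > 0" "x \<in> S3"
  shows "lens_embedding p q (lens_action p (int q) k x) = lens_embedding p q x"
proof -
  let ?\<zeta> = "cis (2 * pi * of_int k / of_nat p)"
  have "cis (2 * pi * of_int (int q * k) / of_nat p) = ?\<zeta> ^ q"
    by (simp add: Complex.DeMoivre algebra_simps)
  moreover have "?\<zeta> ^ q * cnj ?\<zeta> ^ q = 1"
    by (simp add: power_mult_distrib[symmetric] cis_cnj cis_mult)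
  ultimately show ?thesis
    using assms cis_root_power[OF assms(1), of k] cis_root_power[OF assms(1), of "int q * k"]
    by (simp add: lens_action_apply lens_embedding_def power_mult_distrib)
qed

lemma root_of_unity_quotient:
  fixes z z' :: complex
  assumes "p > 0" "z ^ p = z' ^ p" "z \<noteq> 0"
  obtains k where "k \<in> {0..<int p}" "z' = cis (2 * pi * of_int k / of_nat p) * z"
proof -
  have "(z' / z) ^ p = 1"
    using assms(3) by (simp add: power_divide assms(2)[symmetric])
  then have "z' / z \<in> (\<lambda>k. cis (2 * pi * real k / real p)) ` {..<p}"
    using Complex.bij_betw_roots_unity[OF assms(1)] by (simp add: bij_betw_def)
  then obtain k where k: "k < p" "z' / z = cis (2 * pi * real k / real p)" by auto
  show ?thesis
    by (rule that[of "int k"]) (use k assms(3) in \<open>auto simp: field_simps\<close>)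
qed

text \<open>
  The first invariant determines \<open>z\<close> up to a \<open>p\<close>-th root of unity.  If \<open>z \<noteq> 0\<close>, the second one then
  determines \<open>w\<close>; if \<open>z = 0\<close>, the third one determines \<open>w\<close> up to a \<open>p\<close>-th root of unity, and every such
  root is a power of \<open>\<zeta>^q\<close> because \<open>q\<close> is invertible modulo \<open>p\<close>.
\<close>

lemma lens_embedding_fibre:
  assumes p: "p > 0" "coprime (int p) (int q)" and x: "x \<in> S3" and y: "y \<in> S3"
  shows "lens_embedding p q x = lens_embedding p q y \<longleftrightarrow>
    (\<exists>k\<in>{0..<int p}. y = lens_action p (int q) k x)"
proof
  assume eq: "lens_embedding p q x = lens_embedding p q y"
  obtain z w where xz: "x = (z, w)" by fastforce
  obtain z' w' where yz: "y = (z', w')" by fastforce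
  have e: "z ^ p = z' ^ p" "w * cnj z ^ q = w' * cnj z' ^ q" "w ^ p = w' ^ p"
    using eq by (simp_all add: lens_embedding_def xz yz)
  show "\<exists>k\<in>{0..<int p}. y = lens_action p (int q) k x"
  proof (cases "z = 0")
    case False
    obtain k where k: "k \<in> {0..<int p}" "z' = cis (2 * pi * of_int k / of_nat p) * z"
      by (rule root_of_unity_quotient[OF p(1) e(1) False])
    let ?\<zeta> = "cis (2 * pi * of_int k / of_nat p)"
    have \<zeta>: "cis (2 * pi * of_int (int q * k) / of_nat p) = ?\<zeta> ^ q"
      by (simp add: Complex.DeMoivre algebra_simps)
    have "w * cnj z ^ q = (w' * cnj ?\<zeta> ^ q) * cnj z ^ q"
      using e(2) k(2) by (simp add: power_mult_distrib algebra_simps)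
    then have "w = w' * cnj ?\<zeta> ^ q" using False by simp
    then have "?\<zeta> ^ q * w = w' * (?\<zeta> ^ q * cnj ?\<zeta> ^ q)" by (simp add: algebra_simps)
    also have "?\<zeta> ^ q * cnj ?\<zeta> ^ q = 1"
      by (simp add: power_mult_distrib[symmetric] cis_cnj cis_mult)
    finally have "w' = cis (2 * pi * of_int (int q * k) / of_nat p) * w" using \<zeta> by simp
    then have "y = lens_action p (int q) k x"
      unfolding lens_action_apply[OF x] yz k(2) by (simp add: xz)
    then show ?thesis using k(1) by blast
  next
    case True
    then have "z' = 0" using e(1) p(1) by (simp add: power_0_left)
    have "w \<noteq> 0" using x True by (auto simp: xz)
    then obtain j where j: "j \<in> {0..<int p}" "w' = cis (2 * pi * of_int j / of_nat p) * w"
      using root_of_unity_quotient[OF p(1) e(3)] by metis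
    \<comment> \<open>\<open>q\<close> is invertible modulo \<open>p\<close>, so the rotation of the second coordinate is a power of the action\<close>
    obtain u r where ur: "u * int p + r * int q = 1"
      using bezout_int[of "int p" "int q"] p(2) by (auto simp: coprime_iff_gcd_eq_1)
    define k where "k = (r * j) mod int p"
    have "int q * k mod int p = (int q * r) * j mod int p"
      by (simp add: k_def mod_mult_right_eq mult.assoc)
    also have "int q * r = 1 - u * int p" using ur by (simp add: algebra_simps)
    also have "(1 - u * int p) * j = j + (- u * j) * int p" by (simp add: algebra_simps)
    also have "(j + (- u * j) * int p) mod int p = j mod int p" by (rule mod_mult_self1)
    finally have "cis (2 * pi * of_int (int q * k) / of_nat p) = cis (2 * pi * of_int j / of_nat p)"
      using cis_mod_eq[OF p(1), of 1 "int q * k"] cis_mod_eq[OF p(1), of 1 j] by simp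
    then have "y = lens_action p (int q) k x"
      unfolding lens_action_apply[OF x] yz j(2) using \<open>z' = 0\<close> True by (simp add: xz)
    moreover have "k \<in> {0..<int p}" using p(1) by (simp add: k_def)
    ultimately show ?thesis by blast
  qed
next
  assume "\<exists>k\<in>{0..<int p}. y = lens_action p (int q) k x"
  then obtain k where "y = lens_action p (int q) k x" by blast
  then show "lens_embedding p q x = lens_embedding p q y"
    using lens_embedding_action[OF p(1) x, of q k] by simp
qed

lemma dist_lens_action:
  assumes "x \<in> S3" "y \<in> S3"
  shows "dist (lens_action p q k x) (lens_action p q k y) = dist x y"
proof -
  have "dist (cis a * u) (cis a * v) = dist u v" for a u v
    by (simp add: dist_norm right_diff_distrib[symmetric] norm_mult)
  then show ?thesis
    using assms by (simp add: lens_action_apply dist_prod_def)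
qed

lemma covering_space_lens_embedding:
  assumes p: "p > 0" "coprime (int p) (int q)"
  shows "covering_space S3 (lens_embedding p q) (lens_embedding p q ` S3)"
proof (rule covering_space_free_finite_isometries[where G = "lens_action p (int q) ` {0..<int p}"])
  show "continuous_on S3 (lens_embedding p q)" by (rule continuous_on_lens_embedding)
  show "g x \<in> S3" if "g \<in> lens_action p (int q) ` {0..<int p}" "x \<in> S3" for g x
    using that lens_action_in_S3 by blast
  show "dist (g x) (g y) = dist x y"
    if "g \<in> lens_action p (int q) ` {0..<int p}" "x \<in> S3" "y \<in> S3" for g x y
    using that dist_lens_action by (elim imageE) simp
  show "lens_embedding p q x = lens_embedding p q y \<longleftrightarrow> (\<exists>g\<in>lens_action p (int q) ` {0..<int p}. y = g x)"
    if "x \<in> S3" "y \<in> S3" for x y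
    using lens_embedding_fibre[OF p that] by simp
  show "g y = y" if g: "g \<in> lens_action p (int q) ` {0..<int p}" and x: "x \<in> S3" and y: "y \<in> S3" and "g x = x" for g x y
  proof -
    obtain k where k: "k \<in> {0..<int p}" "g = lens_action p (int q) k" using g by blast
    have "k \<in> carrier (integer_mod_group p)" using k(1) p(1) by (simp add: carrier_integer_mod_group)
    from lens_action_free[OF p this x] have "k = 0" using that(4) k(2) by simp
    then show ?thesis using k(2) lens_action_zero[OF y] by simp
  qed
qed auto

lemma finite_fibre_lens_embedding:
  assumes p: "p > 0" "coprime (int p) (int q)"
  shows "finite (S3 \<inter> lens_embedding p q -` {b})"
proof (cases "S3 \<inter> lens_embedding p q -` {b} = {}")
  case False
  then obtain x where x: "x \<in> S3" "lens_embedding p q x = b" by blast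
  have "S3 \<inter> lens_embedding p q -` {b} \<subseteq> (\<lambda>k. lens_action p (int q) k x) ` {0..<int p}"
  proof
    fix y assume "y \<in> S3 \<inter> lens_embedding p q -` {b}"
    then have y: "y \<in> S3" "lens_embedding p q y = b" by auto
    then have "\<exists>k\<in>{0..<int p}. y = lens_action p (int q) k x"
      using lens_embedding_fibre[OF p x(1) y(1)] x(2) by simp
    then show "y \<in> (\<lambda>k. lens_action p (int q) k x) ` {0..<int p}" by blast
  qed
  then show ?thesis by (rule finite_subset) simp
qed simp

text \<open>
  The orbit map and the embedding are quotient maps of the sphere with the same fibres.
\<close>

lemma lens_space_homeomorphic_image:
  assumes p: "p > 0" "coprime (int p) (int q)"
  shows "lens_space p (int q) homeomorphic_space top_of_set (lens_embedding p q ` S3)"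
proof -
  let ?e = "lens_embedding p q" and ?o = "orbit (integer_mod_group p) (lens_action p (int q))"
  have orb: "?o x = (\<lambda>k. lens_action p (int q) k x) ` {0..<int p}" for x
    using p(1) by (auto simp: orbit_def carrier_integer_mod_group)
  have self: "x \<in> ?o x" if "x \<in> S3" for x
    unfolding orb using p(1) lens_action_zero[OF that, of p "int q"] by (intro image_eqI[of _ _ 0]) auto
  have const: "?e y = ?e x" if "x \<in> S3" "y \<in> ?o x" for x y
    using that(2) lens_embedding_action[OF p(1) that(1)] unfolding orb by auto
  have q: "quotient_map (top_of_set S3) (lens_space p (int q)) ?o"
    unfolding lens_space_def orbit_space_def by (rule quotient_map_quotient_topology)
  have eq: "?e x = ?e y" if "x \<in> S3" "y \<in> S3" "?o x = ?o y" for x y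
    using const[OF that(1), of y] self[OF that(2)] that(3) by simp
  have qe: "quotient_map (top_of_set S3) (top_of_set (?e ` S3)) ?e"
  proof (rule T1_Spaces.continuous_imp_quotient_map)
    show "continuous_map (top_of_set S3) (top_of_set (?e ` S3)) ?e"
      using continuous_on_lens_embedding by (simp add: image_subset_iff_funcset[symmetric])
  qed (simp_all add: compact_space_subtopology Hausdorff_space_subtopology)
  have eo: "?o x = ?o y" if "x \<in> S3" "y \<in> S3" "?e x = ?e y" for x y
  proof -
    have half: "?o y \<subseteq> ?o x" if xy: "x \<in> S3" "y \<in> S3" "?e x = ?e y" for x y
    proof
      fix u assume u: "u \<in> ?o y"
      then have "u \<in> S3" using lens_action_in_S3[OF xy(2)] unfolding orb by auto
      moreover have "?e x = ?e u" using const[OF xy(2) u] xy(3) by simp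
      ultimately show "u \<in> ?o x" using lens_embedding_fibre[OF p xy(1)] unfolding orb by auto
    qed
    show ?thesis using half[OF that] half[OF that(2,1) that(3)[symmetric]] by simp
  qed
  show ?thesis
  proof (rule homeomorphic_space_if_same_fibres[OF q qe])
    fix x y assume "x \<in> topspace (top_of_set S3)" "y \<in> topspace (top_of_set S3)"
    then have "x \<in> S3" "y \<in> S3" by simp_all
    then show "?o x = ?o y \<longleftrightarrow> ?e x = ?e y" using eq eo by metis
  qed
qed

text \<open>
  Otherwise the covering map from the 3-sphere would be null-homotopic and the 3-sphere contractible.
\<close>

lemma lens_image_not_deformable:
  assumes p: "p > 0" "coprime (int p) (int q)"
  shows "\<not> contractible_within_to (top_of_set (lens_embedding p q ` S3)) (lens_embedding p q ` S3) circle"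
proof
  assume "contractible_within_to (top_of_set (lens_embedding p q ` S3)) (lens_embedding p q ` S3) circle"
  then have "\<exists>a. homotopic_with_canon (\<lambda>_. True) S3 (lens_embedding p q ` S3) (lens_embedding p q) (\<lambda>_. a)"
    by (rule nullhomotopic_into_circle_deformable) (simp_all add: continuous_on_lens_embedding)
  then obtain a where a: "homotopic_with_canon (\<lambda>_. True) S3 (lens_embedding p q ` S3) (lens_embedding p q) (\<lambda>_. a)" ..
  have "connected S3" by (rule connected_sphere) simp
  from contractible_if_covering_nullhomotopic[OF covering_space_lens_embedding[OF p] this
      finite_fibre_lens_embedding[OF p] a]
  have "contractible S3" .
  then show False by (simp add: contractible_sphere)
qed

text \<open>
  The effect of \<open>(z, w) \<mapsto> (a z, b w)\<close> on the invariants, for real \<open>a\<close> and \<open>b\<close>.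
\<close>

definition lens_scale :: "nat \<Rightarrow> nat \<Rightarrow> real \<Rightarrow> real \<Rightarrow> complex \<times> complex \<times> complex \<Rightarrow> complex \<times> complex \<times> complex" where
  "lens_scale p q a b y =
     (of_real (a ^ p) * fst y, of_real (b * a ^ q) * fst (snd y), of_real (b ^ p) * snd (snd y))"

lemma lens_scale_embedding:
  "lens_scale p q a b (lens_embedding p q x) = lens_embedding p q (of_real a * fst x, of_real b * snd x)"
  by (simp add: lens_scale_def lens_embedding_def power_mult_distrib)

lemma S3_iff: "x \<in> S3 \<longleftrightarrow> (norm (fst x))\<^sup>2 + (norm (snd x))\<^sup>2 = 1"
  by (cases x) (simp add: norm_Pair)

lemma circle_root:
  assumes "p > 0" "norm (c::complex) = 1"
  obtains z where "norm z = 1" "z ^ p = c"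
proof (rule that)
  have "c \<noteq> 0" using assms(2) by auto
  then have "cis (Arg c) = c" using assms(2) by (simp add: cis_Arg sgn_div_norm)
  then show "cis (Arg c / p) ^ p = c" using assms(1) by (simp add: Complex.DeMoivre)
qed simp

text \<open>
  Scaling both coordinates by real factors commutes with the action; as long as it preserves the unit
  sphere it induces a deformation of the lens space.
\<close>

lemma lens_scale_homotopy:
  fixes p q :: nat and A0 :: "(complex \<times> complex) set" and \<alpha> \<beta> :: "real \<Rightarrow> complex \<times> complex \<times> complex \<Rightarrow> real"
  defines "A \<equiv> lens_embedding p q ` A0"
  assumes cont: "continuous_on ({0..1} \<times> A) (\<lambda>z. \<alpha> (fst z) (snd z))" "continuous_on ({0..1} \<times> A) (\<lambda>z. \<beta> (fst z) (snd z))"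
    and start: "\<And>y. y \<in> A \<Longrightarrow> \<alpha> 0 y = 1" "\<And>y. y \<in> A \<Longrightarrow> \<beta> 0 y = 1"
    and norm: "\<And>t x. t \<in> {0..1} \<Longrightarrow> x \<in> A0 \<Longrightarrow>
      (\<alpha> t (lens_embedding p q x) * norm (fst x))\<^sup>2 + (\<beta> t (lens_embedding p q x) * norm (snd x))\<^sup>2 = 1"
  shows "homotopic_with_canon (\<lambda>_. True) A (lens_embedding p q ` S3) id
    (\<lambda>y. lens_scale p q (\<alpha> 1 y) (\<beta> 1 y) y)"
proof -
  let ?h = "\<lambda>z. lens_scale p q (\<alpha> (fst z) (snd z)) (\<beta> (fst z) (snd z)) (snd z)"
  have "?h (t, lens_embedding p q x) \<in> lens_embedding p q ` S3" if "t \<in> {0..1}" "x \<in> A0" for t x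
    unfolding fst_conv snd_conv lens_scale_embedding
  proof (rule imageI)
    show "(of_real (\<alpha> t (lens_embedding p q x)) * fst x, of_real (\<beta> t (lens_embedding p q x)) * snd x) \<in> S3"
      unfolding S3_iff using norm[OF that] by (simp add: norm_mult power_mult_distrib)
  qed
  then have im: "?h ` ({0..1} \<times> A) \<subseteq> lens_embedding p q ` S3"
    unfolding A_def by (intro image_subsetI) (elim SigmaE imageE, simp only:)
  have "continuous_on ({0..1} \<times> A) ?h"
    unfolding lens_scale_def by (intro continuous_intros cont)
  then show ?thesis
    using im by (rule homotopic_with_canonI) (simp_all add: start lens_scale_def)
qed

lemma lens_core_homeomorphic:
  "(\<lambda>c. (c, 0::complex, 0::complex)) ` sphere (0::complex) 1 homeomorphic sphere (0::complex) 1"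
  "(\<lambda>c. (0::complex, 0::complex, c)) ` sphere (0::complex) 1 homeomorphic sphere (0::complex) 1"
proof -
  have "homeomorphism ((\<lambda>c. (c, 0::complex, 0::complex)) ` sphere (0::complex) 1) (sphere 0 1) fst (\<lambda>c. (c, 0, 0))"
    by (intro homeomorphismI continuous_intros) auto
  then show "(\<lambda>c. (c, 0::complex, 0::complex)) ` sphere (0::complex) 1 homeomorphic sphere (0::complex) 1"
    unfolding homeomorphic_def by (intro exI)
  have "homeomorphism ((\<lambda>c. (0::complex, 0::complex, c)) ` sphere (0::complex) 1) (sphere 0 1)
      (\<lambda>y. snd (snd y)) (\<lambda>c. (0, 0, c))"
    by (intro homeomorphismI continuous_intros) auto
  then show "(\<lambda>c. (0::complex, 0::complex, c)) ` sphere (0::complex) 1 homeomorphic sphere (0::complex) 1"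
    unfolding homeomorphic_def by (intro exI)
qed

text \<open>
  On a unit vector whose coordinates have absolute values \<open>\<sigma>\<close> and \<open>\<rho>\<close>, shrinking the second coordinate by
  the factor \<open>1 - t\<close> must be compensated by stretching the first one by this factor.
\<close>

definition slide :: "real \<Rightarrow> real \<Rightarrow> real" where
  "slide t \<rho> = sqrt (1 - ((1 - t) * \<rho>)\<^sup>2) / sqrt (1 - \<rho>\<^sup>2)"

lemma slide_norm:
  assumes "\<sigma>\<^sup>2 + \<rho>\<^sup>2 = 1" "\<rho>\<^sup>2 \<le> 1 / 2" "t \<in> {0..1}"
  shows "(slide t \<rho> * \<sigma>)\<^sup>2 + ((1 - t) * \<rho>)\<^sup>2 = 1" "slide t \<rho> \<ge> 0" "slide 0 \<rho> = 1"
proof -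
  have \<sigma>: "1 - \<rho>\<^sup>2 = \<sigma>\<^sup>2" "\<sigma>\<^sup>2 > 0" using assms(1,2) by linarith+
  have "(1 - t)\<^sup>2 \<le> 1" using assms(3) by (simp add: power_le_one)
  then have "((1 - t) * \<rho>)\<^sup>2 \<le> 1 * (1 / 2)"
    unfolding power_mult_distrib using assms(2) by (intro mult_mono) auto
  then have "(slide t \<rho>)\<^sup>2 = (1 - ((1 - t) * \<rho>)\<^sup>2) / \<sigma>\<^sup>2"
    unfolding slide_def using \<sigma> by (simp add: power_divide)
  then show "(slide t \<rho> * \<sigma>)\<^sup>2 + ((1 - t) * \<rho>)\<^sup>2 = 1"
    using \<sigma>(2) by (simp add: power_mult_distrib[of _ \<sigma>])
  show "slide t \<rho> \<ge> 0"
    unfolding slide_def using \<open>((1 - t) * \<rho>)\<^sup>2 \<le> 1 * (1 / 2)\<close> \<sigma> by simp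
  show "slide 0 \<rho> = 1" unfolding slide_def using \<sigma> by simp
qed

lemma continuous_on_slide:
  assumes "continuous_on S \<rho>" "\<And>y. y \<in> S \<Longrightarrow> (\<rho> y)\<^sup>2 \<le> 1 / 2"
  shows "continuous_on ({0..1} \<times> S) (\<lambda>z. slide (fst z) (\<rho> (snd z)))"
proof -
  have "continuous_on ({0..1::real} \<times> S) (\<lambda>z. \<rho> (snd z))"
    by (intro continuous_on_compose2[OF assms(1)] continuous_intros) auto
  moreover have "sqrt (1 - (\<rho> (snd z))\<^sup>2) \<noteq> 0" if "z \<in> {0..1::real} \<times> S" for z
    using assms(2)[of "snd z"] that by auto
  ultimately show ?thesis
    unfolding slide_def by (intro continuous_intros) auto
qed

lemma unit_scale_image:
  assumes p: "p > 0" and "a \<ge> 0" "(a * norm (z::complex))\<^sup>2 = 1"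
  shows "norm (of_real (a ^ p) * z ^ p) = 1"
proof -
  have "a * norm z = 1" using assms(2,3) by (metis mult_nonneg_nonneg norm_ge_zero power2_eq_1_iff
      zero_le_one neg_0_le_iff_le not_one_le_zero)
  then show ?thesis using assms(2) by (simp add: norm_mult norm_power power_mult_distrib[symmetric])
qed

text \<open>
  The solid torus \<open>|w| \<le> |z|\<close> is deformed to its core \<open>w = 0\<close>, on which \<open>z^p\<close> is a coordinate with
  values in the circle.  The invariants return \<open>|w|\<close> as the \<open>p\<close>-th root of \<open>|w^p|\<close>, so the homotopy is
  continuous on the image.
\<close>

lemma lens_first_half:
  assumes p: "p > 0"
  defines "A0 \<equiv> {x \<in> S3. (norm (snd x))\<^sup>2 \<le> 1 / 2}"
  shows "contractible_within_to (top_of_set (lens_embedding p q ` S3)) (lens_embedding p q ` A0) circle"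
proof -
  let ?e = "lens_embedding p q" and ?\<rho> = "\<lambda>y :: complex \<times> complex \<times> complex. root p (norm (snd (snd y)))"
  have \<rho>: "?\<rho> (?e x) = norm (snd x)" for x
    using p by (simp add: lens_embedding_def norm_power real_root_power_cancel)
  have A0: "(norm (fst x))\<^sup>2 + (norm (snd x))\<^sup>2 = 1" "(norm (snd x))\<^sup>2 \<le> 1 / 2" if "x \<in> A0" for x
    using that unfolding A0_def S3_iff by auto
  let ?f = "\<lambda>y. lens_scale p q (slide 1 (?\<rho> y)) (1 - 1) y"
  have hom: "homotopic_with_canon (\<lambda>_. True) (?e ` A0) (?e ` S3) id ?f"
  proof (rule lens_scale_homotopy[where \<alpha> = "\<lambda>t y. slide t (?\<rho> y)" and \<beta> = "\<lambda>t y. 1 - t"])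
    show "continuous_on ({0..1} \<times> ?e ` A0) (\<lambda>z. slide (fst z) (?\<rho> (snd z)))"
    proof (rule continuous_on_slide)
      show "continuous_on (?e ` A0) ?\<rho>" by (intro continuous_intros)
      show "(?\<rho> y)\<^sup>2 \<le> 1 / 2" if "y \<in> ?e ` A0" for y
        using that A0(2) \<rho> by (elim imageE) simp
    qed
    show "continuous_on ({0..1::real} \<times> ?e ` A0) (\<lambda>z. 1 - fst z)" by (intro continuous_intros)
    show "slide 0 (?\<rho> y) = 1" if "y \<in> ?e ` A0" for y
      using that
    proof (rule imageE)
      fix x assume x: "y = ?e x" "x \<in> A0"
      show ?thesis unfolding x(1) \<rho> by (rule slide_norm(3)[OF A0[OF x(2)], of 0]) simp
    qed
    show "(slide t (?\<rho> (?e x)) * norm (fst x))\<^sup>2 + ((1 - t) * norm (snd x))\<^sup>2 = 1"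
      if "t \<in> {0..1}" "x \<in> A0" for t x
      unfolding \<rho> by (rule slide_norm(1)[OF A0[OF that(2)] that(1)])
  qed simp
  have core: "?f (?e x) = (of_real (slide 1 (norm (snd x)) ^ p) * fst x ^ p, 0, 0)" for x
    unfolding \<rho> using p by (simp add: lens_scale_def lens_embedding_def power_0_left)
  have "?f ` ?e ` A0 = (\<lambda>c. (c, 0, 0)) ` sphere 0 1"
  proof (intro equalityI image_subsetI)
    fix y assume "y \<in> ?e ` A0"
    then obtain x where x: "x \<in> A0" "y = ?e x" by (elim imageE)
    have "norm (of_real (slide 1 (norm (snd x)) ^ p) * fst x ^ p) = 1"
    proof (rule unit_scale_image[OF p])
      show "slide 1 (norm (snd x)) \<ge> 0" by (rule slide_norm(2)[OF A0[OF x(1)]]) simp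
      show "(slide 1 (norm (snd x)) * norm (fst x))\<^sup>2 = 1"
        using slide_norm(1)[OF A0[OF x(1)], of 1] by simp
    qed
    then have "of_real (slide 1 (norm (snd x)) ^ p) * fst x ^ p \<in> sphere 0 1" by (simp only: mem_sphere_0)
    then show "?f y \<in> (\<lambda>c. (c, 0, 0)) ` sphere 0 1"
      unfolding x(2) core by (rule imageI)
  next
    fix c :: complex assume "c \<in> sphere 0 1"
    then have "norm c = 1" by simp
    then obtain z where z: "norm z = 1" "z ^ p = c" using circle_root[OF p] by metis
    have "(z, 0) \<in> A0" using z(1) by (simp add: A0_def S3_iff)
    then have "?f (?e (z, 0)) \<in> ?f ` ?e ` A0" by (intro imageI)
    moreover have "?f (?e (z, 0)) = (c, 0, 0)" unfolding core using z(2) by (simp add: slide_def)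
    ultimately show "(c, 0, 0) \<in> ?f ` ?e ` A0" by (simp only:)
  qed
  then have "?f ` ?e ` A0 homeomorphic sphere (0::complex) 1" 
    by (simp only: lens_core_homeomorphic(1))
  moreover have sub: "?e ` A0 \<subseteq> ?e ` S3" unfolding A0_def by (rule image_mono) auto
  ultimately show ?thesis
    unfolding contractible_within_to_set_iff[OF sub] using hom by (intro exI[of _ ?f] conjI)
qed

text \<open>
  The same with the coordinates exchanged.  The exponent \<open>q\<close> has to be positive for the second invariant
  to vanish on the core \<open>z = 0\<close>.
\<close>

lemma lens_second_half:
  assumes p: "p > 0" and q: "q > 0"
  defines "A0 \<equiv> {x \<in> S3. (norm (fst x))\<^sup>2 \<le> 1 / 2}"
  shows "contractible_within_to (top_of_set (lens_embedding p q ` S3)) (lens_embedding p q ` A0) circle"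
proof -
  let ?e = "lens_embedding p q" and ?\<rho> = "\<lambda>y :: complex \<times> complex \<times> complex. root p (norm (fst y))"
  have \<rho>: "?\<rho> (?e x) = norm (fst x)" for x
    using p by (simp add: lens_embedding_def norm_power real_root_power_cancel)
  have A0: "(norm (snd x))\<^sup>2 + (norm (fst x))\<^sup>2 = 1" "(norm (fst x))\<^sup>2 \<le> 1 / 2" if "x \<in> A0" for x
    using that unfolding A0_def S3_iff by auto
  let ?f = "\<lambda>y. lens_scale p q (1 - 1) (slide 1 (?\<rho> y)) y"
  have hom: "homotopic_with_canon (\<lambda>_. True) (?e ` A0) (?e ` S3) id ?f"
  proof (rule lens_scale_homotopy[where \<beta> = "\<lambda>t y. slide t (?\<rho> y)" and \<alpha> = "\<lambda>t y. 1 - t"])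
    show "continuous_on ({0..1} \<times> ?e ` A0) (\<lambda>z. slide (fst z) (?\<rho> (snd z)))"
    proof (rule continuous_on_slide)
      show "continuous_on (?e ` A0) ?\<rho>" by (intro continuous_intros)
      show "(?\<rho> y)\<^sup>2 \<le> 1 / 2" if "y \<in> ?e ` A0" for y
        using that A0(2) \<rho> by (elim imageE) simp
    qed
    show "continuous_on ({0..1::real} \<times> ?e ` A0) (\<lambda>z. 1 - fst z)" by (intro continuous_intros)
    show "slide 0 (?\<rho> y) = 1" if "y \<in> ?e ` A0" for y
      using that
    proof (rule imageE)
      fix x assume x: "y = ?e x" "x \<in> A0"
      show ?thesis unfolding x(1) \<rho> by (rule slide_norm(3)[OF A0[OF x(2)], of 0]) simp
    qed
    show "((1 - t) * norm (fst x))\<^sup>2 + (slide t (?\<rho> (?e x)) * norm (snd x))\<^sup>2 = 1"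
      if "t \<in> {0..1}" "x \<in> A0" for t x
      unfolding \<rho> using slide_norm(1)[OF A0[OF that(2)] that(1)] by (simp only: add.commute)
  qed simp
  have core: "?f (?e x) = (0, 0, of_real (slide 1 (norm (fst x)) ^ p) * snd x ^ p)" for x
    unfolding \<rho> using p q by (simp add: lens_scale_def lens_embedding_def power_0_left)
  have "?f ` ?e ` A0 = (\<lambda>c. (0, 0, c)) ` sphere 0 1"
  proof (intro equalityI image_subsetI)
    fix y assume "y \<in> ?e ` A0"
    then obtain x where x: "x \<in> A0" "y = ?e x" by (elim imageE)
    have "norm (of_real (slide 1 (norm (fst x)) ^ p) * snd x ^ p) = 1"
    proof (rule unit_scale_image[OF p])
      show "slide 1 (norm (fst x)) \<ge> 0" by (rule slide_norm(2)[OF A0[OF x(1)]]) simp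
      show "(slide 1 (norm (fst x)) * norm (snd x))\<^sup>2 = 1"
        using slide_norm(1)[OF A0[OF x(1)], of 1] by simp
    qed
    then have "of_real (slide 1 (norm (fst x)) ^ p) * snd x ^ p \<in> sphere 0 1" by (simp only: mem_sphere_0)
    then show "?f y \<in> (\<lambda>c. (0, 0, c)) ` sphere 0 1"
      unfolding x(2) core by (rule imageI)
  next
    fix c :: complex assume "c \<in> sphere 0 1"
    then have "norm c = 1" by simp
    then obtain z where z: "norm z = 1" "z ^ p = c" using circle_root[OF p] by metis
    have "(0, z) \<in> A0" using z(1) by (simp add: A0_def S3_iff)
    then have "?f (?e (0, z)) \<in> ?f ` ?e ` A0" by (intro imageI)
    moreover have "?f (?e (0, z)) = (0, 0, c)" unfolding core using z(2) by (simp add: slide_def)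
    ultimately show "(0, 0, c) \<in> ?f ` ?e ` A0" by (simp only:)
  qed
  then have "?f ` ?e ` A0 homeomorphic sphere (0::complex) 1" 
    by (simp only: lens_core_homeomorphic(2))
  moreover have sub: "?e ` A0 \<subseteq> ?e ` S3" unfolding A0_def by (rule image_mono) auto
  ultimately show ?thesis
    unfolding contractible_within_to_set_iff[OF sub] using hom by (intro exI[of _ ?f] conjI)
qed

lemma lens_image_cover:
  assumes p: "p > 0" and q: "q > 0"
  shows "has_P_cover circle (top_of_set (lens_embedding p q ` S3)) 2"
proof (rule has_P_cover_2I[OF _ _ _ lens_first_half[OF p] lens_second_half[OF p q]])
  have cl: "closedin (top_of_set (lens_embedding p q ` S3)) (lens_embedding p q ` {x \<in> S3. g x \<le> 1 / 2})"
    if g: "continuous_on UNIV g" for g :: "complex \<times> complex \<Rightarrow> real"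
  proof (rule closed_subset)
    have "closed {x. g x \<le> 1 / 2}" by (rule closed_Collect_le[OF g continuous_on_const])
    then have "compact (S3 \<inter> {x. g x \<le> 1 / 2})" by (rule compact_Int_closed[OF compact_sphere])
    moreover have "S3 \<inter> {x. g x \<le> 1 / 2} = {x \<in> S3. g x \<le> 1 / 2}" by blast
    ultimately have "compact {x \<in> S3. g x \<le> 1 / 2}" by (simp only:)
    then show "closed (lens_embedding p q ` {x \<in> S3. g x \<le> 1 / 2})"
      by (intro compact_imp_closed compact_continuous_image continuous_on_lens_embedding)
    show "lens_embedding p q ` {x \<in> S3. g x \<le> 1 / 2} \<subseteq> lens_embedding p q ` S3"
      by (rule image_mono) blast
  qed
  show "closedin (top_of_set (lens_embedding p q ` S3)) (lens_embedding p q ` {x \<in> S3. (norm (snd x))\<^sup>2 \<le> 1 / 2})"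
    "closedin (top_of_set (lens_embedding p q ` S3)) (lens_embedding p q ` {x \<in> S3. (norm (fst x))\<^sup>2 \<le> 1 / 2})"
    by (intro cl continuous_intros)+
  have "S3 \<subseteq> {x \<in> S3. (norm (snd x))\<^sup>2 \<le> 1 / 2} \<union> {x \<in> S3. (norm (fst x))\<^sup>2 \<le> 1 / 2}"
  proof
    fix x :: "complex \<times> complex" assume x: "x \<in> S3"
    then have "(norm (snd x))\<^sup>2 \<le> 1 / 2 \<or> (norm (fst x))\<^sup>2 \<le> 1 / 2" unfolding S3_iff by linarith
    then show "x \<in> {x \<in> S3. (norm (snd x))\<^sup>2 \<le> 1 / 2} \<union> {x \<in> S3. (norm (fst x))\<^sup>2 \<le> 1 / 2}"
      using x by blast
  qed
  then show "topspace (top_of_set (lens_embedding p q ` S3)) \<subseteq>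
      lens_embedding p q ` {x \<in> S3. (norm (snd x))\<^sup>2 \<le> 1 / 2} \<union>
      lens_embedding p q ` {x \<in> S3. (norm (fst x))\<^sup>2 \<le> 1 / 2}"
    unfolding image_Un[symmetric] topspace_euclidean_subtopology by (rule image_mono)
qed

text \<open>
  The action depends on \<open>q\<close> only modulo \<open>p\<close>, so \<open>q\<close> may be replaced by a positive integer \<open>q'\<close> that can
  serve as an exponent.
\<close>

theorem round_category_lens_space:
  assumes p: "p > 0" "coprime (int p) q"
  shows "round_category (lens_space p q) = 2"
proof -
  \<comment> \<open>the summand \<open>p\<close> makes \<open>q'\<close> positive also when \<open>p\<close> divides \<open>q\<close>\<close>
  define q' where "q' = nat (q mod int p) + p"
  have q': "int q' mod int p = q mod int p" "q' > 0"
    using p(1) by (simp_all add: q'_def)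
  have "int p \<noteq> 0" using p(1) by simp
  from coprime_mod_right_iff[OF this, of "int q'"] coprime_mod_right_iff[OF this, of q]
  have cop: "coprime (int p) (int q')"
    using p(2) unfolding q'(1) by blast
  have "lens_space p q = lens_space p (int q')"
    unfolding lens_space_def using lens_action_cong[OF p(1) q'(1)] by simp
  then have hom: "lens_space p q homeomorphic_space top_of_set (lens_embedding p q' ` S3)"
    using lens_space_homeomorphic_image[OF p(1) cop] by simp
  have "P_category circle (top_of_set (lens_embedding p q' ` S3)) = 2"
  proof (rule P_category_eq_2I[OF lens_image_cover[OF p(1) q'(2)]])
    have "(1, 0) \<in> S3" by (simp add: S3_iff)
    then show "topspace (top_of_set (lens_embedding p q' ` S3)) \<noteq> {}" by auto
    show "\<not> contractible_within_to (top_of_set (lens_embedding p q' ` S3))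
        (topspace (top_of_set (lens_embedding p q' ` S3))) circle"
      using lens_image_not_deformable[OF p(1) cop] by simp
  qed
  then show ?thesis
    unfolding round_category_def P_category_homeomorphic[OF hom] .
qed

lemma S3_homeomorphic_lens_space: "top_of_set S3 homeomorphic_space lens_space 1 1"
proof -
  have "quotient_map (top_of_set S3) (lens_space 1 1) (orbit (integer_mod_group 1) (lens_action 1 1))"
    unfolding lens_space_def orbit_space_def by (rule quotient_map_quotient_topology)
  moreover have "quotient_map (top_of_set S3) (top_of_set S3) (\<lambda>x. x)"
    by (rule T1_Spaces.continuous_imp_quotient_map)
       (simp_all add: compact_space_subtopology Hausdorff_space_subtopology)
  ultimately have "lens_space 1 1 homeomorphic_space top_of_set S3"
  proof (rule homeomorphic_space_if_same_fibres)
    fix x y assume "x \<in> topspace (top_of_set S3)" "y \<in> topspace (top_of_set S3)"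
    then have xy: "x \<in> S3" "y \<in> S3" by simp_all
    have "carrier (integer_mod_group 1) = {0}" by (auto simp: carrier_integer_mod_group)
    then have "orbit (integer_mod_group 1) (lens_action 1 1) u = {u}" if "u \<in> S3" for u
      using lens_action_zero[OF that] by (simp add: orbit_def)
    then show "orbit (integer_mod_group 1) (lens_action 1 1) x = orbit (integer_mod_group 1) (lens_action 1 1) y \<longleftrightarrow> x = y"
      using xy by simp
  qed
  then show ?thesis by (rule homeomorphic_space_sym[THEN iffD1])
qed

text \<open>
  For \<open>p = 2\<close>, \<open>q = 1\<close> the generator acts as the antipodal map.
\<close>

lemma real_projective_3_space_homeomorphic_lens_space:
  "real_projective_3_space homeomorphic_space lens_space 2 1"
proof (rule homeomorphic_space_if_same_fibres)
  show "quotient_map (top_of_set S3) real_projective_3_space (\<lambda>x. {x, - x})"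
    unfolding real_projective_3_space_def by (rule quotient_map_quotient_topology)
  show "quotient_map (top_of_set S3) (lens_space 2 1) (orbit (integer_mod_group 2) (lens_action 2 1))"
    unfolding lens_space_def orbit_space_def by (rule quotient_map_quotient_topology)
  fix x y assume "x \<in> topspace (top_of_set S3)" "y \<in> topspace (top_of_set S3)"
  then have xy: "x \<in> S3" "y \<in> S3" by simp_all
  have carrier: "carrier (integer_mod_group 2) = {0, 1}" by (auto simp: carrier_integer_mod_group)
  have neg: "lens_action 2 1 1 u = - u" if "u \<in> S3" for u
    using that by (simp add: lens_action_apply prod_eq_iff)
  have "orbit (integer_mod_group 2) (lens_action 2 1) u = {u, - u}" if u: "u \<in> S3" for u
    unfolding orbit_def carrier Setcompr_eq_image image_insert image_empty neg[OF u] lens_action_zero[OF u] ..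
  then show "{x, - x} = {y, - y} \<longleftrightarrow>
      orbit (integer_mod_group 2) (lens_action 2 1) x = orbit (integer_mod_group 2) (lens_action 2 1) y"
    using xy by simp
qed

section \<open>The product of the circle and the 2-sphere\<close>

text \<open>
  The segment from \<open>x\<close> to the pole \<open>n\<close> avoids the origin because its inner product with \<open>n\<close> stays positive,
  except possibly at \<open>x\<close> itself; so it can be projected to the sphere.
\<close>

lemma hemisphere_contractible:
  fixes n :: "'a::euclidean_space"
  assumes n: "norm n = 1"
  shows "homotopic_with_canon (\<lambda>_. True) {x \<in> sphere 0 1. x \<bullet> n \<ge> 0} (sphere 0 1) id (\<lambda>_. n)"
proof -
  let ?H = "{x \<in> sphere 0 1. x \<bullet> n \<ge> 0}" and ?u = "\<lambda>z :: real \<times> 'a. (1 - fst z) *\<^sub>R snd z + fst z *\<^sub>R n"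
  have nz: "?u (t, x) \<noteq> 0" if "t \<in> {0..1}" "x \<in> ?H" for t x
  proof
    assume "?u (t, x) = 0"
    then have "?u (t, x) \<bullet> n = 0" by (simp only: inner_zero_left)
    then have "(1 - t) * (x \<bullet> n) + t = 0"
      using n by (simp add: inner_add_left dot_square_norm)
    moreover have "(1 - t) * (x \<bullet> n) \<ge> 0" using that by simp
    ultimately have "t = 0" using that(1) by (auto simp: add_nonneg_eq_0_iff)
    then show False using \<open>?u (t, x) = 0\<close> that(2) by auto
  qed
  have "continuous_on ({0..1} \<times> ?H) (\<lambda>z. ?u z /\<^sub>R norm (?u z))"
  proof (intro continuous_intros ballI)
    fix z assume "z \<in> {0..1::real} \<times> ?H"
    then obtain t x where tx: "z = (t, x)" "t \<in> {0..1}" "x \<in> ?H" by (elim SigmaE)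
    show "norm (?u z) \<noteq> 0" unfolding tx(1) norm_eq_zero by (rule nz[OF tx(2,3)])
  qed
  moreover have "(\<lambda>z. ?u z /\<^sub>R norm (?u z)) ` ({0..1} \<times> ?H) \<subseteq> sphere 0 1"
  proof (rule image_subsetI)
    fix z assume "z \<in> {0..1::real} \<times> ?H"
    then obtain t x where tx: "z = (t, x)" "t \<in> {0..1}" "x \<in> ?H" by (elim SigmaE)
    show "?u z /\<^sub>R norm (?u z) \<in> sphere 0 1"
      unfolding tx(1) using nz[OF tx(2,3)] by (simp only: mem_sphere_0 norm_scaleR) simp
  qed
  ultimately show ?thesis
    by (rule homotopic_with_canonI) (simp_all add: n)
qed

text \<open>
  Otherwise the inclusion of the 2-sphere would be null-homotopic, and so would be the identity of the
  2-sphere, which is the inclusion followed by the projection.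
\<close>

lemma sphere_in_circle_sphere_not_deformable:
  "\<not> contractible_within_to (top_of_set (sphere (0::complex) 1 \<times> sphere (0 :: real^3) 1))
     (sphere 0 1 \<times> sphere 0 1) circle"
proof
  let ?S = "sphere (0::complex) 1 \<times> sphere (0 :: real^3) 1"
  assume con: "contractible_within_to (top_of_set ?S) ?S circle"
  have "continuous_on (sphere (0::real^3) 1) (\<lambda>x. (1::complex, x))" by (intro continuous_intros)
  moreover have "(\<lambda>x. (1::complex, x)) ` sphere (0::real^3) 1 \<subseteq> ?S" by auto
  ultimately obtain a where
    a: "homotopic_with_canon (\<lambda>_. True) (sphere 0 1) ?S (\<lambda>x. (1::complex, x)) (\<lambda>_. a)"
    using nullhomotopic_into_circle_deformable[OF con, of "\<lambda>x. (1::complex, x)"] by auto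
  have "homotopic_with_canon (\<lambda>_. True) (sphere 0 1) (sphere (0::real^3) 1) (snd \<circ> (\<lambda>x. (1::complex, x))) (snd \<circ> (\<lambda>_. a))"
    by (rule homotopic_with_compose_continuous_left[OF a]) (auto intro!: continuous_intros)
  then have "homotopic_with_canon (\<lambda>_. True) (sphere 0 1) (sphere (0::real^3) 1) id (\<lambda>_. snd a)"
    by (simp add: o_def id_def)
  then have "contractible (sphere (0::real^3) 1)"
    unfolding contractible_def by (intro exI[of _ "snd a"])
  then show False by (simp add: contractible_sphere)
qed

text \<open>
  The circle factor is left alone while the other factor contracts to a point.
\<close>

lemma circle_times_set_deformable:
  fixes S :: "'a::euclidean_space set"
  assumes A: "A \<subseteq> S" "A \<noteq> {}" and hom: "homotopic_with_canon (\<lambda>_. True) A S id (\<lambda>_. n)"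
  shows "contractible_within_to (top_of_set (sphere (0::complex) 1 \<times> S)) (sphere 0 1 \<times> A) circle"
proof -
  obtain h where h: "continuous_on ({0..1::real} \<times> A) h" "h ` ({0..1} \<times> A) \<subseteq> S"
    and h01: "\<And>x. h (0, x) = x" "\<And>x. h (1, x) = n"
    using hom unfolding homotopic_with_def by (auto simp: image_subset_iff_funcset)
  let ?k = "\<lambda>z :: real \<times> complex \<times> 'a. (fst (snd z), h (fst z, snd (snd z)))"
  have "continuous_on ({0..1} \<times> sphere 0 1 \<times> A) ?k"
    by (intro continuous_intros continuous_on_compose2[OF h(1)]) auto
  moreover have "?k ` ({0..1} \<times> sphere 0 1 \<times> A) \<subseteq> sphere 0 1 \<times> S"
    using h(2) by (auto simp: image_subset_iff)
  ultimately have "homotopic_with_canon (\<lambda>_. True) (sphere (0::complex) 1 \<times> A) (sphere 0 1 \<times> S) id (\<lambda>y. (fst y, n))"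
    by (rule homotopic_with_canonI) (simp_all add: h01)
  moreover have "(\<lambda>y. (fst y, n)) ` (sphere (0::complex) 1 \<times> A) homeomorphic sphere (0::complex) 1"
  proof -
    have "(\<lambda>y. (fst y, n)) ` (sphere (0::complex) 1 \<times> A) = (\<lambda>c. (c, n)) ` fst ` (sphere 0 1 \<times> A)"
      unfolding image_image ..
    also have "fst ` (sphere (0::complex) 1 \<times> A) = sphere 0 1" using A(2) by simp
    finally have im: "(\<lambda>y. (fst y, n)) ` (sphere (0::complex) 1 \<times> A) = (\<lambda>c. (c, n)) ` sphere 0 1" .
    have "homeomorphism ((\<lambda>c. (c, n)) ` sphere (0::complex) 1) (sphere 0 1) fst (\<lambda>c. (c, n))"
      by (intro homeomorphismI continuous_intros) auto
    then show ?thesis unfolding im homeomorphic_def by (intro exI)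
  qed
  moreover have sub: "sphere (0::complex) 1 \<times> A \<subseteq> sphere 0 1 \<times> S" using A(1) by auto
  ultimately show ?thesis
    unfolding contractible_within_to_set_iff[OF sub] by (intro exI[of _ "\<lambda>y. (fst y, n)"] conjI)
qed

theorem round_category_circle_times_sphere:
  "round_category (prod_topology circle (top_of_set (sphere (0 :: real^3) 1))) = 2"
proof -
  let ?S = "sphere (0::complex) 1 \<times> sphere (0 :: real^3) 1"
  let ?H = "\<lambda>n :: real^3. {x \<in> sphere 0 1. x \<bullet> n \<ge> 0}"
  let ?n = "axis 1 1 :: real^3"
  have n: "norm ?n = 1" "norm (- ?n) = 1" by simp_all
  have half: "contractible_within_to (top_of_set ?S) (sphere 0 1 \<times> ?H n) circle"
    if n: "norm n = 1" for n
  proof (rule circle_times_set_deformable[OF _ _ hemisphere_contractible[OF n]])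
    have "n \<in> ?H n" using n by simp
    then show "?H n \<noteq> {}" by blast
  qed blast
  have cl: "closedin (top_of_set ?S) (sphere 0 1 \<times> ?H n)" for n
  proof (rule closed_subset)
    have "closed {x. 0 \<le> x \<bullet> n}" by (intro closed_Collect_le continuous_intros)
    then have "closed (sphere 0 1 \<inter> {x. 0 \<le> x \<bullet> n})" by (intro closed_Int closed_sphere)
    moreover have "sphere 0 1 \<inter> {x. 0 \<le> x \<bullet> n} = ?H n" by blast
    ultimately have "closed (?H n)" by (simp only:)
    then show "closed (sphere (0::complex) 1 \<times> ?H n)" by (intro closed_Times closed_sphere)
  qed blast
  have "has_P_cover circle (top_of_set ?S) 2"
  proof (rule has_P_cover_2I[OF cl cl _ half[OF n(1)] half[OF n(2)]])
    have "x \<in> ?H ?n \<union> ?H (- ?n)" if "x \<in> sphere 0 1" for x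
      using that linear[of 0 "x \<bullet> ?n"] by (simp only: inner_minus_right) auto
    then show "topspace (top_of_set ?S) \<subseteq> sphere 0 1 \<times> ?H ?n \<union> sphere 0 1 \<times> ?H (- ?n)"
      unfolding Sigma_Un_distrib2[symmetric] topspace_euclidean_subtopology by (intro Sigma_mono subsetI)
  qed
  then have "P_category circle (top_of_set ?S) = 2"
  proof (rule P_category_eq_2I)
    have "(1, ?n) \<in> ?S" by simp
    then show "topspace (top_of_set ?S) \<noteq> {}" unfolding topspace_euclidean_subtopology by blast
    show "\<not> contractible_within_to (top_of_set ?S) (topspace (top_of_set ?S)) circle"
      unfolding topspace_euclidean_subtopology by (rule sphere_in_circle_sphere_not_deformable)
  qed
  then show ?thesis by (simp add: round_category_def)
qed

section \<open>The three-dimensional torus\<close>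

text \<open>
  A choice of angle that is continuous away from the positive real axis, whereas \<^const>\<open>Arg\<close> is continuous
  away from the negative one.
\<close>

definition left_arg :: "complex \<Rightarrow> real" where
  "left_arg z = Arg (- z) + pi"

lemma cis_Arg_unit: "norm z = 1 \<Longrightarrow> cis (Arg z) = z"
  by (subst cis_Arg) (auto simp: sgn_div_norm)

lemma cis_left_arg: "norm z = 1 \<Longrightarrow> cis (left_arg z) = z"
  using cis_Arg_unit[of "- z"] by (simp add: left_arg_def cis_mult[symmetric])

lemma continuous_on_Arg_right:
  assumes "continuous_on S f" "\<And>y. y \<in> S \<Longrightarrow> f y \<in> sphere 0 1 \<and> Re (f y) \<ge> 0"
  shows "continuous_on S (\<lambda>y. Arg (f y))"
proof (rule continuous_on_compose2[OF continuous_on_Arg assms(1)], rule image_subsetI)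
  fix y assume "y \<in> S"
  then have "norm (f y) = 1" "Re (f y) \<ge> 0" using assms(2) by auto
  then show "f y \<in> - \<real>\<^sub>\<le>\<^sub>0" by (auto simp: complex_nonpos_Reals_iff cmod_def)
qed

lemma continuous_on_left_arg:
  assumes "continuous_on S f" "\<And>y. y \<in> S \<Longrightarrow> f y \<in> sphere 0 1 \<and> Re (f y) \<le> 1 / 2"
  shows "continuous_on S (\<lambda>y. left_arg (f y))"
proof -
  have "continuous_on S (\<lambda>y. Arg (- f y))"
  proof (rule continuous_on_compose2[OF continuous_on_Arg continuous_on_minus[OF assms(1)]], rule image_subsetI)
    fix y assume "y \<in> S"
    then have "norm (f y) = 1" "Re (f y) \<le> 1 / 2" using assms(2) by auto
    then show "- f y \<in> - \<real>\<^sub>\<le>\<^sub>0"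
      by (auto simp: complex_nonpos_Reals_iff cmod_def power2_eq_1_iff)
  qed
  then show ?thesis unfolding left_arg_def by (rule continuous_on_add[OF _ continuous_on_const])
qed

text \<open>
  A set with continuous angle functions is the image of a subset of the plane, where it contracts linearly
  to the origin.
\<close>

lemma torus_contract_if_args:
  assumes "continuous_on A \<theta>" "continuous_on A \<phi>"
    and eq: "\<And>y. y \<in> A \<Longrightarrow> y = (cis (\<theta> y), cis (\<phi> y))"
  shows "homotopic_with_canon (\<lambda>_. True) A (sphere 0 1 \<times> sphere 0 1) id (\<lambda>_. (1, 1))"
proof (rule homotopic_with_canonI)
  let ?h = "\<lambda>z. (cis ((1 - fst z) * \<theta> (snd z)), cis ((1 - fst z) * \<phi> (snd z)))"
  show "continuous_on ({0..1::real} \<times> A) ?h"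
    by (intro continuous_intros continuous_on_compose2[OF assms(1)] continuous_on_compose2[OF assms(2)]) auto
  show "?h ` ({0..1} \<times> A) \<subseteq> sphere 0 1 \<times> sphere 0 1" by auto
  show "?h (0, x) = id x" if "x \<in> A" for x
    using eq[OF that] by simp
qed simp

text \<open>
  The torus \<open>T\<^sup>2\<close>, seen as a square with opposite edges identified, is the union of a neighbourhood of the
  vertex, of thickened middle parts of the two edges, which are disjoint from each other, and of a smaller
  square.  On each of the three sets both coordinates admit continuous angles.
\<close>

lemma three_torus_cover:
  "has_P_cover circle (top_of_set (sphere (0::complex) 1 \<times> sphere (0::complex) 1 \<times> sphere (0::complex) 1)) 3"
proof -
  let ?C = "sphere (0::complex) 1" and ?T = "sphere (0::complex) 1 \<times> sphere (0::complex) 1"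
  let ?P = "{y \<in> ?T. Re (fst y) \<ge> 1 / 2 \<and> Re (snd y) \<le> 0}"
  let ?Q = "{y \<in> ?T. Re (fst y) \<le> 0 \<and> Re (snd y) \<ge> 1 / 2}"
  define A where "A i = (if i = 0 then {y \<in> ?T. Re (fst y) \<ge> 0 \<and> Re (snd y) \<ge> 0}
    else if i = 1 then ?P \<union> ?Q else {y \<in> ?T. Re (fst y) \<le> 1 / 2 \<and> Re (snd y) \<le> 1 / 2})" for i :: nat
  have clT: "closed ?T" by (intro closed_Times closed_sphere)
  have clc: "closed {y \<in> ?T. f y \<le> a \<and> g y \<le> b}"
    if "continuous_on UNIV f" "continuous_on UNIV g" for f g :: "complex \<times> complex \<Rightarrow> real" and a b
  proof -
    have "closed (?T \<inter> ({y. f y \<le> a} \<inter> {y. g y \<le> b}))"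
      by (intro closed_Int clT closed_Collect_le that continuous_on_const)
    moreover have "?T \<inter> ({y. f y \<le> a} \<inter> {y. g y \<le> b}) = {y \<in> ?T. f y \<le> a \<and> g y \<le> b}" by blast
    ultimately show ?thesis by (simp only:)
  qed
  have clP: "closed ?P"
    using clc[of "\<lambda>y. - Re (fst y)" "\<lambda>y. Re (snd y)" "- (1/2)" 0] by (simp add: continuous_intros)
  have clQ: "closed ?Q"
    using clc[of "\<lambda>y. Re (fst y)" "\<lambda>y. - Re (snd y)" 0 "- (1/2)"] by (simp add: continuous_intros)
  have clA: "closed (A i)" for i
    using clP clQ clc[of "\<lambda>y. - Re (fst y)" "\<lambda>y. - Re (snd y)" 0 0]
      clc[of "\<lambda>y. Re (fst y)" "\<lambda>y. Re (snd y)" "1/2" "1/2"]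
    by (simp add: A_def closed_Un continuous_intros)
  have con0: "homotopic_with_canon (\<lambda>_. True) (A 0) ?T id (\<lambda>_. (1, 1))"
  proof (rule torus_contract_if_args[where \<theta> = "\<lambda>y. Arg (fst y)" and \<phi> = "\<lambda>y. Arg (snd y)"])
    show "continuous_on (A 0) (\<lambda>y. Arg (fst y))" "continuous_on (A 0) (\<lambda>y. Arg (snd y))"
      by (intro continuous_on_Arg_right continuous_intros; auto simp: A_def)+
    show "y = (cis (Arg (fst y)), cis (Arg (snd y)))" if "y \<in> A 0" for y
      using that by (auto simp: A_def cis_Arg_unit)
  qed
  have con2: "homotopic_with_canon (\<lambda>_. True) (A 2) ?T id (\<lambda>_. (1, 1))"
  proof (rule torus_contract_if_args[where \<theta> = "\<lambda>y. left_arg (fst y)" and \<phi> = "\<lambda>y. left_arg (snd y)"])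
    show "continuous_on (A 2) (\<lambda>y. left_arg (fst y))" "continuous_on (A 2) (\<lambda>y. left_arg (snd y))"
      by (intro continuous_on_left_arg continuous_intros; auto simp: A_def)+
    show "y = (cis (left_arg (fst y)), cis (left_arg (snd y)))" if "y \<in> A 2" for y
      using that by (auto simp: A_def cis_left_arg)
  qed
  have con1: "homotopic_with_canon (\<lambda>_. True) (A 1) ?T id (\<lambda>_. (1, 1))"
  proof (rule torus_contract_if_args
      [where \<theta> = "\<lambda>y. if Re (fst y) \<ge> 1 / 2 then Arg (fst y) else left_arg (fst y)"
        and \<phi> = "\<lambda>y. if Re (fst y) \<ge> 1 / 2 then left_arg (snd y) else Arg (snd y)"])
    have A1: "A 1 = ?P \<union> ?Q" by (simp add: A_def)
    have "continuous_on ?P (\<lambda>y. Arg (fst y))" "continuous_on ?Q (\<lambda>y. Arg (snd y))"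
      by (intro continuous_on_Arg_right continuous_intros; auto)+
    moreover have "continuous_on ?P (\<lambda>y. left_arg (snd y))" "continuous_on ?Q (\<lambda>y. left_arg (fst y))"
      by (intro continuous_on_left_arg continuous_intros; auto)+
    ultimately show "continuous_on (A 1) (\<lambda>y. if Re (fst y) \<ge> 1 / 2 then Arg (fst y) else left_arg (fst y))"
      "continuous_on (A 1) (\<lambda>y. if Re (fst y) \<ge> 1 / 2 then left_arg (snd y) else Arg (snd y))"
      unfolding A1 by (intro continuous_on_cases clP clQ; auto)+
    show "y = (cis (if Re (fst y) \<ge> 1 / 2 then Arg (fst y) else left_arg (fst y)),
        cis (if Re (fst y) \<ge> 1 / 2 then left_arg (snd y) else Arg (snd y)))" if "y \<in> A 1" for y
      using that unfolding A1 by (auto simp: cis_left_arg cis_Arg_unit)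
  qed
  have ne: "A 0 \<noteq> {}" "A 1 \<noteq> {}" "A 2 \<noteq> {}"
  proof -
    have "(1, 1) \<in> A 0" "(1, -1) \<in> A 1" "(-1, -1) \<in> A 2" by (simp_all add: A_def)
    then show "A 0 \<noteq> {}" "A 1 \<noteq> {}" "A 2 \<noteq> {}" by blast+
  qed
  have sub: "A i \<subseteq> ?T" for i by (auto simp: A_def)
  note con012 = circle_times_set_deformable[OF sub ne(1) con0] circle_times_set_deformable[OF sub ne(2) con1]
    circle_times_set_deformable[OF sub ne(3) con2]
  have con: "contractible_within_to (top_of_set (?C \<times> ?T)) (?C \<times> A i) circle" if i: "i < 3" for i
  proof -
    have "i = 0 \<or> i = 1 \<or> i = 2" using i by linarith
    then show ?thesis using con012 by (elim disjE) simp_all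
  qed
  have "closedin (top_of_set (?C \<times> ?T)) (?C \<times> A i)" for i
    by (intro closed_subset closed_Times closed_sphere clA Sigma_mono sub) simp
  moreover have "?C \<times> ?T = (\<Union>i<3. ?C \<times> A i)"
  proof
    have "y \<in> A 0 \<union> A 1 \<union> A 2" if "y \<in> ?T" for y
    proof -
      consider "Re (fst y) \<ge> 0 \<and> Re (snd y) \<ge> 0" | "Re (fst y) \<le> 1/2 \<and> Re (snd y) \<le> 1/2"
        | "Re (fst y) \<ge> 1/2 \<and> Re (snd y) \<le> 0" | "Re (fst y) \<le> 0 \<and> Re (snd y) \<ge> 1/2"
        by linarith
      then show ?thesis using that by cases (auto simp: A_def)
    qed
    moreover have "{..<3::nat} = {0, 1, 2}" by auto
    ultimately show "?C \<times> ?T \<subseteq> (\<Union>i<3. ?C \<times> A i)" by auto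
    show "(\<Union>i<3. ?C \<times> A i) \<subseteq> ?C \<times> ?T" using sub by blast
  qed
  ultimately show ?thesis
    unfolding has_P_cover_def topspace_euclidean_subtopology using con
    by (intro exI[of _ "\<lambda>i. ?C \<times> A i"]) simp
qed

abbreviation three_torus :: "(complex \<times> complex \<times> complex) set" where
  "three_torus \<equiv> sphere 0 1 \<times> sphere 0 1 \<times> sphere 0 1"

lemma circle_map_log:
  fixes f :: "'a::real_normed_vector \<Rightarrow> complex"
  assumes "homotopic_with_canon (\<lambda>_. True) S (sphere 0 1) f (\<lambda>_. a)"
  shows "\<exists>g. continuous_on S g \<and> (\<forall>x\<in>S. f x = cis (g x))"
proof -
  have "\<exists>g. continuous_on S g \<and> (\<forall>x\<in>S. f x = exp (\<i> * of_real (g x)))"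
    using inessential_eq_continuous_logarithm_circle[of S f] assms by blast
  then show ?thesis by (simp add: cis_conv_exp)
qed

text \<open>
  The circle is the quotient of the unit interval that identifies the end points.
\<close>

lemma descend_to_circle:
  fixes m :: "real \<Rightarrow> real"
  assumes m: "continuous_on {0..1} m" "m 0 = m 1"
  shows "\<exists>g. continuous_on (sphere (0::complex) 1) g \<and> (\<forall>t\<in>{0..1}. g (cis (2 * pi * t)) = m t)"
proof -
  have q: "quotient_map (top_of_set {0..1::real}) circle (\<lambda>t. cis (2 * pi * t))"
  proof (rule T1_Spaces.continuous_imp_quotient_map)
    have "continuous_on {0..1} (\<lambda>t. cis (2 * pi * t))" by (intro continuous_intros)
    then show "continuous_map (top_of_set {0..1}) circle (\<lambda>t. cis (2 * pi * t))" by auto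
  qed (simp_all add: compact_space_subtopology Hausdorff_space_subtopology circle_eq_cis_image)
  have cm: "continuous_map (top_of_set {0..1}) euclideanreal m" using m(1) by simp
  have fib: "m s = m t" if s: "s \<in> {0..1}" and t: "t \<in> {0..1}" and eq: "cis (2 * pi * s) = cis (2 * pi * t)" for s t
  proof -
    have "cis (2 * pi * (s - t)) = 1"
      using eq by (simp add: right_diff_distrib flip: cis_divide)
    then have "cos (2 * pi * (s - t)) = 1" by (metis cis.sel(1) one_complex.sel(1))
    then obtain n :: int where "2 * pi * (s - t) = of_int n * 2 * pi" using cos_one_2pi_int by metis
    then have n: "s - t = of_int n" by simp
    have st: "0 \<le> s" "s \<le> 1" "0 \<le> t" "t \<le> 1" using s t by simp_all
    then have "real_of_int n \<le> 1" "- 1 \<le> real_of_int n" unfolding n[symmetric] by linarith+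
    then consider "n = 0" | "n = 1" | "n = -1" by linarith
    then show ?thesis
    proof cases
      case 1
      then have "s = t" using n by simp
      then show ?thesis by (rule arg_cong)
    next
      case 2
      then have "s - t = 1" using n by simp
      then have "s = 1" "t = 0" using st by linarith+
      then show ?thesis using m(2) by (simp only:)
    next
      case 3
      then have "s - t = -1" using n by simp
      then have "s = 0" "t = 1" using st by linarith+
      then show ?thesis using m(2) by (simp only:)
    qed
  qed
  have "\<forall>s\<in>topspace (top_of_set {0..1}). \<forall>t\<in>topspace (top_of_set {0..1}).
      cis (2 * pi * s) = cis (2 * pi * t) \<longrightarrow> m s = m t"
    unfolding topspace_euclidean_subtopology by (intro ballI impI fib)
  from quotient_map_factor[OF q cm this] show ?thesis by simp
qed

text \<open>
  On \<open>A\<close> the map \<open>\<pi>\<close> is homotopic to its composite with \<open>f\<close>, and their quotient therefore has a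
  continuous angle \<open>u\<close>.  The composite factors through the circle \<open>f ` A\<close>; along the parametrisation
  of this circle \<open>\<pi>\<close> has an angle \<open>l\<close>, whose increment is \<open>2 \<pi>\<close> times the degree \<open>d\<close>.
\<close>

lemma circle_coordinate_of_deformable:
  fixes T A :: "'a::real_normed_vector set" and \<pi> :: "'a \<Rightarrow> complex"
  assumes f: "homotopic_with_canon (\<lambda>_. True) A T id f"
    and hk: "homeomorphism (f ` A) (sphere (0::complex) 1) h k"
    and \<pi>: "continuous_on T \<pi>" "\<pi> ` T \<subseteq> sphere 0 1"
  shows "\<exists>l u (d::int). continuous_on {0..1::real} l \<and> continuous_on A u \<and> l 1 - l 0 = 2 * pi * d \<and>
    (\<forall>a\<in>A. \<forall>t\<in>{0..1}. h (f a) = cis (2 * pi * t) \<longrightarrow> \<pi> a = cis (l t + u a))"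
proof -
  have fT: "f ` A \<subseteq> T" by (rule homotopic_with_imp_subset2[OF f])
  let ?w = "\<lambda>t. \<pi> (k (cis (2 * pi * t)))"
  have kT: "k z \<in> T" if "z \<in> sphere 0 1" for z
    using homeomorphism_image2[OF hk] fT that by blast
  have cT: "k (cis (2 * pi * t)) \<in> T" for t by (rule kT) simp
  have "continuous_on {0..1} (\<lambda>t. cis (2 * pi * t))" by (intro continuous_intros)
  then have "continuous_on {0..1} (\<lambda>t. k (cis (2 * pi * t)))"
    by (rule continuous_on_compose2[OF homeomorphism_cont2[OF hk]]) (simp add: image_subset_iff)
  then have "continuous_on {0..1} ?w"
    by (rule continuous_on_compose2[OF \<pi>(1)]) (intro image_subsetI cT)
  moreover have "?w t \<in> sphere 0 1" for t by (rule subsetD[OF \<pi>(2) imageI[OF cT]])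
  then have "?w \<in> {0..1} \<rightarrow> sphere 0 1" by (intro funcsetI)
  moreover have "contractible {0..1::real}" by (rule convex_imp_contractible) simp
  ultimately obtain c where "homotopic_with_canon (\<lambda>_. True) {0..1} (sphere 0 1) ?w (\<lambda>_. c)"
    by (rule nullhomotopic_from_contractible)
  from circle_map_log[OF this] obtain l where
    l1: "continuous_on {0..1} l" and l2: "\<forall>t\<in>{0..1}. ?w t = cis (l t)" by (elim exE conjE)
  have l: "continuous_on {0..1} l" "\<And>t. t \<in> {0..1} \<Longrightarrow> ?w t = cis (l t)"
    by (rule l1) (rule bspec[OF l2])
  have "cis (l 1) = cis (l 0)" using l(2)[of 0, symmetric] l(2)[of 1, symmetric] by simp
  then have "cis (l 1 - l 0) = 1" by (simp flip: cis_divide)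
  then have "cos (l 1 - l 0) = 1" by (metis cis.sel(1) one_complex.sel(1))
  then obtain d :: int where "l 1 - l 0 = of_int d * 2 * pi" using cos_one_2pi_int by metis
  then have d: "l 1 - l 0 = 2 * pi * d" by simp
  have "homotopic_with_canon (\<lambda>_. True) A (sphere 0 1) (\<pi> \<circ> id) (\<pi> \<circ> f)"
    by (rule homotopic_with_compose_continuous_left[OF f \<pi>(1)])
       (use \<pi>(2) in \<open>simp add: image_subset_iff_funcset[symmetric]\<close>)
  from homotopic_circlemaps_divide[THEN iffD1, OF this]
  obtain b where "homotopic_with_canon (\<lambda>_. True) A (sphere 0 1) (\<lambda>a. (\<pi> \<circ> id) a / (\<pi> \<circ> f) a) (\<lambda>_. b)"
    by (elim conjE exE)
  from circle_map_log[OF this] obtain u where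
    u1: "continuous_on A u" and "\<forall>a\<in>A. (\<pi> \<circ> id) a / (\<pi> \<circ> f) a = cis (u a)" by (elim conjE exE)
  then have u2: "\<pi> a / \<pi> (f a) = cis (u a)" if "a \<in> A" for a using that by simp
  have "\<pi> a = cis (l t + u a)" if a: "a \<in> A" and t: "t \<in> {0..1}" and ht: "h (f a) = cis (2 * pi * t)" for a t
  proof -
    have "k (cis (2 * pi * t)) = f a"
      using homeomorphism_apply1[OF hk imageI[OF a]] ht by simp
    then have w: "\<pi> (f a) = cis (l t)" using l(2)[OF t] by simp
    then have "\<pi> a = cis (u a) * cis (l t)" using u2[OF a] by (simp add: divide_eq_eq)
    then show ?thesis by (simp add: cis_mult add.commute)
  qed
  then show ?thesis using l(1) u1 d by (intro exI[of _ l] exI[of _ u] exI[of _ d] conjI ballI impI)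
qed

definition cross :: "'a::comm_ring \<times> 'a \<times> 'a \<Rightarrow> 'a \<times> 'a \<times> 'a \<Rightarrow> 'a \<times> 'a \<times> 'a" where
  "cross a b = (case (a, b) of ((a1, a2, a3), (b1, b2, b3)) \<Rightarrow>
     (a2 * b3 - a3 * b2, a3 * b1 - a1 * b3, a1 * b2 - a2 * b1))"

definition dot :: "'a::comm_ring \<times> 'a \<times> 'a \<Rightarrow> 'a \<times> 'a \<times> 'a \<Rightarrow> 'a" where
  "dot a b = (case (a, b) of ((a1, a2, a3), (b1, b2, b3)) \<Rightarrow> a1 * b1 + a2 * b2 + a3 * b3)"

definition torus_point :: "real \<times> real \<times> real \<Rightarrow> complex \<times> complex \<times> complex" where
  "torus_point y = (cis (fst y), cis (fst (snd y)), cis (snd (snd y)))"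

text \<open>
  The class \<open>a\<close> in the first cohomology of \<open>T\<^sup>3\<close>, as a linear form on the universal cover \<open>\<real>\<^sup>3\<close>.
\<close>

definition real_vector :: "int \<times> int \<times> int \<Rightarrow> real \<times> real \<times> real" where
  "real_vector a = (of_int (fst a), of_int (fst (snd a)), of_int (snd (snd a)))"

lemma cis_of_int_mult_cong: "cis x = cis y \<Longrightarrow> cis (of_int n * x) = cis (of_int n * y)"
  by (simp flip: cis_power_int)

text \<open>
  The vector \<open>d\<close> consists of the degrees of the three coordinates on the circle to which \<open>A\<close> deforms.  If
  \<open>a\<close> is orthogonal to \<open>d\<close>, then the combination of the three angles \<open>l1\<close>, \<open>l2\<close>, \<open>l3\<close> with coefficients \<open>a\<close>
  has the same value at both end points and descends to the circle, so the character of \<open>T\<^sup>3\<close> given by \<open>a\<close>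
  has a continuous angle on \<open>A\<close>.
\<close>

lemma integral_class_vanishing_on_deformable:
  assumes A: "A \<subseteq> three_torus" and con: "contractible_within_to (top_of_set three_torus) A circle"
  shows "\<exists>d. \<forall>a. dot a d = 0 \<longrightarrow> (\<exists>v. continuous_on A v \<and>
    (\<forall>y. torus_point y \<in> A \<longrightarrow> cis (dot (real_vector a) y) = cis (v (torus_point y))))"
proof -
  obtain f where f: "homotopic_with_canon (\<lambda>_. True) A three_torus id f" and "f ` A homeomorphic sphere (0::complex) 1"
    using con unfolding contractible_within_to_set_iff[OF A] by (elim exE conjE)
  then obtain h k where hk: "homeomorphism (f ` A) (sphere (0::complex) 1) h k"
    unfolding homeomorphic_def by (elim exE)
  note coord = circle_coordinate_of_deformable[OF f hk]
  have im: "fst ` three_torus \<subseteq> sphere 0 1" "(\<lambda>a. fst (snd a)) ` three_torus \<subseteq> sphere 0 1"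
    "(\<lambda>a. snd (snd a)) ` three_torus \<subseteq> sphere 0 1"
    by auto
  have cont: "continuous_on three_torus fst" "continuous_on three_torus (\<lambda>a. fst (snd a))"
    "continuous_on three_torus (\<lambda>a. snd (snd a))"
    by (intro continuous_intros)+
  obtain l1 u1 and d1 :: int where 1: "continuous_on {0..1::real} l1" "continuous_on A u1" "l1 1 - l1 0 = 2 * pi * d1"
    "\<forall>a\<in>A. \<forall>t\<in>{0..1}. h (f a) = cis (2 * pi * t) \<longrightarrow> fst a = cis (l1 t + u1 a)"
    using coord[OF cont(1) im(1)] by (elim exE conjE)
  obtain l2 u2 and d2 :: int where 2: "continuous_on {0..1::real} l2" "continuous_on A u2" "l2 1 - l2 0 = 2 * pi * d2"
    "\<forall>a\<in>A. \<forall>t\<in>{0..1}. h (f a) = cis (2 * pi * t) \<longrightarrow> fst (snd a) = cis (l2 t + u2 a)"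
    using coord[OF cont(2) im(2)] by (elim exE conjE)
  obtain l3 u3 and d3 :: int where 3: "continuous_on {0..1::real} l3" "continuous_on A u3" "l3 1 - l3 0 = 2 * pi * d3"
    "\<forall>a\<in>A. \<forall>t\<in>{0..1}. h (f a) = cis (2 * pi * t) \<longrightarrow> snd (snd a) = cis (l3 t + u3 a)"
    using coord[OF cont(3) im(3)] by (elim exE conjE)
  have fA: "continuous_on A f" using homotopic_with_imp_continuous[OF f] by (rule conjunct2)
  have hC: "h (f a) \<in> sphere 0 1" if "a \<in> A" for a
    using homeomorphism_image1[OF hk] that by blast
  show ?thesis
  proof (intro exI[of _ "(d1, d2, d3)"] allI impI)
    fix a assume a0: "dot a (d1, d2, d3) = 0"
    obtain a1 a2 a3 where a: "a = (a1, a2, a3)" by (cases a)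
    define m where "m t = a1 * l1 t + a2 * l2 t + a3 * l3 t" for t
    have "m 1 - m 0 = a1 * (l1 1 - l1 0) + a2 * (l2 1 - l2 0) + a3 * (l3 1 - l3 0)"
      by (simp add: m_def algebra_simps)
    also have "\<dots> = 2 * pi * of_int (dot a (d1, d2, d3))"
      unfolding 1(3) 2(3) 3(3) by (simp add: dot_def a algebra_simps)
    finally have m01: "m 0 = m 1" unfolding a0 by simp
    have "continuous_on {0..1} m" unfolding m_def by (intro continuous_intros 1(1) 2(1) 3(1))
    from descend_to_circle[OF this m01] obtain g where
      g: "continuous_on (sphere (0::complex) 1) g" "\<forall>t\<in>{0..1}. g (cis (2 * pi * t)) = m t" by (elim exE conjE)
    define v where "v x = g (h (f x)) + a1 * u1 x + a2 * u2 x + a3 * u3 x" for x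
    have "continuous_on A (\<lambda>x. h (f x))"
      by (rule continuous_on_compose2[OF homeomorphism_cont1[OF hk] fA]) simp
    then have "continuous_on A (\<lambda>x. g (h (f x)))"
      by (rule continuous_on_compose2[OF g(1)]) (intro image_subsetI hC)
    then have "continuous_on A v" unfolding v_def by (intro continuous_intros 1(2) 2(2) 3(2))
    moreover have "cis (dot (real_vector a) y) = cis (v (torus_point y))" if yA: "torus_point y \<in> A" for y
    proof -
      obtain y1 y2 y3 where y: "y = (y1, y2, y3)" by (cases y)
      define x where "x = torus_point y"
      have xA: "x \<in> A" using yA by (simp only: x_def)
      have "h (f x) \<in> (\<lambda>t. cis (2 * pi * t)) ` {0..1}"
        unfolding circle_eq_cis_image by (rule hC[OF xA])
      then obtain t where t: "h (f x) = cis (2 * pi * t)" "t \<in> {0..1}" by (rule imageE)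
      have c: "cis y1 = cis (l1 t + u1 x)" "cis y2 = cis (l2 t + u2 x)" "cis y3 = cis (l3 t + u3 x)"
        using 1(4)[rule_format, OF xA t(2,1)] 2(4)[rule_format, OF xA t(2,1)] 3(4)[rule_format, OF xA t(2,1)]
        by (simp_all add: x_def torus_point_def y)
      have gt: "g (h (f x)) = m t" unfolding t(1) by (rule bspec[OF g(2) t(2)])
      have "cis (dot (real_vector a) y) = cis (a1 * y1) * cis (a2 * y2) * cis (a3 * y3)"
        by (simp add: cis_mult dot_def real_vector_def a y)
      also have "\<dots> = cis (a1 * (l1 t + u1 x)) * cis (a2 * (l2 t + u2 x)) * cis (a3 * (l3 t + u3 x))"
        unfolding cis_of_int_mult_cong[OF c(1)] cis_of_int_mult_cong[OF c(2)] cis_of_int_mult_cong[OF c(3)] ..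
      also have "\<dots> = cis (m t + a1 * u1 x + a2 * u2 x + a3 * u3 x)"
        by (simp add: cis_mult m_def algebra_simps)
      finally show ?thesis unfolding v_def x_def[symmetric] gt .
    qed
    ultimately show "\<exists>v. continuous_on A v \<and>
        (\<forall>y. torus_point y \<in> A \<longrightarrow> cis (dot (real_vector a) y) = cis (v (torus_point y)))"
      by (intro exI[of _ v] conjI allI impI)
  qed
qed

lemma orthogonal_plane:
  fixes d :: "int \<times> int \<times> int"
  shows "\<exists>a b. dot a d = 0 \<and> dot b d = 0 \<and> cross a b \<noteq> 0"
proof -
  obtain d1 d2 d3 where d: "d = (d1, d2, d3)" by (cases d)
  consider "d = 0" | "d1 \<noteq> 0" | "d2 \<noteq> 0" | "d3 \<noteq> 0" unfolding d by (auto simp: zero_prod_def)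
  then show ?thesis
  proof cases
    case 1
    then show ?thesis
      by (intro exI[of _ "(1, 0, 0)"] exI[of _ "(0, 1, 0)"]) (simp add: dot_def cross_def zero_prod_def)
  next
    case 2
    then show ?thesis unfolding d
      by (intro exI[of _ "(d2, - d1, 0)"] exI[of _ "(d3, 0, - d1)"]) (simp add: dot_def cross_def zero_prod_def)
  next
    case 3
    then show ?thesis unfolding d
      by (intro exI[of _ "(d2, - d1, 0)"] exI[of _ "(0, d3, - d2)"]) (simp add: dot_def cross_def zero_prod_def)
  next
    case 4
    then show ?thesis unfolding d
      by (intro exI[of _ "(d3, 0, - d1)"] exI[of _ "(0, d3, - d2)"]) (simp add: dot_def cross_def zero_prod_def)
  qed
qed

lemma cross_eq_0_trans:
  fixes a b c :: "int \<times> int \<times> int"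
  assumes "a \<noteq> 0" "cross a b = 0" "cross a c = 0"
  shows "cross b c = 0"
proof -
  obtain a1 a2 a3 where a: "a = (a1, a2, a3)" by (cases a)
  obtain b1 b2 b3 where b: "b = (b1, b2, b3)" by (cases b)
  obtain c1 c2 c3 where c: "c = (c1, c2, c3)" by (cases c)
  have ab: "a2 * b3 = a3 * b2" "a3 * b1 = a1 * b3" "a1 * b2 = a2 * b1"
    and ac: "a2 * c3 = a3 * c2" "a3 * c1 = a1 * c3" "a1 * c2 = a2 * c1"
    using assms(2,3) by (simp_all add: a b c cross_def zero_prod_def)
  have "a1 * (b2 * c3 - b3 * c2) = 0" "a1 * (b3 * c1 - b1 * c3) = 0" "a1 * (b1 * c2 - b2 * c1) = 0"
    "a2 * (b2 * c3 - b3 * c2) = 0" "a2 * (b3 * c1 - b1 * c3) = 0" "a2 * (b1 * c2 - b2 * c1) = 0"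
    "a3 * (b2 * c3 - b3 * c2) = 0" "a3 * (b3 * c1 - b1 * c3) = 0" "a3 * (b1 * c2 - b2 * c1) = 0"
    using ab ac by algebra+
  then show ?thesis
    using assms(1) by (auto simp: a b c cross_def zero_prod_def)
qed

text \<open>
  For \<open>a \<noteq> 0\<close> orthogonal to \<open>d\<close> and independent \<open>c\<close>, \<open>e\<close> orthogonal to \<open>d'\<close>, not both \<open>c\<close> and \<open>e\<close> can be
  parallel to \<open>a\<close>.
\<close>

lemma independent_orthogonal:
  fixes d d' :: "int \<times> int \<times> int"
  shows "\<exists>a c. dot a d = 0 \<and> dot c d' = 0 \<and> cross a c \<noteq> 0"
proof -
  obtain a b where ab: "dot a d = 0" "cross a b \<noteq> 0" using orthogonal_plane[of d] by blast
  obtain c e where ce: "dot c d' = 0" "dot e d' = 0" "cross c e \<noteq> 0" using orthogonal_plane[of d'] by blast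
  have "a \<noteq> 0" using ab(2) by (auto simp: cross_def zero_prod_def)
  then have "cross a c \<noteq> 0 \<or> cross a e \<noteq> 0" using cross_eq_0_trans ce(3) by blast
  then show ?thesis using ab(1) ce(1,2) by blast
qed

text \<open>
  With \<open>n = a \<times> c\<close>, the vectors \<open>p = (c \<times> n) / |n|\<^sup>2\<close> and \<open>r = (n \<times> a) / |n|\<^sup>2\<close> do it.
\<close>

lemma dual_pair:
  fixes a c :: "real \<times> real \<times> real"
  assumes "cross a c \<noteq> 0"
  shows "\<exists>p r. dot a p = 1 \<and> dot c p = 0 \<and> dot a r = 0 \<and> dot c r = 1"
proof -
  obtain a1 a2 a3 where a: "a = (a1, a2, a3)" by (cases a)
  obtain c1 c2 c3 where c: "c = (c1, c2, c3)" by (cases c)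
  define n1 n2 n3 where "n1 = a2 * c3 - a3 * c2" and "n2 = a3 * c1 - a1 * c3" and "n3 = a1 * c2 - a2 * c1"
  define N where "N = n1\<^sup>2 + n2\<^sup>2 + n3\<^sup>2"
  have "n1 \<noteq> 0 \<or> n2 \<noteq> 0 \<or> n3 \<noteq> 0"
    using assms by (auto simp: a c cross_def zero_prod_def n1_def n2_def n3_def)
  then have N: "N \<noteq> 0" unfolding N_def by (simp add: add_nonneg_eq_0_iff sum_power2_eq_zero_iff)
  define p where "p = ((c2 * n3 - c3 * n2) / N, (c3 * n1 - c1 * n3) / N, (c1 * n2 - c2 * n1) / N)"
  define r where "r = ((n2 * a3 - n3 * a2) / N, (n3 * a1 - n1 * a3) / N, (n1 * a2 - n2 * a1) / N)"
  have "dot a p = (a1 * (c2 * n3 - c3 * n2) + a2 * (c3 * n1 - c1 * n3) + a3 * (c1 * n2 - c2 * n1)) / N"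
    by (simp add: dot_def a p_def add_divide_distrib)
  also have "a1 * (c2 * n3 - c3 * n2) + a2 * (c3 * n1 - c1 * n3) + a3 * (c1 * n2 - c2 * n1) = N"
    unfolding N_def n1_def n2_def n3_def by algebra
  finally have 1: "dot a p = 1" using N by simp
  have "dot c r = (c1 * (n2 * a3 - n3 * a2) + c2 * (n3 * a1 - n1 * a3) + c3 * (n1 * a2 - n2 * a1)) / N"
    by (simp add: dot_def c r_def add_divide_distrib)
  also have "c1 * (n2 * a3 - n3 * a2) + c2 * (n3 * a1 - n1 * a3) + c3 * (n1 * a2 - n2 * a1) = N"
    unfolding N_def n1_def n2_def n3_def by algebra
  finally have 2: "dot c r = 1" using N by simp
  have 3: "dot c p = 0" "dot a r = 0"
    by (simp_all add: dot_def a c p_def r_def add_divide_distrib[symmetric] algebra_simps)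
  show ?thesis using 1 2 3 by blast
qed

lemma dot_linear: "dot a (s *\<^sub>R p + t *\<^sub>R r) = s * dot a p + t * dot a (r :: real \<times> real \<times> real)"
  by (cases a; cases p; cases r) (simp add: dot_def algebra_simps)

lemma cross_real_vector: "cross (real_vector a) (real_vector c) = real_vector (cross a c)"
  by (cases a; cases c) (simp add: cross_def real_vector_def)

lemma real_vector_eq_0_iff: "real_vector a = 0 \<longleftrightarrow> a = 0"
  by (cases a) (simp add: real_vector_def zero_prod_def)

lemma bounded_extension:
  fixes T :: "'a::euclidean_space set" and v :: "'a \<Rightarrow> real"
  assumes "compact T" "closed A" "A \<subseteq> T" "continuous_on A v"
  shows "\<exists>u R. continuous_on T u \<and> (\<forall>x\<in>A. u x = v x) \<and> (\<forall>x\<in>T. \<bar>u x\<bar> \<le> R)"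
proof -
  have "closedin (top_of_set T) A" using assms(2,3) by (intro closed_subset)
  then obtain u where u: "continuous_on T u" "\<And>x. x \<in> A \<Longrightarrow> u x = v x"
    using Tietze_unbounded[OF assms(4)] by blast
  have "bounded (u ` T)" by (rule compact_imp_bounded[OF compact_continuous_image[OF u(1) assms(1)]])
  then obtain R where "\<forall>y\<in>u ` T. norm y \<le> R" unfolding bounded_iff by (elim exE)
  then show ?thesis using u by (intro exI[of _ u] exI[of _ R]) simp
qed

text \<open>
  Choose independent integral classes \<open>a\<close>, \<open>c\<close> whose characters have continuous angles \<open>v\<close> on \<open>A\<close> and \<open>w\<close>
  on \<open>B\<close>, and extend these to bounded functions \<open>v'\<close> and \<open>w'\<close> on \<open>T\<^sup>3\<close>.  On a plane in \<open>\<real>\<^sup>3\<close> on which the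
  linear forms \<open>a\<close> and \<open>c\<close> are coordinates \<open>y\<^sub>1\<close> and \<open>y\<^sub>2\<close>, Brouwer's theorem yields a point with
  \<open>y\<^sub>1 = \<pi> + v'\<close> and \<open>y\<^sub>2 = \<pi> + w'\<close>.  Its image in \<open>T\<^sup>3\<close> is not in \<open>A\<close>, where \<open>y\<^sub>1\<close> and \<open>v'\<close> differ by a
  multiple of \<open>2 \<pi>\<close>, and for the same reason not in \<open>B\<close>.
\<close>

theorem three_torus_not_union_of_two_deformable:
  assumes A: "closed A" "A \<subseteq> three_torus" "contractible_within_to (top_of_set three_torus) A circle"
    and B: "closed B" "B \<subseteq> three_torus" "contractible_within_to (top_of_set three_torus) B circle"
  shows "\<not> three_torus \<subseteq> A \<union> B"
proof
  assume cov: "three_torus \<subseteq> A \<union> B"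
  obtain d where d: "\<forall>a. dot a d = 0 \<longrightarrow> (\<exists>v. continuous_on A v \<and>
    (\<forall>y. torus_point y \<in> A \<longrightarrow> cis (dot (real_vector a) y) = cis (v (torus_point y))))"
    using integral_class_vanishing_on_deformable[OF A(2,3)] by (elim exE)
  obtain d' where d': "\<forall>a. dot a d' = 0 \<longrightarrow> (\<exists>v. continuous_on B v \<and>
    (\<forall>y. torus_point y \<in> B \<longrightarrow> cis (dot (real_vector a) y) = cis (v (torus_point y))))"
    using integral_class_vanishing_on_deformable[OF B(2,3)] by (elim exE)
  obtain a c where ac: "dot a d = 0" "dot c d' = 0" "cross a c \<noteq> 0"
    using independent_orthogonal[of d d'] by (elim exE conjE)
  obtain v where v: "continuous_on A v"
    "\<forall>y. torus_point y \<in> A \<longrightarrow> cis (dot (real_vector a) y) = cis (v (torus_point y))"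
    using d[rule_format, OF ac(1)] by (elim exE conjE)
  obtain w where w: "continuous_on B w"
    "\<forall>y. torus_point y \<in> B \<longrightarrow> cis (dot (real_vector c) y) = cis (w (torus_point y))"
    using d'[rule_format, OF ac(2)] by (elim exE conjE)
  have cT: "compact three_torus" by (intro compact_Times compact_sphere)
  obtain v' R1 where v': "continuous_on three_torus v'" "\<forall>x\<in>A. v' x = v x" "\<forall>x\<in>three_torus. \<bar>v' x\<bar> \<le> R1"
    using bounded_extension[OF cT A(1,2) v(1)] by (elim exE conjE)
  obtain w' R2 where w': "continuous_on three_torus w'" "\<forall>x\<in>B. w' x = w x" "\<forall>x\<in>three_torus. \<bar>w' x\<bar> \<le> R2"
    using bounded_extension[OF cT B(1,2) w(1)] by (elim exE conjE)
  have "cross (real_vector a) (real_vector c) \<noteq> 0"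
    unfolding cross_real_vector real_vector_eq_0_iff by (rule ac(3))
  from dual_pair[OF this] obtain p r where pr: "dot (real_vector a) p = 1" "dot (real_vector c) p = 0"
    "dot (real_vector a) r = 0" "dot (real_vector c) r = 1"
    by (elim exE conjE)
  define X where "X y = torus_point (fst y *\<^sub>R p + snd y *\<^sub>R r)" for y :: "real \<times> real"
  have XT: "X y \<in> three_torus" for y by (simp add: X_def torus_point_def)
  have contX: "continuous_on S X" for S
    unfolding X_def torus_point_def by (intro continuous_intros)
  define F where "F y = (pi + v' (X y), pi + w' (X y))" for y
  define S where "S = {pi - R1..pi + R1} \<times> {pi - R2..pi + R2}"
  have "continuous_on S F"
    unfolding F_def
    by (intro continuous_intros continuous_on_compose2[OF v'(1) contX] continuous_on_compose2[OF w'(1) contX]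
        image_subsetI XT)
  moreover have FS: "F y \<in> S" for y
  proof -
    have "\<bar>v' (X y)\<bar> \<le> R1" "\<bar>w' (X y)\<bar> \<le> R2"
      by (rule bspec[OF v'(3) XT], rule bspec[OF w'(3) XT])
    then show ?thesis by (auto simp: F_def S_def)
  qed
  then have "F \<in> S \<rightarrow> S" "S \<noteq> {}" by auto
  moreover have "compact S" "convex S"
    unfolding S_def by (intro compact_Times compact_Icc, intro convex_Times convex_real_interval)
  ultimately obtain y where y: "F y = y" using brouwer[of S F] by metis
  have fy: "fst y = pi + v' (X y)" "snd y = pi + w' (X y)"
    using arg_cong[OF y, of fst] arg_cong[OF y, of snd] by (simp_all add: F_def)
  have da: "dot (real_vector a) (fst y *\<^sub>R p + snd y *\<^sub>R r) = fst y"
    and dc: "dot (real_vector c) (fst y *\<^sub>R p + snd y *\<^sub>R r) = snd y"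
    unfolding dot_linear pr by simp_all
  have no: "cis (pi + x) \<noteq> cis x" for x
  proof
    assume "cis (pi + x) = cis x"
    then have "- cis x = cis x" by (simp flip: cis_mult)
    then show False using cis_neq_zero[of x] by simp
  qed
  have "X y \<in> A \<or> X y \<in> B" using subsetD[OF cov XT[of y]] by (rule UnE) simp_all
  then show False
  proof
    assume XA: "X y \<in> A"
    have "cis (fst y) = cis (v (X y))"
      using v(2)[rule_format, of "fst y *\<^sub>R p + snd y *\<^sub>R r", folded X_def, OF XA] unfolding da .
    moreover have "v (X y) = v' (X y)" using bspec[OF v'(2) XA] by (rule sym)
    ultimately show False using no[of "v' (X y)"] fy(1) by simp
  next
    assume XB: "X y \<in> B"
    have "cis (snd y) = cis (w (X y))"
      using w(2)[rule_format, of "fst y *\<^sub>R p + snd y *\<^sub>R r", folded X_def, OF XB] unfolding dc .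
    moreover have "w (X y) = w' (X y)" using bspec[OF w'(2) XB] by (rule sym)
    ultimately show False using no[of "w' (X y)"] fy(2) by simp
  qed
qed

text \<open>
  Covers by fewer than two sets are covers by two sets in which a set is repeated, apart from the empty one.
\<close>

theorem round_category_three_torus:
  "round_category (prod_topology circle (prod_topology circle circle)) = 3"
proof -
  let ?T = "top_of_set three_torus"
  have ne: "three_torus \<noteq> {}"
  proof -
    have "(1, 1, 1) \<in> three_torus" by simp
    then show ?thesis by blast
  qed
  have two: False if A: "closedin ?T A" "contractible_within_to ?T A circle"
    and B: "closedin ?T B" "contractible_within_to ?T B circle" and cov: "three_torus = A \<union> B" for A B
  proof -
    have cT: "closed three_torus" by (intro closed_Times closed_sphere)
    have "closed A" "closed B" "A \<subseteq> three_torus" "B \<subseteq> three_torus"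
      using closedin_closed_trans[OF A(1) cT] closedin_closed_trans[OF B(1) cT]
        closedin_imp_subset[OF A(1)] closedin_imp_subset[OF B(1)] by simp_all
    then have "\<not> three_torus \<subseteq> A \<union> B"
      using A(2) B(2) by (intro three_torus_not_union_of_two_deformable)
    then show False using cov by simp
  qed
  have "P_category circle ?T = enat 3"
  proof (rule P_category_eqI[OF three_torus_cover])
    fix j :: nat assume "j < 3"
    show "\<not> has_P_cover circle ?T j"
    proof
      assume "has_P_cover circle ?T j"
      then obtain A where A: "\<forall>i<j. closedin ?T (A i) \<and> contractible_within_to ?T (A i) circle"
        and cov: "three_torus = (\<Union>i<j. A i)"
        unfolding has_P_cover_def topspace_euclidean_subtopology by (elim exE conjE)
      consider "j = 0" | "j = 1" | "j = 2" using \<open>j < 3\<close> by linarith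
      then show False
      proof cases
        case 1
        then show False using cov ne by simp
      next
        case 2
        have "three_torus = A 0 \<union> A 0" using cov unfolding 2 by (simp add: lessThan_Suc)
        then show False using A 2 by (intro two[of "A 0" "A 0"]) simp_all
      next
        case 3
        have "three_torus = A 0 \<union> A 1" using cov unfolding 3 by (auto simp: numeral_2_eq_2 lessThan_Suc)
        then show False using A 3 by (intro two[of "A 0" "A 1"]) simp_all
      qed
    qed
  qed
  moreover have "(prod_topology circle (prod_topology circle circle)) = ?T" by simp
  ultimately show ?thesis by (simp add: round_category_def numeral_eq_enat)
qed

section \<open>The round category of closed 3-manifolds\<close>

lemma round_category_homeomorphic:
  "M homeomorphic_space N \<Longrightarrow> round_category M = round_category N"
  unfolding round_category_def by (rule P_category_homeomorphic)

theorem proposition1p12: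
  fixes M :: "'a topology"
  assumes "closed_connected_3_manifold M"
  shows "(M homeomorphic_space top_of_set S3 \<or>
          M homeomorphic_space prod_topology circle (top_of_set (sphere (0 :: real^3) 1)) \<or>
          M homeomorphic_space real_projective_3_space \<or>
          lens_space_as_quotient M
          \<longrightarrow> round_category M = 2) \<and>
         (M homeomorphic_space prod_topology circle (prod_topology circle circle)
          \<longrightarrow> round_category M = 3) \<and>
         (\<not> M homeomorphic_space top_of_set S3 \<and>
          \<not> M homeomorphic_space prod_topology circle (top_of_set (sphere (0 :: real^3) 1)) \<and>
          \<not> M homeomorphic_space real_projective_3_space \<and>
          \<not> lens_space_as_quotient M \<and>
          \<not> M homeomorphic_space prod_topology circle (prod_topology circle circle)
          \<longrightarrow> round_category M \<le> 4)"
proof (intro conjI impI)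
  assume "M homeomorphic_space top_of_set S3 \<or>
    M homeomorphic_space prod_topology circle (top_of_set (sphere (0 :: real^3) 1)) \<or>
    M homeomorphic_space real_projective_3_space \<or> lens_space_as_quotient M"
  then show "round_category M = 2"
  proof (elim disjE)
    assume "M homeomorphic_space top_of_set S3"
    then have "M homeomorphic_space lens_space 1 1"
      by (rule homeomorphic_space_trans[OF _ S3_homeomorphic_lens_space])
    then have "round_category M = round_category (lens_space 1 1)" by (rule round_category_homeomorphic)
    then show ?thesis using round_category_lens_space[of 1 1] by simp
  next
    assume "M homeomorphic_space prod_topology circle (top_of_set (sphere (0 :: real^3) 1))"
    then have "round_category M = round_category (prod_topology circle (top_of_set (sphere (0 :: real^3) 1)))"
      by (rule round_category_homeomorphic)
    then show ?thesis using round_category_circle_times_sphere by (rule trans)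
  next
    assume "M homeomorphic_space real_projective_3_space"
    then have "M homeomorphic_space lens_space 2 1"
      by (rule homeomorphic_space_trans[OF _ real_projective_3_space_homeomorphic_lens_space])
    then have "round_category M = round_category (lens_space 2 1)" by (rule round_category_homeomorphic)
    then show ?thesis using round_category_lens_space[of 2 1] by simp
  next
    assume "lens_space_as_quotient M"
    then obtain p q where p: "p > 0" "coprime (int p) q" and "M homeomorphic_space lens_space p q"
      unfolding lens_space_as_quotient_iff by (elim exE conjE)
    then have "round_category M = round_category (lens_space p q)" by (intro round_category_homeomorphic)
    then show ?thesis using round_category_lens_space[OF p] by (rule trans)
  qed
next
  assume "M homeomorphic_space prod_topology circle (prod_topology circle circle)"
  then have "round_category M = round_category (prod_topology circle (prod_topology circle circle))"
    by (rule round_category_homeomorphic)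
  then show "round_category M = 3" using round_category_three_torus by (rule trans)
next
  show "round_category M \<le> 4"
    using P_category_le[OF closed_3_manifold_circle_cover[OF assms]]
    by (simp add: round_category_def numeral_eq_enat)
qed

end
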